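(* Let $V$ be a real vector space of dimension $n$, $L\subset V$ a lattice of rank $n$, $p$ a prime, and $1\le k\le n-1$. Let $P$ be a nonsingular $n$-dimensional lattice polytope with respect to $L$. Let $f$ be a face of $P$ and let $\pi=(\pi(F))_{F\supseteq f}$ assign a positive integer to each facet $F$ of $P$ containing $f$, with $\sum_{F\supseteq f}\pi(F)=l$. Then \[ \sum_{M\in\mathscr{L}_k}A_M(f,\pi)\,\partial_f^{\pi}\operatorname{Vol}_M P^{M}(h)\Bigr|_{h=0}=\nu_{n,k,n-l}(p)\,A_L(f,\pi)\,\partial_f^{\pi}\operatorname{Vol}_L P^{L}(h)\Bigr|_{h=0}. \]
   Context: A lattice polytope $P$ w.r.t. $L$ is a full-dimensional convex polytope with vertices in $L$; it is simple if each vertex lies on exactly $n$ edges, and nonsingular if at each vertex the primitive lattice vectors along the $n$ edges form a $\mathbb{Z}$-basis of $L$. For a lattice $L\subsetneq M\subsetneq p^{-1}L$ let $\overline M=M/L\subset p^{-1}L/L\cong\mathbb{F}_p^n$, and let $\mathscr{L}_k$ be the set of such $M$ with $\dim\overline M=k$. For $0\le j\le n$, $\nu_{n,k,j}(p)=\sum_{W\subset\mathbb{F}_p^n,\ \dim W=k}p^{\dim(W\cap U)}$ for any fixed $j$-dimensional $U\subset\mathbb{F}_p^n$. For a lattice $N$ (here $N=L$ or $N\in\mathscr{L}_k$; $P$ has vertices in $N$ since $L\subset N$) let $N^*\subset V^*$ be the dual lattice. For each facet $F$ of $P$, let $u_F^N\in N^*$ be the primitive inward normal of $F$ and $\lambda_F^N$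 the number with $F\subset\{x:\langle u_F^N,x\rangle+\lambda_F^N=0\}$. For real variables $h=(h_F)_F$ indexed by facets, $P^N(h)=\{x:\langle u_F^N,x\rangle+\lambda_F^N+h_F\ge0\ \forall F\}$, and $\operatorname{Vol}_N$ is Lebesgue measure normalized so that a fundamental domain of $N$ has volume $1$; for small $h$, $\operatorname{Vol}_N P^N(h)$ is a polynomial in $h$. The operator $\partial_f^\pi=\prod_{F\supseteq f}(\partial/\partial h_F)^{\pi(F)}$. For $a\in\mathbb{C}$ define numbers $c(a,m)$ by the formal expansion $\frac{x}{1-a e^{-x}}=\sum_{m\ge0}c(a,m)x^m$. Let $\Gamma^N_f$ be the set of $g\in N^*$ of the form $g=\sum_{F\supseteq f}\rho_F u_F^N$ with $0\le\rho_F<1$ (the $u_F^N$, $F\supseteq f$, are linearly independent since $P$ is simple), and for such $g$ put $a_F(g)=\exp(2\pi i\rho_F)$. Define \[ A_N(f,\pi)=\sum_{g\in\Gamma^N_f}\prod_{F\supseteq f}c\bigl(a_F(g),\pi(F)\bigr). \] The facets and faces of $P$ are the same whether $P$ is regarded w.r.t. $L$ or $M$, so the variables $h_F$ and the face $f$ are common to all terms. *)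

theory Defs
  imports "HOL-Analysis.Analysis" "HOL-Computational_Algebra.Formal_Power_Series"
begin

definition lattice_of :: "real^'n^'n \<Rightarrow> (real^'n) set" where
  "lattice_of B = {B *v (\<chi> i. real_of_int (z $ i)) | z :: int^'n. True}"

definition full_lattice :: "(real^'n) set \<Rightarrow> bool" where
  "full_lattice N \<longleftrightarrow> (\<exists>B. invertible B \<and> N = lattice_of B)"

definition covol :: "(real^'n) set \<Rightarrow> real" where
  "covol N = (SOME c. \<exists>B. invertible B \<and> N = lattice_of B \<and> c = \<bar>det B\<bar>)"

text \<open>Dual lattice, V* identified with V via the standard inner product.\<close>
definition dual_lattice :: "(real^'n) set \<Rightarrow> (real^'n) set" where
  "dual_lattice N = {u. \<forall>x\<in>N. u \<bullet> x \<in> \<int>}"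

definition primitive_in :: "(real^'n) set \<Rightarrow> real^'n \<Rightarrow> bool" where
  "primitive_in N u \<longleftrightarrow> u \<in> N \<and> u \<noteq> 0 \<and>
     (\<forall>m::int. \<forall>y\<in>N. u = of_int m *\<^sub>R y \<longrightarrow> \<bar>m\<bar> = 1)"

definition Zbasis :: "(real^'n) set \<Rightarrow> (real^'n) set \<Rightarrow> bool" where
  "Zbasis N S \<longleftrightarrow> independent S \<and>
     N = {\<Sum>b\<in>S. real_of_int (c b) *\<^sub>R b | c. True}"

definition lattice_polytope :: "(real^'n) set \<Rightarrow> (real^'n) set \<Rightarrow> bool" where
  "lattice_polytope L P \<longleftrightarrow> polytope P \<and> aff_dim P = int CARD('n) \<and>
     (\<forall>v. v extreme_point_of P \<longrightarrow> v \<in> L)"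

definition simple_polytope :: "(real^'n) set \<Rightarrow> bool" where
  "simple_polytope P \<longleftrightarrow>
     (\<forall>v. v extreme_point_of P \<longrightarrow> card {e. e edge_of P \<and> v \<in> e} = CARD('n))"

definition edge_dirs :: "(real^'n) set \<Rightarrow> (real^'n) set \<Rightarrow> real^'n \<Rightarrow> (real^'n) set" where
  "edge_dirs L P v = {u. primitive_in L u \<and>
     (\<exists>e w t. e edge_of P \<and> v \<in> e \<and> w \<in> e \<and> w \<noteq> v \<and> t > 0 \<and> u = t *\<^sub>R (w - v))}"

definition nonsingular_polytope :: "(real^'n) set \<Rightarrow> (real^'n) set \<Rightarrow> bool" where
  "nonsingular_polytope L P \<longleftrightarrow> simple_polytope P \<and>
     (\<forall>v. v extreme_point_of P \<longrightarrow> Zbasis L (edge_dirs L P v))"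

definition facet_normal :: "(real^'n) set \<Rightarrow> (real^'n) set \<Rightarrow> (real^'n) set \<Rightarrow> real^'n" where
  "facet_normal N P F = (THE u. primitive_in (dual_lattice N) u \<and>
     (\<exists>lam. (\<forall>x\<in>F. u \<bullet> x + lam = 0) \<and> (\<forall>x\<in>P. u \<bullet> x + lam \<ge> 0)))"

definition facet_const :: "(real^'n) set \<Rightarrow> (real^'n) set \<Rightarrow> (real^'n) set \<Rightarrow> real" where
  "facet_const N P F = (THE lam. \<forall>x\<in>F. facet_normal N P F \<bullet> x + lam = 0)"

definition PN :: "(real^'n) set \<Rightarrow> (real^'n) set \<Rightarrow> ((real^'n) set \<Rightarrow> real) \<Rightarrow> (real^'n) set" where
  "PN N P h = {x. \<forall>F. F facet_of P \<longrightarrow>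
     facet_normal N P F \<bullet> x + facet_const N P F + h F \<ge> 0}"

definition VolN :: "(real^'n) set \<Rightarrow> (real^'n) set \<Rightarrow> real" where
  "VolN N S = measure lebesgue S / covol N"

definition volfun :: "(real^'n) set \<Rightarrow> (real^'n) set \<Rightarrow> ((real^'n) set \<Rightarrow> real) \<Rightarrow> real" where
  "volfun N P = (\<lambda>h. VolN N (PN N P h))"

definition pd :: "'a \<Rightarrow> (('a \<Rightarrow> real) \<Rightarrow> real) \<Rightarrow> (('a \<Rightarrow> real) \<Rightarrow> real)" where
  "pd F g = (\<lambda>h. deriv (\<lambda>t. g (h(F := h F + t))) 0)"

fun pdl :: "'a list \<Rightarrow> (('a \<Rightarrow> real) \<Rightarrow> real) \<Rightarrow> (('a \<Rightarrow> real) \<Rightarrow> real)" where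
  "pdl [] g = g"
| "pdl (F # Fs) g = pd F (pdl Fs g)"

definition face_deriv :: "(real^'n) set \<Rightarrow> (real^'n) set \<Rightarrow> ((real^'n) set \<Rightarrow> nat)
    \<Rightarrow> (((real^'n) set \<Rightarrow> real) \<Rightarrow> real) \<Rightarrow> real" where
  "face_deriv P f \<pi> g = pdl (SOME xs. \<forall>F. count_list xs F =
       (if F facet_of P \<and> f \<subseteq> F then \<pi> F else 0)) g (\<lambda>_. 0)"

definition c_coef :: "complex \<Rightarrow> nat \<Rightarrow> complex" where
  "c_coef a m = fps_nth (fps_X / (1 - fps_const a * fps_exp (-1))) m"

definition facets_through :: "(real^'n) set \<Rightarrow> (real^'n) set \<Rightarrow> (real^'n) set set" where
  "facets_through P f = {F. F facet_of P \<and> f \<subseteq> F}"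

definition Gamma :: "(real^'n) set \<Rightarrow> (real^'n) set \<Rightarrow> (real^'n) set \<Rightarrow> (real^'n) set" where
  "Gamma N P f = {g \<in> dual_lattice N. \<exists>\<rho>.
     (\<forall>F\<in>facets_through P f. 0 \<le> \<rho> F \<and> \<rho> F < 1) \<and>
     g = (\<Sum>F\<in>facets_through P f. \<rho> F *\<^sub>R facet_normal N P F)}"

text \<open>The coefficients \<rho>_F of g (unique by linear independence of the normals).\<close>
definition rho :: "(real^'n) set \<Rightarrow> (real^'n) set \<Rightarrow> (real^'n) set \<Rightarrow> real^'n
    \<Rightarrow> (real^'n) set \<Rightarrow> real" where
  "rho N P f g = (THE \<rho>. (\<forall>F. F \<notin> facets_through P f \<longrightarrow> \<rho> F = 0) \<and>
     g = (\<Sum>F\<in>facets_through P f. \<rho> F *\<^sub>R facet_normal N P F))"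

definition A_coef :: "(real^'n) set \<Rightarrow> (real^'n) set \<Rightarrow> (real^'n) set \<Rightarrow> ((real^'n) set \<Rightarrow> nat)
    \<Rightarrow> complex" where
  "A_coef N P f \<pi> = (\<Sum>g\<in>Gamma N P f. \<Prod>F\<in>facets_through P f.
     c_coef (exp (2 * of_real pi * \<i> * of_real (rho N P f g F))) (\<pi> F))"

definition Lk :: "(real^'n) set \<Rightarrow> nat \<Rightarrow> nat \<Rightarrow> (real^'n) set set" where
  "Lk L p k = {M. full_lattice M \<and> L \<subset> M \<and> M \<subset> (\<lambda>x. inverse (real p) *\<^sub>R x) ` L \<and>
     card ((\<lambda>x. (\<lambda>y. x + y) ` L) ` M) = p ^ k}"

definition Fp_space :: "nat \<Rightarrow> nat \<Rightarrow> (nat \<Rightarrow> int) set" where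
  "Fp_space n p = {x. (\<forall>i<n. 0 \<le> x i \<and> x i < int p) \<and> (\<forall>i\<ge>n. x i = 0)}"

definition Fp_subspace :: "nat \<Rightarrow> nat \<Rightarrow> (nat \<Rightarrow> int) set \<Rightarrow> bool" where
  "Fp_subspace n p W \<longleftrightarrow> W \<subseteq> Fp_space n p \<and> (\<lambda>_. 0) \<in> W \<and>
     (\<forall>x\<in>W. \<forall>y\<in>W. (\<lambda>i. (x i + y i) mod int p) \<in> W) \<and>
     (\<forall>c::int. \<forall>x\<in>W. (\<lambda>i. (c * x i) mod int p) \<in> W)"

definition Fp_dim :: "nat \<Rightarrow> (nat \<Rightarrow> int) set \<Rightarrow> nat" where
  "Fp_dim p W = (THE d. card W = p ^ d)"

definition Fp_U :: "nat \<Rightarrow> nat \<Rightarrow> nat \<Rightarrow> (nat \<Rightarrow> int) set" where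
  "Fp_U n p j = {x \<in> Fp_space n p. \<forall>i\<ge>j. x i = 0}"

definition nu :: "nat \<Rightarrow> nat \<Rightarrow> nat \<Rightarrow> nat \<Rightarrow> nat" where
  "nu n k j p = (\<Sum>W\<in>{W. Fp_subspace n p W \<and> Fp_dim p W = k}. p ^ Fp_dim p (W \<inter> Fp_U n p j))"

end

(*
Proof idea. Each coefficient of the sum lives at one vertex v of f. There P is locally a unimodular
cone: the facets through v are the hyperplanes of the basis u of the dual lattice that is dual to
the primitive edge vectors. For a superlattice M of L inside p^-1 L, the normal of a facet is
multiplied by d = 1 or d = p according to whether it lies in the dual of M, so the derivative of
the volume for M is p^k * prod d_F^(-pi(F)) times that for L.

On the arithmetic side, comparing coefficients in sum_j x/(1 - zeta^j e^-x) = p x/(1 - e^(-p x))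
gives sum_j c(zeta^j, m) = p^m c(1, m). Hence A_M(f, pi) * prod d_F^(-pi(F)) is p^-l times the sum of
prod_F c(zeta^(y_F), pi(F)) over all y in F_p^n supported on the facets through f and orthogonal to
M/L. Summing over M, the number of k-dimensional subspaces orthogonal to y only depends on whether
y = 0, and the same two numbers compute nu by orthogonality of characters.

For l > n both sides vanish, because the volume is locally a polynomial of degree at most n. This
is seen without a formula for the volume: mixed differences in the directions of facets without a
common point vanish for small steps, translating P trades a repeated facet for facets not yet used,
so all (n+1)-fold mixed differences vanish near 0; averaging the difference equation over its step
then shows that partial derivatives are linear combinations of shifts.
*)

theory Submission
  imports Defs
begin

section \<open>Edges and the cone at a vertex\<close>

text \<open>What makes the two sides comparable: summed over all k-dimensional subspaces W and all y
  in a coordinate space V orthogonal to W, a function \<open>G\<close> enters only through its value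
  at 0 and its total over V. For the products of the \<open>c_coef\<close> over the facets through
  \<open>f\<close> the total is \<open>p ^ l\<close> times the value at 0, because a facet F
  contributes \<open>p ^ \<pi> F\<close> and not just \<open>p\<close>. For the constant 1 on an
  l-dimensional V the ratio is \<open>p ^ l\<close> as well. This is why the sum of the exponents,
  and not the codimension of \<open>f\<close>, selects the term of \<open>nu\<close>, and why the
  comparison requires l <= n. On the analytic side the obstacle is that \<open>pd\<close> is a
  \<open>deriv\<close>, which carries information only where a derivative exists. Passing from h_F
  to h_F / d_F by the chain rule therefore calls for differentiability of all iterated partial
  derivatives in a whole neighbourhood of 0. Finite differences supply this together with the bound
  on the degree, and the argument needs only translation invariance, dominated convergence and the
  local simplicity of P.\<close>

text \<open>The intersection of all faces through \<open>w\<close> works: on its relative boundary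
  \<open>w\<close> would lie in a facet of it, which is again a face of \<open>P\<close> through
  \<open>w\<close> and so contains the intersection.\<close>

lemma obtain_minimal_face:
  fixes P :: "'a::euclidean_space set"
  assumes "polytope P" "w \<in> P"
  obtains G where "G face_of P" "w \<in> rel_interior G"
proof -
  define G where "G = \<Inter>{F. F face_of P \<and> w \<in> F}"
  have P: "P face_of P" by (simp add: face_of_refl polytope_imp_convex assms)
  have G: "G face_of P"
    unfolding G_def using P assms by (intro face_of_Inter) auto
  have wG: "w \<in> G" by (auto simp: G_def)
  have polG: "polytope G" using G assms face_of_polytope_polytope by blast
  have "w \<in> rel_interior G"
  proof (rule ccontr)
    assume "w \<notin> rel_interior G"
    then have "w \<in> rel_frontier G"
      using wG closure_subset by (auto simp: rel_frontier_def)
    then obtain F where F: "F facet_of G" "w \<in> F"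
      using rel_frontier_of_polyhedron polG polytope_imp_polyhedron by blast
    then have "F face_of P" using G face_of_trans facet_of_imp_face_of by blast
    then have "G \<subseteq> F" using F by (auto simp: G_def)
    moreover have "F \<subseteq> G" using F(1) by (rule facet_of_imp_subset)
    ultimately have "F = G" by simp
    then show False using F(1) by simp
  qed
  then show ?thesis using that G by blast
qed

text \<open>Let \<open>G\<close> be the face with \<open>w\<close> in its relative interior. In
  dimension 0 the point \<open>w\<close> would be a vertex on the hyperplane; in dimension at least
  2 the slice would contain a segment around \<open>w\<close>. Only dimension 1 remains.\<close>

lemma extreme_point_of_slice_in_edge:
  fixes P :: "'a::euclidean_space set"
  assumes P: "polytope P"
    and w: "w extreme_point_of (P \<inter> {x. a \<bullet> x = b})"
    and nov: "\<And>z. z extreme_point_of P \<Longrightarrow> a \<bullet> z \<noteq> b"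
  shows "\<exists>e. e edge_of P \<and> w \<in> e"
proof -
  have wP: "w \<in> P" and wb: "a \<bullet> w = b" using w by (auto simp: extreme_point_of_def)
  obtain G where G: "G face_of P" "w \<in> rel_interior G"
    using obtain_minimal_face[OF P wP] by blast
  have wG: "w \<in> G" using G rel_interior_subset by blast
  have "aff_dim G \<noteq> 0"
  proof
    assume "aff_dim G = 0"
    then have "G = {w}" using wG aff_dim_eq_0 by (metis singletonD)
    then have "w extreme_point_of P" using G face_of_singleton by blast
    then show False using nov wb by blast
  qed
  moreover have "aff_dim G \<ge> 0" using wG aff_dim_negative_iff
    by (metis empty_iff linorder_not_less)
  moreover have "\<not> aff_dim G \<ge> 2"
  proof
    assume 2: "aff_dim G \<ge> 2"
    define H where "H = affine hull G \<inter> {x. a \<bullet> x = b}"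
    have wH: "w \<in> H" using wG wb by (auto simp: H_def hull_inc)
    have "aff_dim H \<ge> 1"
      using 2 wH aff_dim_affine_Int_hyperplane[of "affine hull G" a b]
      by (auto simp: H_def affine_affine_hull split: if_splits)
    then have "H \<noteq> {w}" using aff_dim_sing[of w] by auto
    then obtain q where q: "q \<in> H" "q \<noteq> w" using wH by blast
    obtain \<epsilon> where \<epsilon>: "\<epsilon> > 0" "cball w \<epsilon> \<inter> affine hull G \<subseteq> G"
      using G(2) unfolding rel_interior_cball by blast
    \<comment> \<open>Moving from \<open>w\<close> towards \<open>q\<close> and away from it by this
      multiple gives two points at distance \<open>\<epsilon>\<close>, both still in
      \<open>G\<close>, with midpoint \<open>w\<close>.\<close>
    define s where "s = \<epsilon> / norm (q - w)"
    have s: "s > 0" using \<epsilon> q by (simp add: s_def)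
    have aff: "affine (affine hull G)" by simp
    have qa: "q \<in> affine hull G" "w \<in> affine hull G" using q wG by (auto simp: H_def hull_inc)
    have mem: "w + t *\<^sub>R (q - w) \<in> affine hull G" for t
      using mem_affine_3_minus[OF aff qa(2) qa(1) qa(2)] by simp
    have in1: "w + t *\<^sub>R (q - w) \<in> P \<inter> {x. a \<bullet> x = b}" if "\<bar>t\<bar> = s" for t
    proof -
      have "dist w (w + t *\<^sub>R (q - w)) \<le> \<epsilon>" using that q \<epsilon> by (simp add: s_def dist_norm)
      then have "w + t *\<^sub>R (q - w) \<in> G" using mem \<epsilon> by (auto simp: mem_cball)
      moreover have "a \<bullet> (w + t *\<^sub>R (q - w)) = b"
        using q wb by (simp add: H_def inner_add_right inner_diff_right)
      ultimately show ?thesis using G face_of_imp_subset by blast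
    qed
    define x where "x = w + s *\<^sub>R (q - w)"
    define y where "y = w + (- s) *\<^sub>R (q - w)"
    have "x \<in> P \<inter> {x. a \<bullet> x = b}" "y \<in> P \<inter> {x. a \<bullet> x = b}"
      using in1[of s] in1[of "-s"] s by (auto simp: x_def y_def)
    moreover have "w \<in> open_segment x y"
    proof -
      have "x - y = (2 * s) *\<^sub>R (q - w)"
        unfolding x_def y_def mult_2 scaleR_add_left by simp
      then have "x \<noteq> y" using s q by auto
      moreover have "x + y = 2 *\<^sub>R w"
        unfolding x_def y_def scaleR_2 by simp
      then have "w = midpoint x y"
        by (simp add: midpoint_def)
      ultimately show ?thesis by simp
    qed
    ultimately show False using w unfolding extreme_point_of_def by blast
  qed
  ultimately have "aff_dim G = 1" by linarith
  then show ?thesis using G wG by (auto simp: edge_of_def)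
qed

text \<open>A vertex figure argument: a hyperplane separating \<open>v\<close> from the other vertices meets \<open>P\<close>
  in a polytope whose vertices lie on the edges through \<open>v\<close>.\<close>

lemma inner_nonneg_of_edges:
  fixes P :: "'a::euclidean_space set"
  assumes P: "polytope P" and v: "v extreme_point_of P" and x: "x \<in> P"
    and edges: "\<And>e w. e edge_of P \<Longrightarrow> v \<in> e \<Longrightarrow> w \<in> e \<Longrightarrow> u \<bullet> (w - v) \<ge> 0"
  shows "u \<bullet> (x - v) \<ge> 0"
proof -
  define V where "V = {x. x extreme_point_of P}"
  have cP: "compact P" "convex P" using P polytope_imp_compact polytope_imp_convex by auto
  have PV: "P = convex hull V"
    unfolding V_def using cP by (rule Krein_Milman_Minkowski)
  have finV: "finite V" unfolding V_def
    using P finite_polyhedron_extreme_points polytope_imp_polyhedron by blast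
  have vV: "v \<in> V" using v by (simp add: V_def)
  \<comment> \<open>An extreme point is not in the hull of the other vertices, so \<open>v\<close>
    and \<open>Q\<close> can be separated strictly.\<close>
  define Q where "Q = convex hull (V - {v})"
  have vQ: "v \<notin> Q"
  proof
    assume "v \<in> Q"
    then have "convex hull V = convex hull (V - {v})"
      using hull_redundant[of v convex "V - {v}"] vV by (simp add: Q_def insert_absorb)
    then have "v extreme_point_of convex hull (V - {v})" using v PV by simp
    then show False using extreme_point_of_convex_hull by blast
  qed
  show ?thesis
  proof (cases "V - {v} = {}")
    case True
    then have "V = {v}" using vV by blast
    then show ?thesis using PV x by simp
  next
    case False
    have "convex Q" "closed Q"
      using finV by (simp_all add: Q_def compact_imp_closed finite_imp_compact_convex_hull)
    then obtain a b where ab: "a \<bullet> v < b" "\<And>z. z \<in> Q \<Longrightarrow> b < a \<bullet> z"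
      using separating_hyperplane_closed_point[of Q v] vQ by metis
    have "x \<in> convex hull (insert v (V - {v}))"
      using x PV insert_Diff[OF vV] by metis
    then obtain \<alpha> \<beta> z where z: "z \<in> Q" "\<alpha> \<ge> 0" "\<beta> \<ge> 0" "\<alpha> + \<beta> = 1" "x = \<alpha> *\<^sub>R v + \<beta> *\<^sub>R z"
      unfolding convex_hull_insert[OF False] Q_def by blast
    have zP: "z \<in> P" using z(1) PV hull_mono[of "V - {v}" V convex] by (auto simp: Q_def)
    have vP: "v \<in> P" using v by (simp add: extreme_point_of_def)
    \<comment> \<open>\<open>y\<close> is the point where the segment from \<open>v\<close> to
      \<open>z\<close> crosses the separating hyperplane.\<close>
    define \<tau> where "\<tau> = (b - a \<bullet> v) / (a \<bullet> z - a \<bullet> v)"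
    define y where "y = v + \<tau> *\<^sub>R (z - v)"
    have \<tau>: "\<tau> > 0" "\<tau> \<le> 1" using ab(1) ab(2)[OF z(1)] by (simp_all add: \<tau>_def)
    have "y = (1 - \<tau>) *\<^sub>R v + \<tau> *\<^sub>R z" by (simp add: y_def algebra_simps)
    then have yP: "y \<in> P"
      using cP(2) vP zP \<tau> by (simp add: convex_alt)
    have "a \<bullet> y = a \<bullet> v + \<tau> * (a \<bullet> z - a \<bullet> v)"
      by (simp add: y_def inner_add_right inner_diff_right)
    then have "a \<bullet> y = b" using ab(1) ab(2)[OF z(1)] by (simp add: \<tau>_def)
    then have "y \<in> P \<inter> {x. a \<bullet> x = b}" using yP by simp
    also have "P \<inter> {x. a \<bullet> x = b} = convex hull {w. w extreme_point_of (P \<inter> {x. a \<bullet> x = b})}"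
      by (intro Krein_Milman_Minkowski compact_Int_closed cP convex_Int closed_hyperplane convex_hyperplane)
    also have "\<dots> \<subseteq> {w. u \<bullet> w \<ge> u \<bullet> v}"
    proof (intro hull_minimal convex_halfspace_ge subsetI)
      fix w assume "w \<in> {w. w extreme_point_of (P \<inter> {x. a \<bullet> x = b})}"
      then have w: "w extreme_point_of (P \<inter> {x. a \<bullet> x = b})" by simp
      have "a \<bullet> z \<noteq> b" if "z extreme_point_of P" for z
      proof (cases "z = v")
        case True then show ?thesis using ab by simp
      next
        case False
        then have "z \<in> Q" using that by (simp add: Q_def V_def hull_inc)
        then show ?thesis using ab by force
      qed
      from extreme_point_of_slice_in_edge[OF P w this]
      obtain e where e: "e edge_of P" "w \<in> e" by blast
      have eP: "e face_of P" using e by (simp add: edge_of_def)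
      \<comment> \<open>An edge avoiding \<open>v\<close> is spanned by other vertices, so it would
        lie in \<open>Q\<close>, strictly beyond the hyperplane that contains
        \<open>w\<close>.\<close>
      have "v \<in> e"
      proof (rule ccontr)
        assume "v \<notin> e"
        have "compact e" "convex e"
          using eP cP face_of_imp_compact face_of_imp_convex by auto
        then have "e = convex hull {x. x extreme_point_of e}"
          by (rule Krein_Milman_Minkowski)
        also have "\<dots> \<subseteq> Q" unfolding Q_def
        proof (rule hull_mono)
          show "{x. x extreme_point_of e} \<subseteq> V - {v}"
            using \<open>v \<notin> e\<close> extreme_point_of_face[OF eP] by (auto simp: V_def)
        qed
        finally have "b < a \<bullet> w" using e ab by blast
        then show False using w by (auto simp: extreme_point_of_def)
      qed
      then have "u \<bullet> (w - v) \<ge> 0" using edges e by blast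
      then show "w \<in> {w. u \<bullet> w \<ge> u \<bullet> v}" by (simp add: inner_diff_right)
    qed
    finally have "u \<bullet> (y - v) \<ge> 0" by (simp add: inner_diff_right)
    then have "u \<bullet> (z - v) \<ge> 0" using \<tau> by (simp add: y_def zero_le_mult_iff)
    moreover have "x - v = \<beta> *\<^sub>R (z - v)"
    proof -
      have "\<alpha> = 1 - \<beta>" using z by simp
      then have "x = (1 - \<beta>) *\<^sub>R v + \<beta> *\<^sub>R z" using z(5) by metis
      then show ?thesis by (simp add: algebra_simps)
    qed
    ultimately show ?thesis using z by simp
  qed
qed

lemma aff_dim_1_collinear:
  fixes S :: "'a::euclidean_space set"
  assumes "aff_dim S = 1" "a \<in> S" "b \<in> S" "a \<noteq> b" "c \<in> S"
  shows "\<exists>t. c = a + t *\<^sub>R (b - a)"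
proof -
  have "affine hull {a, b} = affine hull S"
  proof (rule affine_dim_equal)
    show "affine hull {a, b} \<subseteq> affine hull S" using assms by (intro hull_mono) auto
  qed (use assms in \<open>auto simp: aff_dim_2\<close>)
  then have "c \<in> affine hull {a, b}" using assms hull_inc by metis
  then obtain \<alpha> \<beta> where "c = \<alpha> *\<^sub>R a + \<beta> *\<^sub>R b" "\<alpha> + \<beta> = 1"
    unfolding affine_hull_2 by blast
  then have "\<alpha> = 1 - \<beta>" by simp
  then have "c = (1 - \<beta>) *\<^sub>R a + \<beta> *\<^sub>R b" using \<open>c = _\<close> by metis
  then have "c = a + \<beta> *\<^sub>R (b - a)" by (simp add: algebra_simps)
  then show ?thesis by blast
qed

text \<open>Generators are indexed by naturals below the dimension, so that integer coordinates have
  the same type as the vectors of \<open>Fp_space\<close>.\<close>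

definition int_span :: "(nat \<Rightarrow> real^'n) \<Rightarrow> (real^'n) set" where
  "int_span e = {\<Sum>i<CARD('n). real_of_int (z i) *\<^sub>R e i | z. True}"

lemma in_int_span: 
  fixes b :: "nat \<Rightarrow> real^'n"
  shows "i < CARD('n) \<Longrightarrow> b i \<in> int_span b"
  unfolding int_span_def
  by (rule CollectI, rule exI[of _ "\<lambda>j. if j = i then 1 else 0"])
     (simp add: if_distrib[of real_of_int] if_distrib[of "\<lambda>c. c *\<^sub>R _"] cong: if_cong)

text \<open>A basis \<open>e\<close> and its dual basis \<open>u\<close>. The expansion of every
  vector stands in for independence and spanning, and is the form in which they enter all
  computations.\<close>

locale dual_bases =
  fixes e u :: "nat \<Rightarrow> real^'n"
  assumes dual: "i < CARD('n) \<Longrightarrow> j < CARD('n) \<Longrightarrow> u i \<bullet> e j = (if i = j then 1 else 0)"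
    and expand: "x = (\<Sum>i<CARD('n). (u i \<bullet> x) *\<^sub>R e i)"
begin

lemma expand_dual: "y = (\<Sum>i<CARD('n). (y \<bullet> e i) *\<^sub>R u i)"
proof -
  have "y \<bullet> x = (\<Sum>i<CARD('n). (y \<bullet> e i) *\<^sub>R u i) \<bullet> x" for x
    by (subst expand[of x]) (simp add: inner_sum_right inner_sum_left mult.commute)
  then show ?thesis using vector_eq_rdot by blast
qed

lemma inner_sum_e [simp]:
  "j < CARD('n) \<Longrightarrow> u j \<bullet> (\<Sum>i<CARD('n). c i *\<^sub>R e i) = c j"
  by (simp add: inner_sum_right dual if_distrib cong: if_cong)

lemma inner_sum_u [simp]:
  "j < CARD('n) \<Longrightarrow> (\<Sum>i<CARD('n). c i *\<^sub>R u i) \<bullet> e j = c j"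
  by (simp add: inner_sum_left dual if_distrib cong: if_cong)

lemma inner_sum_u_e:
  "(\<Sum>i<CARD('n). c i *\<^sub>R u i) \<bullet> (\<Sum>i<CARD('n). d i *\<^sub>R e i) = (\<Sum>i<CARD('n). c i * d i)"
  by (subst inner_sum_left) (simp add: mult.commute)

end

section \<open>The frame at a nonsingular vertex\<close>

lemma span_full_lattice:
  fixes L :: "(real^'n) set"
  assumes "full_lattice L"
  shows "span L = UNIV"
proof -
  obtain B where B: "invertible B" "L = lattice_of B" using assms by (auto simp: full_lattice_def)
  have col: "column j B \<in> L" for j
  proof -
    have "B *v (\<chi> i. real_of_int ((\<chi> i. if i = j then 1 else 0) $ i)) = column j B"
      by (simp add: matrix_vector_mult_def column_def vec_eq_iff if_distrib cong: if_cong)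
    then have "column j B = B *v (\<chi> i. real_of_int ((\<chi> i. if i = j then 1 else 0) $ i))" by (rule sym)
    then show ?thesis unfolding B(2) lattice_of_def by blast
  qed
  have "x \<in> span L" for x
  proof -
    obtain B' where "B ** B' = mat 1" using B(1) by (auto simp: invertible_def)
    then have "x = B *v (B' *v x)"
      by (simp add: matrix_vector_mul_assoc)
    also have "\<dots> = (\<Sum>j\<in>UNIV. ((B' *v x) $ j) *s column j B)"
      by (rule matrix_mult_sum)
    also have "\<dots> \<in> span L"
      by (intro span_sum) (simp add: scalar_mult_eq_scaleR span_scale span_base col)
    finally show ?thesis .
  qed
  then show ?thesis by auto
qed

lemma dual_basis_exists:
  fixes E :: "(real^'n) set"
  assumes "independent E" "span E = UNIV"
  obtains e u where "dual_bases e u" "bij_betw e {..<CARD('n)} E"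
proof -
  have finE: "finite E" using assms independent_imp_finite by blast
  have "card E = CARD('n)"
    using dim_eq_card[of E UNIV] assms by (metis dim_UNIV DIM_cart DIM_real mult_1_right span_UNIV)
  then obtain e where e: "bij_betw e {..<CARD('n)} E"
    using finE ex_bij_betw_nat_finite[OF finE] by (auto simp: atLeast0LessThan)
  have "\<exists>w. \<forall>b'\<in>E. w \<bullet> b' = (if b = b' then 1 else 0)" for b
  proof -
    obtain g :: "real^'n \<Rightarrow> real" where g: "linear g" "\<forall>x\<in>E. g x = (if b = x then 1 else 0)"
      using linear_independent_extend[OF assms(1), of "\<lambda>x. if b = x then 1 else 0"] by auto
    \<comment> \<open>The adjoint at 1 is the vector that represents the functional \<open>g\<close>
      through the inner product.\<close>
    have "adjoint g 1 \<bullet> x = g x" for x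
      unfolding inner_commute[of "adjoint g 1" x] adjoint_works[OF g(1)] by simp
    then show ?thesis using g by metis
  qed
  then obtain w where w: "\<And>b b'. b' \<in> E \<Longrightarrow> w b \<bullet> b' = (if b = b' then 1 else 0)" by metis
  define u where "u i = w (e i)" for i
  have eE: "i < CARD('n) \<Longrightarrow> e i \<in> E" for i using e bij_betwE by blast
  have inj: "inj_on e {..<CARD('n)}" using e bij_betw_def by blast
  have d: "u i \<bullet> e j = (if i = j then 1 else 0)" if "i < CARD('n)" "j < CARD('n)" for i j
    using w[OF eE[OF that(2)]] inj that by (auto simp: u_def inj_on_eq_iff)
  have "x = (\<Sum>i<CARD('n). (u i \<bullet> x) *\<^sub>R e i)" for x
  proof -
    have "x \<in> span E" using assms by simp
    then obtain r where r: "x = (\<Sum>b\<in>E. r b *\<^sub>R b)"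
      using span_finite[OF finE] by auto
    also have "\<dots> = (\<Sum>i<CARD('n). r (e i) *\<^sub>R e i)"
      by (rule sum.reindex_bij_betw[OF e, symmetric])
    finally have x: "x = (\<Sum>i<CARD('n). r (e i) *\<^sub>R e i)" .
    have "u j \<bullet> x = r (e j)" if "j < CARD('n)" for j
      unfolding x using that by (simp add: inner_sum_right d if_distrib cong: if_cong)
    then show ?thesis by (subst x) (intro sum.cong, auto)
  qed
  then have "dual_bases e u" using d by unfold_locales auto
  then show ?thesis using that e by blast
qed

text \<open>The local shape of \<open>P\<close> at \<open>v\<close> in two conditions:
  \<open>P\<close> lies in the cone spanned by the \<open>e i\<close> at \<open>v\<close>, and each
  ray of this cone reaches a further point of \<open>P\<close>.\<close>

locale vertex_frame = dual_bases e u for e u :: "nat \<Rightarrow> real^'n" +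
  fixes P :: "(real^'n) set" and v :: "real^'n"
  assumes poly: "polytope P" and full_dim: "aff_dim P = int CARD('n)"
    and vertex: "v \<in> P"
    and nonneg: "x \<in> P \<Longrightarrow> i < CARD('n) \<Longrightarrow> u i \<bullet> (x - v) \<ge> 0"
    and edge: "i < CARD('n) \<Longrightarrow> \<exists>t>0. v + t *\<^sub>R e i \<in> P"

text \<open>The Z-basis of primitive edge vectors provides \<open>e\<close>. Two independent vectors
  cannot lie along one edge, and simplicity allows only \<open>CARD('n)\<close> edges at
  \<open>v\<close>, so every edge at \<open>v\<close> carries one of the \<open>e i\<close>.
  Nonnegativity of \<open>u i\<close> on \<open>P\<close> then has to be tested only along
  these.\<close>

lemma vertex_frame_exists:
  fixes L P :: "(real^'n) set"
  assumes L: "full_lattice L" and P: "lattice_polytope L P" and ns: "nonsingular_polytope L P"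
    and v: "v extreme_point_of P"
  obtains e u where "vertex_frame e u P v" "L = int_span e"
proof -
  let ?E = "edge_dirs L P v" and ?N = "CARD('n)"
  have polP: "polytope P" and dimP: "aff_dim P = int CARD('n)" using P by (auto simp: lattice_polytope_def)
  have Z: "independent ?E" "L = {\<Sum>b\<in>?E. real_of_int (c b) *\<^sub>R b | c. True}"
    using ns v by (auto simp: nonsingular_polytope_def Zbasis_def)
  have mem_L: "x \<in> L \<longleftrightarrow> (\<exists>c. x = (\<Sum>b\<in>?E. real_of_int (c b) *\<^sub>R b))" for x
    using Z(2) by blast
  have "L \<subseteq> span ?E"
  proof
    fix x assume "x \<in> L"
    then obtain c where "x = (\<Sum>b\<in>?E. real_of_int (c b) *\<^sub>R b)" using mem_L by blast
    then show "x \<in> span ?E" by (simp only:) (intro span_sum span_scale span_base)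
  qed
  then have spE: "span ?E = UNIV"
    using span_full_lattice[OF L] span_minimal[OF _ subspace_span] by blast
  obtain e u where eu: "dual_bases e u" and bij: "bij_betw e {..<?N} ?E"
    using dual_basis_exists[OF Z(1) spE] by blast
  interpret dual_bases e u by fact
  have "L = int_span e"
  proof
    show "L \<subseteq> int_span e"
      by (auto simp: mem_L int_span_def simp flip: sum.reindex_bij_betw[OF bij])
    show "int_span e \<subseteq> L"
    proof
      fix x assume "x \<in> int_span e"
      then obtain z where x: "x = (\<Sum>i<?N. real_of_int (z i) *\<^sub>R e i)" by (auto simp: int_span_def)
      define c where "c b = z (inv_into {..<?N} e b)" for b
      have "x = (\<Sum>i<?N. real_of_int (c (e i)) *\<^sub>R e i)"
        unfolding x using bij by (intro sum.cong) (auto simp: c_def bij_betw_def)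
      also have "\<dots> = (\<Sum>b\<in>?E. real_of_int (c b) *\<^sub>R b)"
        by (rule sum.reindex_bij_betw[OF bij])
      finally show "x \<in> L" unfolding mem_L by blast
    qed
  qed
  have "\<exists>\<epsilon> w t. \<epsilon> edge_of P \<and> v \<in> \<epsilon> \<and> w \<in> \<epsilon> \<and> w \<noteq> v \<and> t > 0 \<and> e i = t *\<^sub>R (w - v)" if "i < ?N" for i
    using that bij bij_betwE unfolding edge_dirs_def by blast
  then obtain \<epsilon> w t where eps: "\<And>i. i < ?N \<Longrightarrow> \<epsilon> i edge_of P \<and> v \<in> \<epsilon> i \<and> w i \<in> \<epsilon> i \<and> w i \<noteq> v
      \<and> t i > 0 \<and> e i = t i *\<^sub>R (w i - v)" by metis
  have wi: "w i = v + (1 / t i) *\<^sub>R e i" if "i < ?N" for i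
    using eps[OF that] by auto
  have dep: "i = j" if ij: "i < ?N" "j < ?N" "\<epsilon> i = \<epsilon> j" for i j
  proof -
    have "aff_dim (\<epsilon> i) = 1" using eps ij by (simp add: edge_of_def)
    then obtain s where "w j = v + s *\<^sub>R (w i - v)"
      using aff_dim_1_collinear[of "\<epsilon> i" v "w i" "w j"] eps[OF ij(1)] eps[OF ij(2)] ij(3) by auto
    then have "e j = (t j * s / t i) *\<^sub>R e i"
      using eps[OF ij(1)] eps[OF ij(2)] by auto
    then have "u j \<bullet> e j = (t j * s / t i) * (u j \<bullet> e i)" by simp
    then show ?thesis using dual ij by (auto split: if_splits)
  qed
  let ?S = "{\<epsilon>. \<epsilon> edge_of P \<and> v \<in> \<epsilon>}"
  have cS: "card ?S = ?N" using ns v by (auto simp: nonsingular_polytope_def simple_polytope_def)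
  have "?S \<subseteq> {F. F face_of P}" by (auto simp: edge_of_def)
  then have "finite ?S" using finite_polytope_faces[OF polP] finite_subset by blast
  have "\<epsilon> ` {..<?N} = ?S"
  proof (rule card_subset_eq[OF \<open>finite ?S\<close>])
    show "\<epsilon> ` {..<?N} \<subseteq> ?S" using eps by auto
    have "inj_on \<epsilon> {..<?N}" using dep by (auto simp: inj_on_def)
    then show "card (\<epsilon> ` {..<?N}) = card ?S" by (simp add: card_image cS)
  qed
  have nn: "u i \<bullet> (x - v) \<ge> 0" if "x \<in> P" "i < ?N" for x i
  proof (rule inner_nonneg_of_edges[OF polP v that(1)])
    fix e' w' assume e': "e' edge_of P" "v \<in> e'" "w' \<in> e'"
    then obtain j where j: "j < ?N" "e' = \<epsilon> j" using \<open>\<epsilon> ` {..<?N} = ?S\<close> by blast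
    have "aff_dim (\<epsilon> j) = 1" using eps j by (simp add: edge_of_def)
    then obtain s where s: "w' = v + s *\<^sub>R (w j - v)"
      using aff_dim_1_collinear[of "\<epsilon> j" v "w j" w'] eps[OF j(1)] e' j by auto
    \<comment> \<open>A point of the edge on the other side of \<open>v\<close> would put the
      extreme point \<open>v\<close> inside a segment of \<open>P\<close>.\<close>
    have "s \<ge> 0"
    proof (rule ccontr)
      assume "\<not> s \<ge> 0"
      then have s0: "s < 0" by simp
      have "\<epsilon> j \<subseteq> P" using eps[OF j(1)] by (simp add: edge_of_imp_subset)
      then have inP: "w' \<in> P" "w j \<in> P" using eps[OF j(1)] e' j by auto
      \<comment> \<open>With this weight \<open>v\<close> is the convex combination of
        \<open>w'\<close> and \<open>w j\<close> with coefficients \<open>r\<close> and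
        \<open>1 - r\<close>.\<close>
      define r where "r = 1 / (1 - s)"
      have r: "0 < r" "r < 1" "r * s = r - 1" using s0 by (auto simp: r_def field_simps)
      have "r *\<^sub>R w' = r *\<^sub>R v + (r * s) *\<^sub>R (w j - v)" unfolding s by (simp add: scaleR_add_right)
      then have "v = (1 - (1 - r)) *\<^sub>R w' + (1 - r) *\<^sub>R w j" unfolding r(3) by (simp add: algebra_simps)
      moreover have "w' \<noteq> w j"
      proof
        assume "w' = w j"
        then have "s *\<^sub>R (w j - v) = w j - v" using s by (metis add_diff_cancel_left')
        then have "(1 - s) *\<^sub>R (w j - v) = 0" by (simp add: scaleR_left_diff_distrib)
        then show False using eps[OF j(1)] s0 by simp
      qed
      moreover have "0 < 1 - r" "1 - r < 1" using r by auto
      ultimately have "v \<in> open_segment w' (w j)" unfolding in_segment by blast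
      then show False using v inP by (auto simp: extreme_point_of_def)
    qed
    have "w' - v = (s / t j) *\<^sub>R e j" using eps[OF j(1)] s by auto
    then show "u i \<bullet> (w' - v) \<ge> 0"
      unfolding \<open>w' - v = _\<close> inner_scaleR_right dual[OF that(2) j(1)]
      using \<open>s \<ge> 0\<close> eps[OF j(1)] by simp
  qed
  have "vertex_frame e u P v"
  proof unfold_locales
    show "v \<in> P" using v by (simp add: extreme_point_of_def)
    show "\<exists>t>0. v + t *\<^sub>R e i \<in> P" if "i < ?N" for i
    proof (intro exI conjI)
      show "1 / t i > 0" using eps[OF that] by simp
      show "v + (1 / t i) *\<^sub>R e i \<in> P"
        using wi[OF that] eps[OF that] edge_of_imp_subset by (metis subsetD)
    qed
  qed (use polP dimP nn in auto)
  then show ?thesis using that \<open>L = int_span e\<close> by blast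
qed

section \<open>Facet normals with respect to superlattices\<close>

lemma dual_lattice_scale_int:
  "u \<in> dual_lattice N \<Longrightarrow> real_of_int c *\<^sub>R u \<in> dual_lattice N"
  by (auto simp: dual_lattice_def)

lemma dual_lattice_add:
  "u \<in> dual_lattice N \<Longrightarrow> w \<in> dual_lattice N \<Longrightarrow> u + w \<in> dual_lattice N"
  by (auto simp: dual_lattice_def inner_add_left)

context dual_bases
begin

text \<open>The factor between \<open>u i\<close> and the primitive vector of the dual of
  \<open>N\<close> in the same direction, for a lattice \<open>N\<close> between
  \<open>int_span e\<close> and its multiple by 1/p.\<close>

definition dilation :: "(real^'n) set \<Rightarrow> nat \<Rightarrow> nat \<Rightarrow> nat" where
  "dilation N p i = (if u i \<in> dual_lattice N then 1 else p)"

lemma inner_e_Ints: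
  assumes "int_span e \<subseteq> N" "y \<in> dual_lattice N" "i < CARD('n)"
  shows "y \<bullet> e i \<in> \<int>"
proof -
  have "e i \<in> N" using assms in_int_span by blast
  then show ?thesis using assms(2) unfolding dual_lattice_def by blast
qed

text \<open>The integers \<open>c\<close> for which \<open>c\<close> times \<open>u i\<close> is in
  the dual form an ideal. It contains \<open>p\<close>, because \<open>N\<close> lies in the
  multiple of \<open>int_span e\<close> by 1/p; as \<open>p\<close> is prime, the ideal is generated
  by 1 or by \<open>p\<close>.\<close>

lemma int_multiple_in_dual_lattice_iff:
  assumes p: "prime p" and sup: "N \<subseteq> (\<lambda>x. inverse (real p) *\<^sub>R x) ` int_span e" and i: "i < CARD('n)"
  shows "real_of_int c *\<^sub>R u i \<in> dual_lattice N \<longleftrightarrow> int (dilation N p i) dvd c"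
proof -
  have p0: "p > 0" using p prime_gt_0_nat by blast
  have pu: "real p *\<^sub>R u i \<in> dual_lattice N"
    unfolding dual_lattice_def
  proof (intro CollectI ballI)
    fix x assume "x \<in> N"
    then obtain z where "x = inverse (real p) *\<^sub>R (\<Sum>i<CARD('n). real_of_int (z i) *\<^sub>R e i)"
      using sup by (auto simp: int_span_def)
    then show "real p *\<^sub>R u i \<bullet> x \<in> \<int>" using i p0 by (simp add: inverse_eq_divide)
  qed
  show ?thesis
  proof (cases "u i \<in> dual_lattice N")
    case True
    then show ?thesis by (simp add: dilation_def dual_lattice_scale_int)
  next
    case False
    show ?thesis
    proof
      assume "int (dilation N p i) dvd c"
      then obtain k where "c = int p * k" using False by (auto simp: dilation_def)
      then show "real_of_int c *\<^sub>R u i \<in> dual_lattice N"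
        using dual_lattice_scale_int[OF pu, of k] by (simp add: mult.commute)
    next
      assume c: "real_of_int c *\<^sub>R u i \<in> dual_lattice N"
      have "int p dvd c"
      proof (rule ccontr)
        assume "\<not> int p dvd c"
        then have "coprime c (int p)"
          using p prime_imp_coprime[of "int p" c] by (simp add: coprime_commute)
        then obtain a b where ab: "a * c + b * int p = 1"
          using bezout_int[of c "int p"] by auto
        have "real_of_int a *\<^sub>R (real_of_int c *\<^sub>R u i) + real_of_int b *\<^sub>R (real p *\<^sub>R u i) \<in> dual_lattice N"
          by (intro dual_lattice_add dual_lattice_scale_int c pu)
        also have "real_of_int a *\<^sub>R (real_of_int c *\<^sub>R u i) + real_of_int b *\<^sub>R (real p *\<^sub>R u i)
            = real_of_int (a * c + b * int p) *\<^sub>R u i"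
          by (simp add: scaleR_add_left)
        finally show False using False ab by simp
      qed
      then show "int (dilation N p i) dvd c" using False by (simp add: dilation_def)
    qed
  qed
qed

lemma dilation_int_span: "i < CARD('n) \<Longrightarrow> dilation (int_span e) p i = 1"
  by (auto simp: dilation_def dual_lattice_def int_span_def)

end

context vertex_frame
begin

text \<open>The functional that cuts out \<open>F\<close> is a nonnegative combination of the
  \<open>u i\<close>, by evaluation along the rays. On \<open>F\<close> each summand vanishes, so
  every \<open>u i\<close> with positive coefficient is constant on \<open>F\<close>, and for
  reasons of dimension the affine hull of \<open>F\<close> is its level hyperplane. Distinct
  \<open>u i\<close> have distinct hyperplanes, so exactly one coefficient is positive.\<close>

lemma facet_at_vertex:
  assumes F: "F facet_of P" and v: "v \<in> F"
  obtains i where "i < CARD('n)" "F = {x \<in> P. u i \<bullet> x = u i \<bullet> v}"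
    "affine hull F = {x. u i \<bullet> x = u i \<bullet> v}"
proof -
  let ?N = "CARD('n)"
  obtain a b where ab: "a \<noteq> 0" "P \<subseteq> {x. a \<bullet> x \<le> b}" "F = P \<inter> {x. a \<bullet> x = b}"
    using facet_of_polyhedron[OF polytope_imp_polyhedron[OF poly] F] by blast
  define \<alpha> where "\<alpha> = - a"
  have \<alpha>: "\<alpha> \<noteq> 0" "\<And>x. x \<in> P \<Longrightarrow> \<alpha> \<bullet> (x - v) \<ge> 0" "F = {x \<in> P. \<alpha> \<bullet> (x - v) = 0}"
    using ab v by (auto simp: \<alpha>_def inner_diff_right)
  have sum: "\<alpha> \<bullet> y = (\<Sum>i<?N. (\<alpha> \<bullet> e i) * (u i \<bullet> y))" for y
    by (subst expand_dual[of \<alpha>]) (simp add: inner_sum_left)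
  have pos: "\<alpha> \<bullet> e i \<ge> 0" if "i < ?N" for i
  proof -
    obtain t where "t > 0" "v + t *\<^sub>R e i \<in> P" using edge \<open>i < ?N\<close> by blast
    then show ?thesis using \<alpha>(2)[of "v + t *\<^sub>R e i"] by (simp add: zero_le_mult_iff)
  qed
  have hull: "affine hull F = {x. u i \<bullet> x = u i \<bullet> v}" if i: "i < ?N" "\<alpha> \<bullet> e i > 0" for i
  proof (rule affine_dim_equal)
    show "affine hull F \<noteq> {}" using v hull_inc by fastforce
    have "u i \<bullet> x = u i \<bullet> v" if "x \<in> F" for x
    proof -
      have x: "x \<in> P" "\<alpha> \<bullet> (x - v) = 0" using \<open>x \<in> F\<close> \<alpha> by auto
      have "(\<Sum>i<?N. (\<alpha> \<bullet> e i) * (u i \<bullet> (x - v))) = 0" using x sum by metis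
      then have "(\<alpha> \<bullet> e i) * (u i \<bullet> (x - v)) = 0"
        using sum_nonneg_eq_0_iff[of "{..<?N}" "\<lambda>i. (\<alpha> \<bullet> e i) * (u i \<bullet> (x - v))"] pos nonneg[OF x(1)] i
        by (metis (no_types, lifting) finite_lessThan lessThan_iff mult_nonneg_nonneg)
      then show ?thesis using i by (simp add: inner_diff_right)
    qed
    then show "affine hull F \<subseteq> {x. u i \<bullet> x = u i \<bullet> v}"
      by (intro hull_minimal affine_hyperplane) auto
    have "u i \<noteq> 0" using dual[OF i(1) i(1)] by auto
    then show "aff_dim (affine hull F) = aff_dim {x. u i \<bullet> x = u i \<bullet> v}"
      using F full_dim by (simp add: facet_of_def)
  qed (auto simp: affine_hyperplane)
  obtain i where i: "i < ?N" "\<alpha> \<bullet> e i > 0"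
  proof -
    have "\<exists>i<?N. \<alpha> \<bullet> e i \<noteq> 0"
    proof (rule ccontr)
      assume "\<not> (\<exists>i<?N. \<alpha> \<bullet> e i \<noteq> 0)"
      then have "\<alpha> \<bullet> \<alpha> = 0" by (subst sum) simp
      then show False using \<alpha> by simp
    qed
    then show ?thesis using that pos by force
  qed
  have other: "\<alpha> \<bullet> e j = 0" if "j < ?N" "j \<noteq> i" for j
  proof (rule ccontr)
    assume "\<alpha> \<bullet> e j \<noteq> 0"
    then have "\<alpha> \<bullet> e j > 0" using pos[OF \<open>j < ?N\<close>] by simp
    then have "{x. u i \<bullet> x = u i \<bullet> v} = {x. u j \<bullet> x = u j \<bullet> v}"
      using hull i \<open>j < ?N\<close> by metis
    moreover have "v + e j \<in> {x. u i \<bullet> x = u i \<bullet> v}"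
      using dual i that by (simp add: inner_add_right)
    moreover have "v + e j \<notin> {x. u j \<bullet> x = u j \<bullet> v}"
      using dual[of j j] that by (simp add: inner_add_right)
    ultimately show False by blast
  qed
  have single: "\<alpha> \<bullet> y = (\<alpha> \<bullet> e i) * (u i \<bullet> y)" for y
  proof -
    have "\<alpha> \<bullet> y = (\<Sum>j<?N. if j = i then (\<alpha> \<bullet> e i) * (u i \<bullet> y) else 0)"
      unfolding sum[of y] using other by (intro sum.cong) auto
    then show ?thesis using i by simp
  qed
  have "\<alpha> \<bullet> (x - v) = 0 \<longleftrightarrow> u i \<bullet> x = u i \<bullet> v" for x
    unfolding single[of "x - v"] using i(2) by (simp add: inner_diff_right)
  then have "F = {x \<in> P. u i \<bullet> x = u i \<bullet> v}"
    unfolding \<alpha>(3) by blast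
  then show ?thesis using that i hull by blast
qed

definition facet_index :: "(real^'n) set \<Rightarrow> nat" where
  "facet_index F = (SOME i. i < CARD('n) \<and> F = {x \<in> P. u i \<bullet> x = u i \<bullet> v} \<and>
    affine hull F = {x. u i \<bullet> x = u i \<bullet> v})"

lemma facet_index:
  assumes "F facet_of P" "v \<in> F"
  shows "facet_index F < CARD('n)" "F = {x \<in> P. u (facet_index F) \<bullet> x = u (facet_index F) \<bullet> v}"
    "affine hull F = {x. u (facet_index F) \<bullet> x = u (facet_index F) \<bullet> v}"
proof -
  have "\<exists>i. i < CARD('n) \<and> F = {x \<in> P. u i \<bullet> x = u i \<bullet> v} \<and> affine hull F = {x. u i \<bullet> x = u i \<bullet> v}"
    by (rule facet_at_vertex[OF assms]) blast
  from someI_ex[OF this] show "facet_index F < CARD('n)"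
    "F = {x \<in> P. u (facet_index F) \<bullet> x = u (facet_index F) \<bullet> v}"
    "affine hull F = {x. u (facet_index F) \<bullet> x = u (facet_index F) \<bullet> v}"
    unfolding facet_index_def by auto
qed

lemma inj_on_facet_index: "inj_on facet_index {F. F facet_of P \<and> v \<in> F}"
proof (intro inj_onI, clarify)
  fix F G assume F: "F facet_of P" "v \<in> F" and G: "G facet_of P" "v \<in> G"
    and eq: "facet_index F = facet_index G"
  show "F = G" using facet_index(2)[OF F] facet_index(2)[OF G] unfolding eq by simp
qed

text \<open>A functional constant on \<open>F\<close> is a multiple of \<open>u i\<close>, because
  \<open>F\<close> spans a level hyperplane of \<open>u i\<close>. The multiples in the dual lattice
  are those by multiples of \<open>d\<close>; primitivity leaves \<open>d\<close> and
  \<open>-d\<close>, and pointing inward leaves \<open>d\<close>. This is the uniqueness that the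
  \<open>THE\<close> in \<open>facet_normal\<close> calls for.\<close>

lemma facet_normal_eq:
  assumes p: "prime p" and sub: "int_span e \<subseteq> N"
    and sup: "N \<subseteq> (\<lambda>x. inverse (real p) *\<^sub>R x) ` int_span e"
    and F: "F facet_of P" "v \<in> F"
  shows "facet_normal N P F = real (dilation N p (facet_index F)) *\<^sub>R u (facet_index F)" (is ?normal)
    and "facet_const N P F = - (real (dilation N p (facet_index F)) * (u (facet_index F) \<bullet> v))" (is ?const)
proof -
  let ?N = "CARD('n)"
  define i where "i = facet_index F"
  define d where "d = dilation N p i"
  note fi = facet_index[OF F, folded i_def]
  have dvd: "real_of_int c *\<^sub>R u i \<in> dual_lattice N \<longleftrightarrow> int d dvd c" for c
    unfolding d_def by (rule int_multiple_in_dual_lattice_iff[OF p sup fi(1)])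
  have d0: "d > 0" using p prime_gt_0_nat by (auto simp: d_def dilation_def)
  have ui0: "u i \<noteq> 0" using dual[OF fi(1) fi(1)] by auto
  have prim: "primitive_in (dual_lattice N) (real d *\<^sub>R u i)"
    unfolding primitive_in_def
  proof (intro conjI allI ballI impI)
    show "real d *\<^sub>R u i \<in> dual_lattice N" using dvd[of "int d"] by simp
    show "real d *\<^sub>R u i \<noteq> 0" using d0 ui0 by simp
    fix m :: int and y assume y: "y \<in> dual_lattice N" "real d *\<^sub>R u i = of_int m *\<^sub>R y"
    have m0: "m \<noteq> 0" using y(2) d0 ui0 by auto
    obtain c where c: "y \<bullet> e i = of_int c" using inner_e_Ints[OF sub y(1) fi(1)] by (elim Ints_cases)
    have yeq: "y = (real d / of_int m) *\<^sub>R u i"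
      using y(2) m0 by (metis divideR_right divide_inverse_commute of_int_eq_0_iff scaleR_scaleR)
    have "of_int c = real d / of_int m"
      using c unfolding yeq using dual[OF fi(1) fi(1)] by simp
    then have ycu: "y = real_of_int c *\<^sub>R u i" using yeq by simp
    have "real_of_int (int d) = real_of_int (c * m)"
      using \<open>of_int c = real d / of_int m\<close> m0 by (simp add: field_simps)
    then have dcm: "int d = c * m" by (simp only: of_int_eq_iff)
    \<comment> \<open>So \<open>d\<close> divides \<open>c\<close> while \<open>d\<close> equals
      \<open>c * m\<close>, and \<open>m\<close> must be a unit.\<close>
    from ycu have "int d dvd c" using y(1) dvd by simp
    then obtain k where k: "c = int d * k" by blast
    have "int d * (k * m) = int d * 1" using dcm unfolding k by (metis mult.assoc mult.right_neutral)
    then have "k * m = 1" using d0 by (metis mult_left_cancel of_nat_eq_0_iff less_irrefl)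
    then have "m dvd 1" by (metis dvd_triv_right)
    then show "\<bar>m\<bar> = 1" by simp
  qed
  have n: ?normal
    unfolding facet_normal_def i_def[symmetric] d_def[symmetric]
  proof (rule the_equality)
    show "primitive_in (dual_lattice N) (real d *\<^sub>R u i) \<and>
      (\<exists>lam. (\<forall>x\<in>F. real d *\<^sub>R u i \<bullet> x + lam = 0) \<and> (\<forall>x\<in>P. 0 \<le> real d *\<^sub>R u i \<bullet> x + lam))"
    proof (intro conjI prim exI[of _ "- (real d *\<^sub>R u i \<bullet> v)"] ballI)
      fix x assume "x \<in> F"
      then show "real d *\<^sub>R u i \<bullet> x + - (real d *\<^sub>R u i \<bullet> v) = 0" using fi(2) by auto
    next
      fix x assume "x \<in> P"
      then have "real d * (u i \<bullet> (x - v)) \<ge> 0" using nonneg fi(1) by simp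
      then show "0 \<le> real d *\<^sub>R u i \<bullet> x + - (real d *\<^sub>R u i \<bullet> v)"
        by (simp add: inner_diff_right algebra_simps)
    qed
  next
    fix w assume w: "primitive_in (dual_lattice N) w \<and>
      (\<exists>lam. (\<forall>x\<in>F. w \<bullet> x + lam = 0) \<and> (\<forall>x\<in>P. 0 \<le> w \<bullet> x + lam))"
    then obtain lam where lam: "\<forall>x\<in>F. w \<bullet> x + lam = 0" "\<forall>x\<in>P. 0 \<le> w \<bullet> x + lam" by blast
    have "affine hull F \<subseteq> {x. w \<bullet> x = - lam}"
      using lam by (intro hull_minimal affine_hyperplane) (auto simp: eq_neg_iff_add_eq_0)
    then have hyp: "w \<bullet> x = - lam" if "u i \<bullet> x = u i \<bullet> v" for x using fi(3) that by blast
    have off: "w \<bullet> e j = 0" if "j < ?N" "j \<noteq> i" for j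
      using hyp[of v] hyp[of "v + e j"] dual[OF fi(1) that(1)] that by (simp add: inner_add_right)
    have weq: "w = (w \<bullet> e i) *\<^sub>R u i"
    proof -
      have "w = (\<Sum>j<?N. if j = i then (w \<bullet> e i) *\<^sub>R u i else 0)"
        by (rule trans[OF expand_dual[of w]]) (intro sum.cong, use off in auto)
      then show ?thesis using fi(1) by simp
    qed
    obtain t where "t > 0" "v + t *\<^sub>R e i \<in> P" using edge fi(1) by blast
    then have "w \<bullet> e i \<ge> 0"
      using bspec[OF lam(2), of "v + t *\<^sub>R e i"] hyp[of v]
      by (simp add: inner_add_right zero_le_mult_iff)
    moreover obtain c where c: "w \<bullet> e i = of_int c"
      using inner_e_Ints[OF sub _ fi(1)] w unfolding primitive_in_def Ints_def by blast
    ultimately have "c \<ge> 0" by simp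
    have wc: "w = real_of_int c *\<^sub>R u i" using weq c by simp
    then have "int d dvd c" using w dvd by (simp add: primitive_in_def)
    then obtain k where k: "c = int d * k" by blast
    have "w = of_int k *\<^sub>R (real d *\<^sub>R u i)" using wc k by (simp add: mult.commute)
    moreover have "real d *\<^sub>R u i \<in> dual_lattice N" using prim by (simp add: primitive_in_def)
    ultimately have "\<bar>k\<bar> = 1" using w unfolding primitive_in_def by blast
    moreover have "k \<ge> 0" using \<open>c \<ge> 0\<close> k d0 by (simp add: zero_le_mult_iff)
    ultimately have "k = 1" by simp
    then show "w = real d *\<^sub>R u i" using wc k by simp
  qed
  show ?normal by (rule n)
  show ?const
    unfolding facet_const_def n i_def[symmetric] d_def[symmetric]
  proof (rule the_equality)
    show "\<forall>x\<in>F. real d *\<^sub>R u i \<bullet> x + - (real d * (u i \<bullet> v)) = 0" using fi(2) by auto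
    fix lam assume "\<forall>x\<in>F. real d *\<^sub>R u i \<bullet> x + lam = 0"
    then have "real d *\<^sub>R u i \<bullet> v + lam = 0" using F by blast
    then show "lam = - (real d * (u i \<bullet> v))" by simp
  qed
qed

end

section \<open>Local polynomiality via finite differences\<close>

definition fdiff :: "('i \<Rightarrow> real) \<Rightarrow> (('i \<Rightarrow> real) \<Rightarrow> real) \<Rightarrow> ('i \<Rightarrow> real) \<Rightarrow> real" where
  "fdiff v g h = g (\<lambda>X. h X + v X) - g h"

definition axis_vec :: "'i \<Rightarrow> real \<Rightarrow> 'i \<Rightarrow> real" where
  "axis_vec F t = (\<lambda>X. if X = F then t else 0)"

fun mdiff :: "('i \<times> real) list \<Rightarrow> (('i \<Rightarrow> real) \<Rightarrow> real) \<Rightarrow> ('i \<Rightarrow> real) \<Rightarrow> real" where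
  "mdiff [] g = g"
| "mdiff ((F, t) # zs) g = fdiff (axis_vec F t) (mdiff zs g)"

definition near_zero :: "real \<Rightarrow> ('i \<Rightarrow> real) \<Rightarrow> bool" where
  "near_zero \<epsilon> h \<longleftrightarrow> (\<forall>X. \<bar>h X\<bar> < \<epsilon>)"

definition small_steps :: "real \<Rightarrow> ('i \<times> real) list \<Rightarrow> bool" where
  "small_steps \<epsilon> zs \<longleftrightarrow> (\<forall>z\<in>set zs. \<bar>snd z\<bar> < \<epsilon>)"

text \<open>Steps are independent of one another even for a repeated direction: in taking a partial
  derivative one of them tends to 0 while the others stay fixed.\<close>

definition mdiff_vanishes :: "'i list \<Rightarrow> (('i \<Rightarrow> real) \<Rightarrow> real) \<Rightarrow> bool" where
  "mdiff_vanishes Fs g \<longleftrightarrow> (\<exists>\<epsilon>>0. \<forall>zs h. map fst zs = Fs \<longrightarrow> small_steps \<epsilon> zs \<longrightarrow> near_zero \<epsilon> h \<longrightarrow>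
     mdiff zs g h = 0)"

section \<open>Calculus of mixed differences\<close>

lemma fun_upd_add_eq: "h(F := h F + t) = (\<lambda>X. h X + axis_vec F t X)"
  by (auto simp: axis_vec_def)

lemma near_zero_mono: "near_zero \<epsilon> h \<Longrightarrow> \<epsilon> \<le> \<epsilon>' \<Longrightarrow> near_zero \<epsilon>' h"
  by (auto simp: near_zero_def intro: order.strict_trans2)

lemma small_steps_mono: "small_steps \<epsilon> zs \<Longrightarrow> \<epsilon> \<le> \<epsilon>' \<Longrightarrow> small_steps \<epsilon>' zs"
  by (auto simp: small_steps_def intro: order.strict_trans2)

lemma near_zero_add: "near_zero r h \<Longrightarrow> near_zero s v \<Longrightarrow> near_zero (r + s) (\<lambda>X. h X + v X)"
  unfolding near_zero_def by (auto intro: le_less_trans[OF abs_triangle_ineq add_strict_mono])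

lemma near_zero_axis_vec: "\<bar>t\<bar> < \<epsilon> \<Longrightarrow> near_zero \<epsilon> (axis_vec F t)"
  by (auto simp: near_zero_def axis_vec_def)

lemma mdiff_append: "mdiff (xs @ ys) g = mdiff xs (mdiff ys g)"
  by (induction xs g rule: mdiff.induct) auto

lemma mdiff_fdiff: "mdiff zs (fdiff v g) = fdiff v (mdiff zs g)"
proof (induction zs g rule: mdiff.induct)
  case (2 F t zs g)
  show ?case unfolding mdiff.simps 2
    by (rule ext) (simp add: fdiff_def add.assoc add.left_commute add.commute[of "axis_vec F t _"])
qed simp

lemma mdiff_shift: "mdiff zs (\<lambda>h. g (\<lambda>X. h X + v X)) h = mdiff zs g (\<lambda>X. h X + v X)"
proof (induction zs arbitrary: h)
  case (Cons z zs)
  obtain F t where z: "z = (F, t)" by fastforce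
  show ?case unfolding z mdiff.simps fdiff_def Cons by (simp add: add.assoc add.commute[of "axis_vec F t _"])
qed simp

lemma mdiff_cmult: "mdiff zs (\<lambda>h. c * g h) h = c * mdiff zs g h"
  by (induction zs arbitrary: h) (auto simp: fdiff_def algebra_simps)

lemma mdiff_sum: "mdiff zs (\<lambda>h. \<Sum>i\<in>I. g i h) h = (\<Sum>i\<in>I. mdiff zs (g i) h)"
  by (induction zs arbitrary: h) (auto simp: fdiff_def sum_subtractf)

lemma mdiff_zero: "mdiff zs (\<lambda>h. 0) h = 0"
  by (induction zs arbitrary: h) (auto simp: fdiff_def)

text \<open>A mixed difference samples \<open>g\<close> only at \<open>h\<close> plus sums of some
  of the steps, and each step adds less than \<open>\<epsilon>\<close> to the distance from
  0.\<close>

lemma mdiff_cong_near: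
  assumes "\<And>h. near_zero (r + real (length zs) * \<epsilon>) h \<Longrightarrow> g h = g' h"
    and "small_steps \<epsilon> zs" "near_zero r h" "\<epsilon> \<ge> 0"
  shows "mdiff zs g h = mdiff zs g' h"
  using assms(1-3)
proof (induction zs arbitrary: h r)
  case (Cons z zs)
  obtain F t where z: "z = (F, t)" by fastforce
  have t: "\<bar>t\<bar> < \<epsilon>" and zs: "small_steps \<epsilon> zs" using Cons(3) z by (auto simp: small_steps_def)
  have "mdiff zs g (\<lambda>X. h X + axis_vec F t X) = mdiff zs g' (\<lambda>X. h X + axis_vec F t X)"
  proof (rule Cons.IH[of "r + \<epsilon>"])
    show "near_zero (r + \<epsilon>) (\<lambda>X. h X + axis_vec F t X)"
      by (intro near_zero_add Cons.prems near_zero_axis_vec t)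
  qed (use Cons.prems zs in \<open>auto simp: algebra_simps\<close>)
  moreover have "mdiff zs g h = mdiff zs g' h"
  proof (rule Cons.IH[of r])
    fix h' :: "'a \<Rightarrow> real" assume "near_zero (r + real (length zs) * \<epsilon>) h'"
    then show "g h' = g' h'"
      using Cons.prems(1) near_zero_mono assms(4) by (fastforce simp: algebra_simps)
  qed (use Cons.prems zs in auto)
  ultimately show ?case by (simp add: z fdiff_def)
qed (use assms in auto)

text \<open>Being a finite combination of values, a mixed difference commutes with pointwise limits.
  This carries the vanishing from difference quotients to partial derivatives.\<close>

lemma mdiff_tendsto_near:
  assumes "\<And>h. near_zero (r + real (length zs) * \<epsilon>) h \<Longrightarrow> ((\<lambda>t. G t h) \<longlongrightarrow> g h) A"
    and "small_steps \<epsilon> zs" "near_zero r h" "\<epsilon> \<ge> 0"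
  shows "((\<lambda>t. mdiff zs (G t) h) \<longlongrightarrow> mdiff zs g h) A"
  using assms(1-3)
proof (induction zs arbitrary: h r)
  case (Cons z zs)
  obtain F t where z: "z = (F, t)" by fastforce
  have t: "\<bar>t\<bar> < \<epsilon>" and zs: "small_steps \<epsilon> zs" using Cons(3) z by (auto simp: small_steps_def)
  have "((\<lambda>u. mdiff zs (G u) (\<lambda>X. h X + axis_vec F t X)) \<longlongrightarrow> mdiff zs g (\<lambda>X. h X + axis_vec F t X)) A"
  proof (rule Cons.IH[of "r + \<epsilon>"])
    show "near_zero (r + \<epsilon>) (\<lambda>X. h X + axis_vec F t X)"
      by (intro near_zero_add Cons.prems near_zero_axis_vec t)
  qed (use Cons.prems zs in \<open>auto simp: algebra_simps\<close>)
  moreover have "((\<lambda>u. mdiff zs (G u) h) \<longlongrightarrow> mdiff zs g h) A"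
  proof (rule Cons.IH[of r])
    fix h' :: "'a \<Rightarrow> real" assume "near_zero (r + real (length zs) * \<epsilon>) h'"
    then show "((\<lambda>t. G t h') \<longlongrightarrow> g h') A"
      using Cons.prems(1) near_zero_mono assms(4) by (fastforce simp: algebra_simps)
  qed (use Cons.prems zs in auto)
  ultimately show ?case by (simp add: z fdiff_def tendsto_diff)
qed (use assms in auto)

text \<open>The \<open>c i\<close> are signed binomial coefficients. Kept are only their
  independence of \<open>F\<close>, \<open>t\<close>, \<open>g\<close>, \<open>h\<close> and that
  \<open>c 0\<close> is nonzero, which allows the relation to be solved for the unshifted
  value.\<close>

lemma mdiff_replicate_expansion:
  "\<exists>c. c 0 \<noteq> 0 \<and> (\<forall>F t g (h :: 'i \<Rightarrow> real). mdiff (replicate N (F, t)) g h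
     = (\<Sum>i\<le>N. c i * g (\<lambda>X. h X + axis_vec F (real i * t) X)))"
proof (induction N)
  case 0
  show ?case by (rule exI[of _ "\<lambda>_. 1"]) (simp add: axis_vec_def)
next
  case (Suc N)
  then obtain c where c: "c 0 \<noteq> 0" "\<And>F t g (h :: 'i \<Rightarrow> real). mdiff (replicate N (F, t)) g h
     = (\<Sum>i\<le>N. c i * g (\<lambda>X. h X + axis_vec F (real i * t) X))" by blast
  \<comment> \<open>Pascal's rule with signs; the guards supply 0 outside the old range.\<close>
  define d where "d i = (if i = 0 then 0 else c (i - 1)) - (if i \<le> N then c i else 0)" for i
  have "mdiff (replicate (Suc N) (F, t)) g h
     = (\<Sum>i\<le>Suc N. d i * g (\<lambda>X. h X + axis_vec F (real i * t) X))" for F t g and h :: "'i \<Rightarrow> real"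
  proof -
    let ?G = "\<lambda>i. g (\<lambda>X. h X + axis_vec F (real i * t) X)"
    have ax: "(\<lambda>X. h X + axis_vec F t X + axis_vec F (real i * t) X)
        = (\<lambda>X. h X + axis_vec F (real (Suc i) * t) X)" for i
      by (auto simp: axis_vec_def algebra_simps)
    have "mdiff (replicate (Suc N) (F, t)) g h = (\<Sum>i\<le>N. c i * ?G (Suc i)) - (\<Sum>i\<le>N. c i * ?G i)"
      by (simp add: fdiff_def c(2) ax)
    also have "(\<Sum>i\<le>N. c i * ?G (Suc i)) = (\<Sum>i\<le>Suc N. (if i = 0 then 0 else c (i - 1)) * ?G i)"
      by (subst sum.atMost_Suc_shift) simp
    also have "(\<Sum>i\<le>N. c i * ?G i) = (\<Sum>i\<le>Suc N. (if i \<le> N then c i else 0) * ?G i)"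
      by simp
    finally show ?thesis by (simp only: d_def left_diff_distrib sum_subtractf)
  qed
  moreover have "d 0 \<noteq> 0" using c(1) by (simp add: d_def)
  ultimately show ?case by blast
qed

text \<open>Integrating the difference equation over the step \<open>t\<close> expresses \<open>G\<close> through an
  antiderivative of \<open>G\<close>.\<close>

lemma difference_equation_has_derivative:
  fixes G :: "real \<Rightarrow> real" and c :: "nat \<Rightarrow> real"
  assumes c: "c 0 \<noteq> 0" and cont: "\<And>s. \<bar>s\<bar> \<le> r \<Longrightarrow> isCont G s"
    and eq: "\<And>s t. \<bar>s\<bar> < \<delta> \<Longrightarrow> \<bar>t\<bar> < \<delta> \<Longrightarrow> (\<Sum>i\<le>N. c i * G (s + real i * t)) = 0"
    and \<delta>: "real (Suc N) * \<delta> \<le> r" and \<eta>: "0 < \<eta>" "\<eta> < \<delta>"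
  shows "(G has_real_derivative (\<Sum>i=1..N. - c i / (c 0 * real i * \<eta>) * (G (real i * \<eta>) - G 0))) (at 0)"
proof -
  have "continuous_on {-r..r} G" using cont by (intro continuous_at_imp_continuous_on) auto
  then obtain \<Phi> where \<Phi>: "\<And>x. x \<in> {-r..r} \<Longrightarrow> (\<Phi> has_vector_derivative G x) (at x within {-r..r})"
    using antiderivative_continuous by blast
  have D: "(\<Phi> has_real_derivative G x) (at x)" if "\<bar>x\<bar> < r" for x
  proof -
    have "x \<in> interior {-r..r}" using that by (auto simp: interior_atLeastAtMost_real)
    then have "at x within {-r..r} = at x" by (rule at_within_interior)
    moreover have "(\<Phi> has_vector_derivative G x) (at x within {-r..r})" by (rule \<Phi>) (use that in auto)
    ultimately show ?thesis by (simp add: has_real_derivative_iff_has_vector_derivative)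
  qed
  \<comment> \<open>The factor \<open>Suc N\<close> in front of \<open>\<delta>\<close> leaves room
    for the base point and up to \<open>N\<close> steps.\<close>
  have bnd: "\<bar>s + real i * t\<bar> < r" if "\<bar>s\<bar> < \<delta>" "\<bar>t\<bar> < \<delta>" "i \<le> N" for s t i
  proof -
    have "\<bar>s + real i * t\<bar> \<le> \<bar>s\<bar> + real i * \<bar>t\<bar>" by (simp add: abs_mult order_trans[OF abs_triangle_ineq])
    also have "\<dots> < \<delta> + real N * \<delta>"
      using that by (intro add_less_le_mono mult_mono) auto
    also have "\<dots> \<le> r" using \<delta> by (simp add: algebra_simps)
    finally show ?thesis .
  qed
  \<comment> \<open>The integral of the left side of the difference equation at \<open>s\<close>
    over all steps between 0 and \<open>t\<close>; hence it vanishes.\<close>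
  define H where "H s t = c 0 * t * G s + (\<Sum>i=1..N. c i * (\<Phi> (s + real i * t) - \<Phi> s) / real i)" for s t
  have H0: "H s \<eta> = 0" if s: "\<bar>s\<bar> < \<delta>" for s
  proof -
    have der: "(H s has_real_derivative 0) (at t)" if t: "\<bar>t\<bar> < \<delta>" for t
    proof -
      have "(H s has_real_derivative c 0 * G s + (\<Sum>i=1..N. c i * G (s + real i * t))) (at t)"
        unfolding H_def
      proof (intro DERIV_add DERIV_sum)
        show "((\<lambda>t. c 0 * t * G s) has_real_derivative c 0 * G s) (at t)"
          by (auto intro!: derivative_eq_intros)
        fix i assume i: "i \<in> {1..N}"
        have "(\<Phi> has_real_derivative G (s + real i * t)) (at (s + real i * t))"
          using D bnd[OF s t] i by auto
        then have "((\<lambda>t. \<Phi> (s + real i * t)) has_real_derivative G (s + real i * t) * real i) (at t)"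
          by (rule DERIV_chain2) (auto intro!: derivative_eq_intros)
        then have "((\<lambda>t. c i * (\<Phi> (s + real i * t) - \<Phi> s) / real i) has_real_derivative
            c i * (G (s + real i * t) * real i - 0) / real i) (at t)"
          by (intro DERIV_cdivide DERIV_cmult DERIV_diff DERIV_const)
        then show "((\<lambda>t. c i * (\<Phi> (s + real i * t) - \<Phi> s) / real i) has_real_derivative c i * G (s + real i * t)) (at t)"
          using i by simp
      qed
      also have "c 0 * G s + (\<Sum>i=1..N. c i * G (s + real i * t)) = (\<Sum>i\<le>N. c i * G (s + real i * t))"
        by (simp add: sum.atMost_shift sum.atLeast1_atMost_eq)
      also have "\<dots> = 0" by (rule eq[OF s t])
      finally show ?thesis .
    qed
    have "H s \<eta> = H s 0"
    proof (rule DERIV_isconst2[OF \<eta>(1)])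
      show "continuous_on {0..\<eta>} (H s)"
        using der \<eta> by (intro continuous_at_imp_continuous_on ballI DERIV_isCont[of _ 0]) auto
      show "\<And>x. 0 < x \<Longrightarrow> x < \<eta> \<Longrightarrow> (H s has_real_derivative 0) (at x)" using der \<eta> by auto
    qed (use \<eta> in auto)
    then show ?thesis by (simp add: H_def)
  qed
  \<comment> \<open>Solving \<open>H s \<eta> = 0\<close> for \<open>G s\<close> gains one order of
    smoothness: the right side involves only antiderivatives of \<open>G\<close>.\<close>
  have Geq: "G s = (\<Sum>i=1..N. - c i / (c 0 * real i * \<eta>) * (\<Phi> (s + real i * \<eta>) - \<Phi> s))" if "\<bar>s\<bar> < \<delta>" for s
  proof -
    have "G s = - (\<Sum>i=1..N. c i * (\<Phi> (s + real i * \<eta>) - \<Phi> s) / real i) / (c 0 * \<eta>)"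
      using H0[OF that] c \<eta> by (simp add: H_def field_simps)
    also have "\<dots> = (\<Sum>i=1..N. - c i / (c 0 * real i * \<eta>) * (\<Phi> (s + real i * \<eta>) - \<Phi> s))"
      by (simp add: sum_divide_distrib sum_negf field_simps)
    finally show ?thesis .
  qed
  have "((\<lambda>s. \<Sum>i=1..N. - c i / (c 0 * real i * \<eta>) * (\<Phi> (s + real i * \<eta>) - \<Phi> s)) has_real_derivative
     (\<Sum>i=1..N. - c i / (c 0 * real i * \<eta>) * (G (real i * \<eta>) - G 0))) (at 0)"
  proof (intro DERIV_sum DERIV_cmult DERIV_diff)
    fix i assume i: "i \<in> {1..N}"
    have "(\<Phi> has_real_derivative G (0 + real i * \<eta>)) (at (0 + real i * \<eta>))"
      using D bnd[of 0 \<eta> i] i \<eta> by auto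
    then have "((\<lambda>s. \<Phi> (s + real i * \<eta>)) has_real_derivative G (0 + real i * \<eta>) * 1) (at 0)"
      by (rule DERIV_chain2) (auto intro!: derivative_eq_intros)
    then show "((\<lambda>s. \<Phi> (s + real i * \<eta>)) has_real_derivative G (real i * \<eta>)) (at 0)" by simp
    show "(\<Phi> has_real_derivative G 0) (at 0)" using D bnd[of 0 0 0] \<eta> by simp
  qed
  moreover have "\<forall>\<^sub>F s in nhds 0. \<bar>s\<bar> < \<delta>"
    using \<eta> by (intro eventually_nhds_in_open[of "{-\<delta><..<\<delta>}", THEN eventually_mono]) auto
  then have ev: "\<forall>\<^sub>F s in nhds 0. G s = (\<Sum>i=1..N. - c i / (c 0 * real i * \<eta>) * (\<Phi> (s + real i * \<eta>) - \<Phi> s))"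
    by eventually_elim (rule Geq)
  ultimately show ?thesis by (simp only: DERIV_cong_ev[OF refl ev refl])
qed

text \<open>Degree less than \<open>d\<close> near \<open>0\<close> in the directions of \<open>S\<close>, encoded by the vanishing of all
  \<open>d\<close>-fold mixed differences for small steps; no differentiability is assumed.\<close>

definition locally_polynomial :: "'i set \<Rightarrow> nat \<Rightarrow> (('i \<Rightarrow> real) \<Rightarrow> real) \<Rightarrow> bool" where
  "locally_polynomial S d g \<longleftrightarrow>
     (\<exists>\<epsilon>>0. \<forall>h F. near_zero \<epsilon> h \<longrightarrow> F \<in> S \<longrightarrow> isCont (\<lambda>t. g (h(F := h F + t))) 0) \<and>
     (\<forall>Fs. set Fs \<subseteq> S \<longrightarrow> length Fs = d \<longrightarrow> mdiff_vanishes Fs g)"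

lemma mdiff_vanishesE:
  assumes "mdiff_vanishes Fs g"
  obtains \<epsilon> where "\<epsilon> > 0" "\<And>zs h. map fst zs = Fs \<Longrightarrow> small_steps \<epsilon> zs \<Longrightarrow> near_zero \<epsilon> h \<Longrightarrow> mdiff zs g h = 0"
  using assms unfolding mdiff_vanishes_def by blast

lemma mdiff_vanishesI:
  assumes "\<epsilon> > 0" "\<And>zs h. map fst zs = Fs \<Longrightarrow> small_steps \<epsilon> zs \<Longrightarrow> near_zero \<epsilon> h \<Longrightarrow> mdiff zs g h = 0"
  shows "mdiff_vanishes Fs g"
  using assms unfolding mdiff_vanishes_def by blast

text \<open>The step \<open>\<eta>\<close> and the coefficients \<open>k\<close> are the same for
  all \<open>h\<close> near 0, so regularity of \<open>g\<close> in every direction of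
  \<open>S\<close> passes to its partial derivative, which is a fixed finite combination of shifts
  of \<open>g\<close>.\<close>

lemma pd_eq_combination_of_shifts:
  assumes g: "locally_polynomial S d g" and F: "F \<in> S"
  obtains \<epsilon> k \<eta> where "\<epsilon> > 0"
    "\<And>i::nat. i \<le> d \<Longrightarrow> \<bar>real i * \<eta>\<bar> < \<epsilon>" 
    "\<And>h. near_zero \<epsilon> h \<Longrightarrow> ((\<lambda>t. g (h(F := h F + t))) has_real_derivative pd F g h) (at 0)"
    "\<And>h. near_zero \<epsilon> h \<Longrightarrow> pd F g h = (\<Sum>i=1..d. k i * (g (\<lambda>X. h X + axis_vec F (real i * \<eta>) X) - g h))"
    "\<And>h F. near_zero (2 * \<epsilon>) h \<Longrightarrow> F \<in> S \<Longrightarrow> isCont (\<lambda>t. g (h(F := h F + t))) 0"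
proof -
  obtain \<epsilon>1 where e1: "\<epsilon>1 > 0" "\<And>h F. near_zero \<epsilon>1 h \<Longrightarrow> F \<in> S \<Longrightarrow> isCont (\<lambda>t. g (h(F := h F + t))) 0"
    using g unfolding locally_polynomial_def by blast
  have "set (replicate d F) \<subseteq> S" using F by auto
  then have "mdiff_vanishes (replicate d F) g" using g unfolding locally_polynomial_def by simp
  then obtain \<epsilon>2 where e2: "\<epsilon>2 > 0" "\<And>zs h. map fst zs = replicate d F \<Longrightarrow> small_steps \<epsilon>2 zs \<Longrightarrow> near_zero \<epsilon>2 h \<Longrightarrow> mdiff zs g h = 0"
    by (rule mdiff_vanishesE) blast
  \<comment> \<open>Half is kept in reserve: shifts by less than \<open>\<epsilon>\<close> stay
    within \<open>2 * \<epsilon>\<close>, where \<open>g\<close> is still under control.\<close>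
  define \<epsilon> where "\<epsilon> = min \<epsilon>1 \<epsilon>2 / 2"
  have eps: "\<epsilon> > 0" "2 * \<epsilon> \<le> \<epsilon>1" "2 * \<epsilon> \<le> \<epsilon>2" using e1(1) e2(1) by (auto simp: \<epsilon>_def)
  obtain c where c: "c 0 \<noteq> 0" "\<And>F t g (h :: 'a \<Rightarrow> real). mdiff (replicate d (F, t)) g h
     = (\<Sum>i\<le>d. c i * g (\<lambda>X. h X + axis_vec F (real i * t) X))"
    using mdiff_replicate_expansion[where 'i = 'a, of d] by blast
  define r where "r = \<epsilon> / 2"
  define \<delta> where "\<delta> = r / real (Suc d)"
  define \<eta> where "\<eta> = \<delta> / 2"
  have r: "r > 0" "r < \<epsilon>" using eps by (auto simp: r_def)
  have del: "\<delta> > 0" "real (Suc d) * \<delta> \<le> r" "\<delta> \<le> r"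
    using r by (auto simp: \<delta>_def field_simps)
  have \<eta>: "0 < \<eta>" "\<eta> < \<delta>" using del by (auto simp: \<eta>_def)
  define k where "k i = - c i / (c 0 * real i * \<eta>)" for i
  have small: "\<bar>real i * \<eta>\<bar> < \<epsilon>" if "i \<le> d" for i
  proof -
    have "\<bar>real i * \<eta>\<bar> \<le> real (Suc d) * \<delta>"
      using \<eta> that by (simp add: abs_mult, intro mult_mono, auto)
    then show ?thesis using del r by linarith
  qed
  have main: "((\<lambda>t. g (h(F := h F + t))) has_real_derivative
      (\<Sum>i=1..d. k i * (g (\<lambda>X. h X + axis_vec F (real i * \<eta>) X) - g h))) (at 0)"
    if h: "near_zero \<epsilon> h" for h
  proof -
    define G where "G s = g (\<lambda>X. h X + axis_vec F s X)" for s
    have "isCont G s" if s: "\<bar>s\<bar> \<le> r" for s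
    proof -
      let ?h = "\<lambda>X. h X + axis_vec F s X"
      have "near_zero (\<epsilon> + \<epsilon>) ?h" using s r by (intro near_zero_add h near_zero_axis_vec) auto
      then have "near_zero \<epsilon>1 ?h" using near_zero_mono eps(2) by fastforce
      then have "isCont (\<lambda>t. g (?h(F := ?h F + t))) 0" by (rule e1(2)[OF _ F])
      moreover have "(\<lambda>t. g (?h(F := ?h F + t))) = (\<lambda>t. G (s + t))"
        unfolding fun_upd_add_eq G_def by (intro ext arg_cong[of _ _ g]) (auto simp: axis_vec_def)
      ultimately have "isCont (\<lambda>t. G (s + t)) 0" by simp
      then have "(\<lambda>t. G (s + t)) \<midarrow>0\<rightarrow> G s" by (simp add: isCont_def)
      then show ?thesis unfolding isCont_def by (rule LIM_offset_zero_cancel)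
    qed
    moreover have "(\<Sum>i\<le>d. c i * G (s + real i * t)) = 0" if s: "\<bar>s\<bar> < \<delta>" and t: "\<bar>t\<bar> < \<delta>" for s t
    proof -
      let ?h = "\<lambda>X. h X + axis_vec F s X"
      have "near_zero (\<epsilon> + \<epsilon>) ?h" using s del r by (intro near_zero_add h near_zero_axis_vec) auto
      then have "near_zero \<epsilon>2 ?h" using near_zero_mono eps(3) by fastforce
      moreover have "small_steps \<epsilon>2 (replicate d (F, t))"
        using t del r eps by (auto simp: small_steps_def)
      ultimately have "mdiff (replicate d (F, t)) g ?h = 0"
        by (intro e2(2)) (auto simp: map_replicate)
      moreover have "(\<lambda>X. ?h X + axis_vec F (real i * t) X) = (\<lambda>X. h X + axis_vec F (s + real i * t) X)" for i
        by (auto simp: axis_vec_def)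
      ultimately show ?thesis unfolding c(2) G_def by simp
    qed
    ultimately have "(G has_real_derivative (\<Sum>i=1..d. - c i / (c 0 * real i * \<eta>) * (G (real i * \<eta>) - G 0))) (at 0)"
      by (intro difference_equation_has_derivative[of c r G \<delta> d \<eta>] c(1) del(2) \<eta>) blast+
    moreover have "G 0 = g h" by (simp add: G_def axis_vec_def)
    ultimately show ?thesis unfolding G_def k_def fun_upd_add_eq by simp
  qed
  then have pd: "pd F g h = (\<Sum>i=1..d. k i * (g (\<lambda>X. h X + axis_vec F (real i * \<eta>) X) - g h))"
    if "near_zero \<epsilon> h" for h
    unfolding pd_def using that by (intro DERIV_imp_deriv)
  show ?thesis
  proof (rule that[of \<epsilon> \<eta> k])
    show "\<And>h F. near_zero (2 * \<epsilon>) h \<Longrightarrow> F \<in> S \<Longrightarrow> isCont (\<lambda>t. g (h(F := h F + t))) 0"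
      using e1(2) eps near_zero_mono by blast
  qed (use eps small main pd in auto)
qed

text \<open>Continuity follows from the combination of shifts. A mixed difference of
  \<open>pd F g\<close> is a limit of mixed differences of the quotients of \<open>g\<close> in
  direction \<open>F\<close>; these have one direction more, so they vanish by the bound for
  \<open>g\<close>.\<close>

lemma locally_polynomial_pd:
  assumes g: "locally_polynomial S d g" and F: "F \<in> S"
  shows "locally_polynomial S (d - 1) (pd F g)"
    and "\<exists>\<epsilon>>0. \<forall>h. near_zero \<epsilon> h \<longrightarrow> ((\<lambda>t. g (h(F := h F + t))) has_real_derivative pd F g h) (at 0)"
proof -
  obtain \<epsilon> k \<eta> where eps: "\<epsilon> > 0" "\<And>i::nat. i \<le> d \<Longrightarrow> \<bar>real i * \<eta>\<bar> < \<epsilon>" 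
    and der: "\<And>h. near_zero \<epsilon> h \<Longrightarrow> ((\<lambda>t. g (h(F := h F + t))) has_real_derivative pd F g h) (at 0)"
    and pd: "\<And>h. near_zero \<epsilon> h \<Longrightarrow> pd F g h = (\<Sum>i=1..d. k i * (g (\<lambda>X. h X + axis_vec F (real i * \<eta>) X) - g h))"
    and cont: "\<And>h F. near_zero (2 * \<epsilon>) h \<Longrightarrow> F \<in> S \<Longrightarrow> isCont (\<lambda>t. g (h(F := h F + t))) 0"
    by (rule pd_eq_combination_of_shifts[OF assms]) blast
  show "\<exists>\<epsilon>>0. \<forall>h. near_zero \<epsilon> h \<longrightarrow> ((\<lambda>t. g (h(F := h F + t))) has_real_derivative pd F g h) (at 0)"
    using eps der by blast
  have cont': "isCont (\<lambda>t. pd F g (h(F' := h F' + t))) 0" if h: "near_zero \<epsilon> h" and F': "F' \<in> S" for h F'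
  proof -
    have 1: "isCont (\<lambda>t. g (\<lambda>X. (h(F' := h F' + t)) X + axis_vec F (real i * \<eta>) X)) 0" if "i \<le> d" for i
    proof -
      let ?h = "\<lambda>X. h X + axis_vec F (real i * \<eta>) X"
      have "near_zero (\<epsilon> + \<epsilon>) ?h" by (intro near_zero_add h near_zero_axis_vec eps that)
      then have "isCont (\<lambda>t. g (?h(F' := ?h F' + t))) 0" using cont F' by simp
      moreover have "?h(F' := ?h F' + t) = (\<lambda>X. (h(F' := h F' + t)) X + axis_vec F (real i * \<eta>) X)" for t
        by (auto simp: axis_vec_def)
      ultimately show ?thesis by simp
    qed
    have 0: "isCont (\<lambda>t. g (h(F' := h F' + t))) 0"
    proof -
      have "(\<lambda>X. (h(F' := h F' + t)) X + axis_vec F (real 0 * \<eta>) X) = h(F' := h F' + t)" for t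
        by (auto simp: axis_vec_def)
      then show ?thesis using 1[of 0] by (simp only: le0)
    qed
    have cs: "isCont (\<lambda>t. \<Sum>i=1..d. k i * (g (\<lambda>X. (h(F' := h F' + t)) X + axis_vec F (real i * \<eta>) X) - g (h(F' := h F' + t)))) 0"
      by (intro continuous_intros 0 1) auto
    have "\<bar>h F'\<bar> < \<epsilon>" using h by (simp add: near_zero_def)
    then have "\<forall>\<^sub>F t in nhds 0. \<bar>h F' + t\<bar> < \<epsilon>"
      by (intro eventually_nhds_in_open[of "{-\<epsilon>-h F'<..<\<epsilon>-h F'}", THEN eventually_mono]) auto
    then have "\<forall>\<^sub>F t in nhds 0. near_zero \<epsilon> (h(F' := h F' + t))"
      by (rule eventually_mono) (use h in \<open>auto simp: near_zero_def\<close>)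
    then have "\<forall>\<^sub>F t in nhds 0. pd F g (h(F' := h F' + t)) = (\<Sum>i=1..d. k i * (g (\<lambda>X. (h(F' := h F' + t)) X + axis_vec F (real i * \<eta>) X) - g (h(F' := h F' + t))))"
      by (rule eventually_mono) (rule pd)
    from isCont_cong[OF this] cs show ?thesis by blast
  qed
  have van: "mdiff_vanishes Fs (pd F g)" if Fs: "set Fs \<subseteq> S" "length Fs = d - 1" for Fs
  proof (cases "d = 0")
    \<comment> \<open>Here truncated subtraction gives \<open>d - 1 = 0\<close>, and the combination
      of shifts is an empty sum, so the derivative vanishes near 0.\<close>
    case True
    have "pd F g h = 0" if "near_zero \<epsilon> h" for h using pd[OF that] True by simp
    then show ?thesis using True Fs eps by (intro mdiff_vanishesI[of \<epsilon>]) auto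
  next
    case False
    have "mdiff_vanishes (Fs @ [F]) g"
      using g F Fs False unfolding locally_polynomial_def by auto
    then obtain \<epsilon>' where e': "\<epsilon>' > 0" "\<And>zs h. map fst zs = Fs @ [F] \<Longrightarrow> small_steps \<epsilon>' zs \<Longrightarrow> near_zero \<epsilon>' h \<Longrightarrow> mdiff zs g h = 0"
      by (rule mdiff_vanishesE) blast
    \<comment> \<open>Room for the base point and \<open>d - 1\<close> steps inside the region where
      the quotients converge.\<close>
    define \<mu> where "\<mu> = min \<epsilon>' (\<epsilon> / real (d + 1))"
    have mu: "\<mu> > 0" "\<mu> \<le> \<epsilon>'" "\<mu> * real (d + 1) \<le> \<epsilon>"
      using eps(1) e'(1) by (simp_all add: \<mu>_def flip: pos_le_divide_eq)
    show ?thesis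
    proof (rule mdiff_vanishesI[OF mu(1)])
      fix zs and h :: "'a \<Rightarrow> real" assume zs: "map fst zs = Fs" "small_steps \<mu> zs" and h: "near_zero \<mu> h"
      have len: "length zs = d - 1" using zs Fs by (metis length_map)
      have "((\<lambda>t. mdiff zs (\<lambda>h. fdiff (axis_vec F t) g h / t) h) \<longlongrightarrow> mdiff zs (pd F g) h) (at 0)"
      proof (rule mdiff_tendsto_near[OF _ zs(2) h])
        fix h' :: "'a \<Rightarrow> real" assume "near_zero (\<mu> + real (length zs) * \<mu>) h'"
        moreover have "\<mu> + real (length zs) * \<mu> \<le> \<epsilon>"
        proof -
          have "\<mu> + real (length zs) * \<mu> \<le> \<mu> * real (d + 1)"
            using mu(1) by (simp add: len algebra_simps)
          then show ?thesis using mu by linarith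
        qed
        ultimately have "near_zero \<epsilon> h'" by (rule near_zero_mono)
        then show "((\<lambda>t. fdiff (axis_vec F t) g h' / t) \<longlongrightarrow> pd F g h') (at 0)"
          using der[unfolded DERIV_def] by (simp add: fdiff_def fun_upd_add_eq[symmetric])
      qed (use mu in auto)
      moreover have "\<forall>\<^sub>F t in at 0. mdiff zs (\<lambda>h. fdiff (axis_vec F t) g h / t) h = 0"
      proof -
        have "mdiff zs (\<lambda>h. fdiff (axis_vec F t) g h / t) h = 0" if "\<bar>t\<bar> < \<mu>" for t
        proof -
          have "mdiff (zs @ [(F, t)]) g h = 0"
            using that zs mu by (intro e'(2) near_zero_mono[OF h]) (auto simp: small_steps_def)
          then have "mdiff zs (fdiff (axis_vec F t) g) h = 0" by (simp add: mdiff_append)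
          then show ?thesis using mdiff_cmult[of zs "inverse t" "fdiff (axis_vec F t) g" h]
            by (simp add: divide_inverse mult.commute)
        qed
        then show ?thesis unfolding eventually_at using mu(1) by (intro exI[of _ \<mu>]) auto
      qed
      ultimately have "((\<lambda>t. 0) \<longlongrightarrow> mdiff zs (pd F g) h) (at (0::real))"
        by (rule Lim_transform_eventually)
      then show "mdiff zs (pd F g) h = 0"
        by (simp add: tendsto_const_iff)
    qed
  qed
  show "locally_polynomial S (d - 1) (pd F g)"
    unfolding locally_polynomial_def using cont' van eps(1) by blast
qed

lemma locally_polynomial_pdl:
  assumes "locally_polynomial S d g" "set Fs \<subseteq> S"
  shows "locally_polynomial S (d - length Fs) (pdl Fs g)"
  using assms(2)
proof (induction Fs)
  case (Cons F Fs)
  then have "locally_polynomial S (d - length Fs - 1) (pd F (pdl Fs g))"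
    by (intro locally_polynomial_pd) auto
  then show ?case by simp
qed (use assms in auto)

text \<open>After \<open>d\<close> derivatives the bound on the degree is 0, and the mixed
  difference along the empty list, which is the function itself, vanishes near 0.\<close>

lemma pdl_eq_0:
  assumes "locally_polynomial S d g" "set Fs \<subseteq> S" "d \<le> length Fs"
  shows "pdl Fs g (\<lambda>_. 0) = 0"
proof -
  have "locally_polynomial S 0 (pdl Fs g)" using locally_polynomial_pdl[OF assms(1,2)] assms(3) by simp
  then have "mdiff_vanishes [] (pdl Fs g)" unfolding locally_polynomial_def by auto
  then obtain \<epsilon> where "\<epsilon> > 0" "\<And>zs h. map fst zs = [] \<Longrightarrow> small_steps \<epsilon> zs \<Longrightarrow> near_zero \<epsilon> h \<Longrightarrow> mdiff zs (pdl Fs g) h = 0"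
    by (rule mdiff_vanishesE) blast
  from this(2)[of "[]" "\<lambda>_. 0"] this(1) show ?thesis by (simp add: small_steps_def near_zero_def)
qed

text \<open>The chain rule, one differentiation at a time. The identity is kept on a neighbourhood
  because the next derivative depends on it around each point; \<open>m F \<ge> 1\<close> ensures
  that rescaling does not leave the neighbourhood.\<close>

lemma pdl_rescale:
  assumes g: "locally_polynomial S d g" and Fs: "set Fs \<subseteq> S" and m: "\<And>F. m F \<ge> (1::real)"
  shows "\<exists>\<epsilon>>0. \<forall>h. near_zero \<epsilon> h \<longrightarrow>
    pdl Fs (\<lambda>h. c * g (\<lambda>F. h F / m F)) h = c * (\<Prod>F\<leftarrow>Fs. 1 / m F) * pdl Fs g (\<lambda>F. h F / m F)"
  using Fs
proof (induction Fs)
  case Nil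
  then show ?case by (auto intro: exI[of _ 1])
next
  case (Cons F Fs)
  let ?g = "\<lambda>h. c * g (\<lambda>F. h F / m F)"
  let ?C = "c * (\<Prod>F\<leftarrow>Fs. 1 / m F)"
  obtain \<epsilon>1 where e1: "\<epsilon>1 > 0" "\<And>h. near_zero \<epsilon>1 h \<Longrightarrow> pdl Fs ?g h = ?C * pdl Fs g (\<lambda>F. h F / m F)"
    using Cons by auto
  have "locally_polynomial S (d - length Fs) (pdl Fs g)"
    using locally_polynomial_pdl[OF g] Cons by simp
  from locally_polynomial_pd(2)[OF this, of F] Cons.prems
  obtain \<epsilon>2 where e2: "\<epsilon>2 > 0" "\<And>h. near_zero \<epsilon>2 h \<Longrightarrow>
     ((\<lambda>t. pdl Fs g (h(F := h F + t))) has_real_derivative pd F (pdl Fs g) h) (at 0)" by auto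
  define \<epsilon> where "\<epsilon> = min \<epsilon>1 \<epsilon>2"
  have eps: "\<epsilon> > 0" "\<epsilon> \<le> \<epsilon>1" "\<epsilon> \<le> \<epsilon>2" using e1 e2 by (auto simp: \<epsilon>_def)
  have "pd F (pdl Fs ?g) h = ?C * (1 / m F) * pd F (pdl Fs g) (\<lambda>F. h F / m F)" if h: "near_zero \<epsilon> h" for h
  proof -
    let ?h = "\<lambda>F. h F / m F"
    have "near_zero \<epsilon> ?h" unfolding near_zero_def
    proof
      fix X
      have "\<bar>h X\<bar> / m X \<le> \<bar>h X\<bar>" using m[of X] mult_right_mono[of 1 "m X" "\<bar>h X\<bar>"] by (simp add: field_simps)
      also have "\<bar>h X\<bar> < \<epsilon>" using h by (simp add: near_zero_def)
      finally show "\<bar>?h X\<bar> < \<epsilon>" using m[of X] by simp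
    qed
    then have "near_zero \<epsilon>2 ?h" using near_zero_mono eps by blast
    from e2(2)[OF this]
    have "((\<lambda>t. pdl Fs g (?h(F := ?h F + t))) has_real_derivative pd F (pdl Fs g) ?h) (at (0 / m F))" by simp
    moreover have "((\<lambda>t. t / m F) has_real_derivative 1 / m F) (at 0)"
      by (intro DERIV_cdivide DERIV_ident)
    ultimately have "((\<lambda>t. pdl Fs g (?h(F := ?h F + t / m F))) has_real_derivative pd F (pdl Fs g) ?h * (1 / m F)) (at 0)"
      by (rule DERIV_chain2)
    then have "((\<lambda>t. ?C * pdl Fs g (?h(F := ?h F + t / m F))) has_real_derivative ?C * (pd F (pdl Fs g) ?h * (1 / m F))) (at 0)"
      by (rule DERIV_cmult)
    moreover have "\<forall>\<^sub>F t in nhds 0. pdl Fs ?g (h(F := h F + t)) = ?C * pdl Fs g (?h(F := ?h F + t / m F))"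
    proof -
      have "\<bar>h F\<bar> < \<epsilon>" using h by (simp add: near_zero_def)
      then have "\<forall>\<^sub>F t in nhds 0. \<bar>h F + t\<bar> < \<epsilon>"
        by (intro eventually_nhds_in_open[of "{-\<epsilon>-h F<..<\<epsilon>-h F}", THEN eventually_mono]) auto
      then have "\<forall>\<^sub>F t in nhds 0. near_zero \<epsilon>1 (h(F := h F + t))"
        by (rule eventually_mono) (use h eps in \<open>auto simp: near_zero_def intro: order.strict_trans2\<close>)
      then show ?thesis
      proof (rule eventually_mono)
        fix t assume "near_zero \<epsilon>1 (h(F := h F + t))"
        moreover have "(\<lambda>X. (h(F := h F + t)) X / m X) = ?h(F := ?h F + t / m F)"
          by (auto simp: add_divide_distrib)
        ultimately show "pdl Fs ?g (h(F := h F + t)) = ?C * pdl Fs g (?h(F := ?h F + t / m F))"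
          using e1(2) by simp
      qed
    qed
    ultimately have "((\<lambda>t. pdl Fs ?g (h(F := h F + t))) has_real_derivative ?C * (pd F (pdl Fs g) ?h * (1 / m F))) (at 0)"
      by (simp only: DERIV_cong_ev[OF refl _ refl])
    then show ?thesis unfolding pd_def[of F "pdl Fs ?g"] by (simp add: DERIV_imp_deriv)
  qed
  then show ?case using eps(1) by (intro exI[of _ \<epsilon>]) (auto simp: mult.commute)
qed

corollary pdl_rescale_at_zero:
  assumes "locally_polynomial S d g" "set Fs \<subseteq> S" "\<And>F. m F \<ge> (1::real)"
  shows "pdl Fs (\<lambda>h. c * g (\<lambda>F. h F / m F)) (\<lambda>_. 0) = c * (\<Prod>F\<leftarrow>Fs. 1 / m F) * pdl Fs g (\<lambda>_. 0)"
proof -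
  obtain \<epsilon> where e: "\<epsilon> > 0 \<and> (\<forall>h. near_zero \<epsilon> h \<longrightarrow>
    pdl Fs (\<lambda>h. c * g (\<lambda>F. h F / m F)) h = c * (\<Prod>F\<leftarrow>Fs. 1 / m F) * pdl Fs g (\<lambda>F. h F / m F))"
    using pdl_rescale[OF assms] by (rule exE)
  then have "near_zero \<epsilon> (\<lambda>_. 0)" by (simp add: near_zero_def)
  then show ?thesis using conjunct2[OF e, rule_format, of "\<lambda>_. 0"] by simp
qed

section \<open>Volumes of simple polytopes\<close>

text \<open>Simplicity is put in terms of translations: constraints active at a common point of the
  unperturbed body are at most \<open>DIM('a)\<close> many, and each of them can be moved by some
  \<open>w\<close> that leaves the other active ones in place. Boundedness ranges over all
  \<open>h\<close>, so that every perturbed volume is finite.\<close>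

locale simple_halfspaces =
  fixes S :: "'i set" and a :: "'i \<Rightarrow> 'a::euclidean_space" and b :: "'i \<Rightarrow> real"
  assumes finite_S: "finite S"
    and nonzero: "F \<in> S \<Longrightarrow> a F \<noteq> 0"
    and bounded_body: "bounded {x. \<forall>F\<in>S. a F \<bullet> x + b F + h F \<ge> 0}"
    and simple: "T \<subseteq> S \<Longrightarrow> \<forall>F\<in>S. a F \<bullet> x + b F \<ge> 0 \<Longrightarrow> \<forall>F\<in>T. a F \<bullet> x + b F = 0 \<Longrightarrow>
      card T \<le> DIM('a) \<and> (\<forall>F\<in>T. \<exists>w. a F \<bullet> w = 1 \<and> (\<forall>G\<in>T - {F}. a G \<bullet> w = 0))"
begin

definition body :: "('i \<Rightarrow> real) \<Rightarrow> 'a set" where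
  "body h = {x. \<forall>F\<in>S. a F \<bullet> x + b F + h F \<ge> 0}"

definition vol :: "('i \<Rightarrow> real) \<Rightarrow> real" where
  "vol h = measure lebesgue (body h)"

lemma compact_body: "compact (body h)"
proof -
  have eq: "body h = (\<Inter>F\<in>S. {x. a F \<bullet> x \<ge> - b F - h F})"
  proof -
    have "0 \<le> a F \<bullet> x + b F + h F \<longleftrightarrow> a F \<bullet> x \<ge> - b F - h F" for F x by linarith
    then show ?thesis unfolding body_def by auto
  qed
  have "closed (body h)" unfolding eq by (intro closed_INT ballI closed_halfspace_ge)
  then show ?thesis using bounded_body[of h] by (simp add: compact_eq_bounded_closed body_def)
qed

lemma lmeasurable_body: "body h \<in> lmeasurable"
  using compact_body by (rule lmeasurable_compact)

lemma integrable_indicator_body: "integrable lebesgue (indicat_real (body h))"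
  using lmeasurable_body by (simp add: lmeasurable_iff_integrable)

lemma vol_eq_integral: "vol h = (\<integral>x. indicat_real (body h) x \<partial>lebesgue)"
  using lmeasurable_body by (simp add: vol_def lmeasurable_iff_integrable)

lemma body_translate: "body (\<lambda>F. h F + a F \<bullet> w) = (\<lambda>x. x - w) ` body h"
proof
  show "body (\<lambda>F. h F + a F \<bullet> w) \<subseteq> (\<lambda>x. x - w) ` body h"
  proof
    fix x assume "x \<in> body (\<lambda>F. h F + a F \<bullet> w)"
    then have "x + w \<in> body h" by (simp add: body_def inner_add_right algebra_simps)
    then show "x \<in> (\<lambda>x. x - w) ` body h" by (rule rev_image_eqI) simp
  qed
qed (auto simp: body_def inner_diff_right)

lemma vol_translate: "vol (\<lambda>F. h F + a F \<bullet> w) = vol h"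
  unfolding vol_def body_translate by (rule measure_translation_subtract)

lemma body_cong: "(\<And>F. F \<in> S \<Longrightarrow> h F = h' F) \<Longrightarrow> body h = body h'"
  by (auto simp: body_def)

lemma vol_cong: "(\<And>F. F \<in> S \<Longrightarrow> h F = h' F) \<Longrightarrow> vol h = vol h'"
  unfolding vol_def using body_cong by metis

lemma body_mono: "(\<And>F. F \<in> S \<Longrightarrow> h F \<le> h' F) \<Longrightarrow> body h \<subseteq> body h'"
  unfolding body_def by (auto intro: order_trans[OF _ add_left_mono])

text \<open>Dominated convergence: off the boundary hyperplane of \<open>F\<close>, which is a null
  set, the indicator is eventually constant along the sequence, and the body with the largest
  perturbation dominates.\<close>

lemma isCont_vol:
  assumes F: "F \<in> S"
  shows "isCont (\<lambda>t. vol (h(F := h F + t))) 0"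
unfolding continuous_at_sequentially o_def
proof (intro allI impI)
  fix s :: "nat \<Rightarrow> real" assume s: "s \<longlonglongrightarrow> 0"
  then obtain K where K: "\<And>n. \<bar>s n\<bar> \<le> K" using convergent_imp_Bseq[OF convergentI[OF s]] by (auto simp: Bseq_def)
  have "(\<lambda>n. \<integral>x. indicat_real (body (h(F := h F + s n))) x \<partial>lebesgue)
     \<longlonglongrightarrow> (\<integral>x. indicat_real (body h) x \<partial>lebesgue)"
  proof (rule integral_dominated_convergence)
    show "integrable lebesgue (indicat_real (body (h(F := h F + K))))" by (rule integrable_indicator_body)
    show "AE x in lebesgue. (\<lambda>n. indicat_real (body (h(F := h F + s n))) x) \<longlonglongrightarrow> indicat_real (body h) x"
    proof -
      have "negligible {x. a F \<bullet> x = - b F - h F}" using nonzero[OF F] by (intro negligible_hyperplane) auto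
      then have "{x. a F \<bullet> x = - b F - h F} \<in> null_sets lebesgue" by (simp add: negligible_iff_null_sets)
      then have "AE x in lebesgue. x \<notin> {x. a F \<bullet> x = - b F - h F}" by (rule AE_not_in)
      then show ?thesis
      proof (rule AE_mp, intro AE_I2 impI)
        fix x assume "x \<notin> {x. a F \<bullet> x = - b F - h F}"
        define c where "c = a F \<bullet> x + b F + h F"
        have c: "c \<noteq> 0" using \<open>x \<notin> _\<close> by (auto simp: c_def)
        have "\<forall>\<^sub>F n in sequentially. \<bar>s n\<bar> < \<bar>c\<bar>"
          using order_tendstoD(2)[OF tendsto_rabs_zero[OF s], of "\<bar>c\<bar>"] c by simp
        then have "\<forall>\<^sub>F n in sequentially. indicat_real (body (h(F := h F + s n))) x = indicat_real (body h) x"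
        proof (rule eventually_mono)
          fix n assume "\<bar>s n\<bar> < \<bar>c\<bar>"
          then have "a F \<bullet> x + b F + (h F + s n) \<ge> 0 \<longleftrightarrow> a F \<bullet> x + b F + h F \<ge> 0" by (auto simp: c_def)
          then have "x \<in> body (h(F := h F + s n)) \<longleftrightarrow> x \<in> body h" unfolding body_def using F by auto
          then show "indicat_real (body (h(F := h F + s n))) x = indicat_real (body h) x"
            by (simp add: indicator_def)
        qed
        then show "(\<lambda>n. indicat_real (body (h(F := h F + s n))) x) \<longlonglongrightarrow> indicat_real (body h) x"
          by (rule tendsto_eventually)
      qed
    qed
    show "AE x in lebesgue. norm (indicat_real (body (h(F := h F + s n))) x) \<le> indicat_real (body (h(F := h F + K))) x" for n
    proof (rule AE_I2)
      fix x
      have "body (h(F := h F + s n)) \<subseteq> body (h(F := h F + K))"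
        using K[of n] by (intro body_mono) auto
      then show "norm (indicat_real (body (h(F := h F + s n))) x) \<le> indicat_real (body (h(F := h F + K))) x"
        by (auto simp: indicator_def)
    qed
  qed (use integrable_indicator_body in auto)
  then show "(\<lambda>n. vol (h(F := h F + s n))) \<longlonglongrightarrow> vol (h(F := h F + 0))"
    by (simp add: vol_eq_integral)
qed

text \<open>Reduces vanishing of a mixed difference of volumes to vanishing of the mixed differences
  of indicators at each point.\<close>

lemma mdiff_vol_eq_integral:
  "integrable lebesgue (\<lambda>x. mdiff zs (\<lambda>h. indicat_real (body h) x) h) \<and>
   mdiff zs vol h = (\<integral>x. mdiff zs (\<lambda>h. indicat_real (body h) x) h \<partial>lebesgue)"
proof (induction zs arbitrary: h)
  case Nil
  then show ?case using integrable_indicator_body by (simp add: vol_eq_integral)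
next
  case (Cons z zs)
  obtain F t where z: "z = (F, t)" by fastforce
  show ?case unfolding z mdiff.simps fdiff_def
    using Cons[of h] Cons[of "\<lambda>X. h X + axis_vec F t X"] by (simp add: Bochner_Integration.integral_diff)
qed

text \<open>Halfspaces without a common boundary point in \<open>body 0\<close>: every point is bounded away from
  one of the constraints, so the mixed difference of the indicator functions vanishes pointwise.\<close>

lemma disjoint_facets_gap:
  assumes T: "T \<subseteq> S" "\<not> (\<exists>x. (\<forall>F\<in>S. a F \<bullet> x + b F \<ge> 0) \<and> (\<forall>F\<in>T. a F \<bullet> x + b F = 0))"
  obtains \<epsilon> where "\<epsilon> > 0" "\<And>x. (\<exists>F\<in>S. a F \<bullet> x + b F < - \<epsilon>) \<or> (\<exists>F\<in>T. a F \<bullet> x + b F > \<epsilon>)"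
proof -
  \<comment> \<open>A decreasing sequence of compact sets; a point in all of them would be a common
    boundary point, so some \<open>K n\<close> is empty.\<close>
  define K where "K n = {x. (\<forall>F\<in>S. a F \<bullet> x + b F + 1 / real (Suc n) \<ge> 0) \<and> (\<forall>F\<in>T. a F \<bullet> x + b F \<le> 1 / real (Suc n))}" for n
  have "\<exists>n. K n = {}"
  proof (rule ccontr)
    assume "\<nexists>n. K n = {}"
    then have ne: "K n \<noteq> {}" for n by blast
    have comp: "compact (K n)" for n
    proof -
      have "K n = body (\<lambda>_. 1 / real (Suc n)) \<inter> (\<Inter>F\<in>T. {x. a F \<bullet> x \<le> 1 / real (Suc n) - b F})"
        unfolding K_def body_def by (intro set_eqI) (simp add: algebra_simps)
      then show ?thesis using compact_body
        by (simp add: compact_Int_closed closed_INT closed_halfspace_le)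
    qed
    have "K n \<subseteq> K m" if "m \<le> n" for m n
    proof
      fix x assume x: "x \<in> K n"
      have le: "1 / real (Suc n) \<le> 1 / real (Suc m)" using that by (simp add: field_simps)
      show "x \<in> K m" unfolding K_def
      proof (intro CollectI conjI ballI)
        fix F assume "F \<in> S"
        then have "a F \<bullet> x + b F + 1 / real (Suc n) \<ge> 0" using x by (simp add: K_def)
        then show "a F \<bullet> x + b F + 1 / real (Suc m) \<ge> 0" using le by linarith
      next
        fix F assume "F \<in> T"
        then have "a F \<bullet> x + b F \<le> 1 / real (Suc n)" using x by (simp add: K_def)
        then show "a F \<bullet> x + b F \<le> 1 / real (Suc m)" using le by linarith
      qed
    qed
    then have "\<Inter>(range K) \<noteq> {}" using compact_nest[of K] comp ne by blast
    then obtain x where x: "\<And>n. x \<in> K n" by blast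
    have lim: "(\<lambda>n. 1 / real (Suc n)) \<longlonglongrightarrow> 0" using LIMSEQ_inverse_real_of_nat by (simp add: inverse_eq_divide)
    have 1: "a F \<bullet> x + b F \<ge> 0" if "F \<in> S" for F
    proof -
      have "(\<lambda>n. a F \<bullet> x + b F + 1 / real (Suc n)) \<longlonglongrightarrow> a F \<bullet> x + b F + 0" by (intro tendsto_intros lim)
      moreover have "a F \<bullet> x + b F + 1 / real (Suc n) \<ge> 0" for n using x[of n] that by (simp add: K_def)
      ultimately show ?thesis using LIMSEQ_le_const[of _ "a F \<bullet> x + b F + 0" 0] by simp
    qed
    have 2: "a F \<bullet> x + b F \<le> 0" if "F \<in> T" for F
    proof -
      have "a F \<bullet> x + b F \<le> 1 / real (Suc n)" for n using x[of n] that by (simp add: K_def)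
      then show ?thesis using LIMSEQ_le_const[OF lim] by blast
    qed
    from 1 2 T show False by (meson antisym subsetD)
  qed
  then obtain n where n: "K n = {}" by blast
  show ?thesis
  proof (rule that[of "1 / real (Suc n)"])
    fix x
    have "x \<notin> K n" using n by blast
    then show "(\<exists>F\<in>S. a F \<bullet> x + b F < - (1 / real (Suc n))) \<or> (\<exists>F\<in>T. a F \<bullet> x + b F > 1 / real (Suc n))"
    proof -
      have *: "0 \<le> a F \<bullet> x + b F + c \<longleftrightarrow> \<not> a F \<bullet> x + b F < - c" for F c by linarith
      show ?thesis using \<open>x \<notin> K n\<close> unfolding K_def mem_Collect_eq * by (meson not_le)
    qed
  qed simp
qed

text \<open>A point that violates some constraint by more than \<open>\<epsilon>0\<close> lies
  outside all bodies sampled by the difference. A point with slack above \<open>\<epsilon>0\<close>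
  at some \<open>F\<close> of the list does not notice the step in \<open>F\<close>, so the
  difference in that direction is already 0.\<close>

lemma mdiff_vanishes_disjoint:
  assumes T: "set Fs \<subseteq> S" "\<not> (\<exists>x. (\<forall>F\<in>S. a F \<bullet> x + b F \<ge> 0) \<and> (\<forall>F\<in>set Fs. a F \<bullet> x + b F = 0))"
  shows "mdiff_vanishes Fs vol"
proof -
  obtain \<epsilon>0 where e0: "\<epsilon>0 > 0" "\<And>x. (\<exists>F\<in>S. a F \<bullet> x + b F < - \<epsilon>0) \<or> (\<exists>F\<in>set Fs. a F \<bullet> x + b F > \<epsilon>0)"
    by (rule disjoint_facets_gap[OF T]) blast
  \<comment> \<open>Small enough that base point and all steps together move each constraint by less
    than \<open>\<epsilon>0\<close>.\<close>
  define \<epsilon> where "\<epsilon> = \<epsilon>0 / real (length Fs + 2)"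
  have eps: "\<epsilon> > 0" "real (length Fs + 2) * \<epsilon> = \<epsilon>0" using e0(1) by (auto simp: \<epsilon>_def)
  show ?thesis
  proof (rule mdiff_vanishesI[OF eps(1)])
    fix zs and h :: "'i \<Rightarrow> real" assume zs: "map fst zs = Fs" "small_steps \<epsilon> zs" and h: "near_zero \<epsilon> h"
    have len: "length zs = length Fs" using zs by (metis length_map)
    have "mdiff zs (\<lambda>h. indicat_real (body h) x) h = 0" for x
      using e0(2)[of x]
    proof
      assume "\<exists>F\<in>S. a F \<bullet> x + b F < - \<epsilon>0"
      then obtain F where F: "F \<in> S" "a F \<bullet> x + b F < - \<epsilon>0" by blast
      have "mdiff zs (\<lambda>h. indicat_real (body h) x) h = mdiff zs (\<lambda>h. 0) h"
      proof (rule mdiff_cong_near[OF _ zs(2) h])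
        fix h' :: "'i \<Rightarrow> real" assume "near_zero (\<epsilon> + real (length zs) * \<epsilon>) h'"
        moreover have "\<epsilon> + real (length zs) * \<epsilon> \<le> \<epsilon>0" using eps len by (simp add: algebra_simps)
        ultimately have "\<bar>h' F\<bar> < \<epsilon>0" unfolding near_zero_def by (meson order.strict_trans2)
        then have "x \<notin> body h'" using F unfolding body_def by fastforce
        then show "indicat_real (body h') x = 0" by simp
      qed (use eps in auto)
      then show ?thesis by (simp add: mdiff_zero)
    next
      assume "\<exists>F\<in>set Fs. a F \<bullet> x + b F > \<epsilon>0"
      then obtain F where F: "F \<in> set Fs" "a F \<bullet> x + b F > \<epsilon>0" by blast
      then obtain t where "(F, t) \<in> set zs" using zs(1) by fastforce
      then obtain xs ys where sp: "zs = xs @ (F, t) # ys" by (meson split_list)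
      have t: "\<bar>t\<bar> < \<epsilon>" using zs sp by (auto simp: small_steps_def)
      have "mdiff zs (\<lambda>h. indicat_real (body h) x) h
          = mdiff (xs @ ys) (fdiff (axis_vec F t) (\<lambda>h. indicat_real (body h) x)) h"
        by (simp add: sp mdiff_append mdiff_fdiff)
      also have "\<dots> = mdiff (xs @ ys) (\<lambda>h. 0) h"
      proof (rule mdiff_cong_near[OF _ _ h])
        show "small_steps \<epsilon> (xs @ ys)" using zs sp by (auto simp: small_steps_def)
        fix h' :: "'i \<Rightarrow> real" assume h': "near_zero (\<epsilon> + real (length (xs @ ys)) * \<epsilon>) h'"
        have l: "\<epsilon> + real (length (xs @ ys)) * \<epsilon> + \<epsilon> \<le> \<epsilon>0"
        proof -
          have "\<epsilon> + real (length (xs @ ys)) * \<epsilon> + \<epsilon> = real (length Fs + 1) * \<epsilon>"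
          proof -
            have "real (length (xs @ ys)) = real (length Fs) - 1" using len sp by simp
            then show ?thesis by (simp only:) (simp add: algebra_simps)
          qed
          also have "\<dots> \<le> real (length Fs + 2) * \<epsilon>" using eps(1) by (intro mult_right_mono) auto
          finally show ?thesis using eps by simp
        qed
        have "\<bar>h' F\<bar> < \<epsilon> + real (length (xs @ ys)) * \<epsilon>" using h' by (simp add: near_zero_def)
        then have "\<bar>h' F\<bar> + \<bar>t\<bar> < \<epsilon>0" using l t by linarith
        then have pos: "a F \<bullet> x + b F + h' F \<ge> 0" "a F \<bullet> x + b F + (h' F + t) \<ge> 0" using F(2) by linarith+
        have "x \<in> body (\<lambda>X. h' X + axis_vec F t X) \<longleftrightarrow> x \<in> body h'"
          unfolding body_def mem_Collect_eq
        proof (intro ball_cong refl)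
          fix G show "0 \<le> a G \<bullet> x + b G + (h' G + axis_vec F t G) \<longleftrightarrow> 0 \<le> a G \<bullet> x + b G + h' G"
            using pos by (cases "G = F") (auto simp: axis_vec_def)
        qed
        then show "fdiff (axis_vec F t) (\<lambda>h. indicat_real (body h) x) h' = 0"
          by (simp add: fdiff_def indicator_def)
      qed (use eps in auto)
      finally show ?thesis by (simp add: mdiff_zero)
    qed
    then show "mdiff zs vol h = 0" using mdiff_vol_eq_integral[of zs h] by simp
  qed
qed

text \<open>Induction on the number of facets missing from the list. If all listed constraints are
  active at a common point, the list, having one entry more than the dimension, repeats some
  \<open>F\<close>. Translating along \<open>w\<close> undoes a step in \<open>F\<close> at the
  price of steps in unlisted facets, and telescoping these gives differences along lists with one
  more distinct entry, since \<open>F\<close> still occurs a second time.\<close>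

lemma mdiff_vanishes_vol:
  assumes "set Fs \<subseteq> S" "length Fs = DIM('a) + 1"
  shows "mdiff_vanishes Fs vol"
  using assms
proof (induction "card S - card (set Fs)" arbitrary: Fs rule: less_induct)
  case less
  show ?case
  proof (cases "\<exists>x. (\<forall>F\<in>S. a F \<bullet> x + b F \<ge> 0) \<and> (\<forall>F\<in>set Fs. a F \<bullet> x + b F = 0)")
    case False
    then show ?thesis using mdiff_vanishes_disjoint less.prems by blast
  next
    case True
    then obtain x where x: "\<forall>F\<in>S. a F \<bullet> x + b F \<ge> 0" "\<forall>F\<in>set Fs. a F \<bullet> x + b F = 0" by blast
    note simp_T = simple[OF less.prems(1) x]
    then have "\<not> distinct Fs" using less.prems distinct_card by fastforce
    then obtain A F B where Fs: "Fs = A @ F # B" and FB: "F \<in> set B"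
      using not_distinct_decomp[of Fs] by fastforce
    define T where "T = set Fs"
    have T: "T = set (A @ B)" using Fs FB by (auto simp: T_def)
    obtain w where w: "a F \<bullet> w = 1" "\<And>G. G \<in> T \<Longrightarrow> G \<noteq> F \<Longrightarrow> a G \<bullet> w = 0"
      using simp_T Fs unfolding T_def by fastforce
    have "\<forall>G\<in>S - T. \<exists>\<epsilon>>0. \<forall>zs h. map fst zs = G # A @ B \<longrightarrow> small_steps \<epsilon> zs \<longrightarrow> near_zero \<epsilon> h \<longrightarrow> mdiff zs vol h = 0"
    proof
      fix G assume G: "G \<in> S - T"
      have "card (set Fs) < card (set (G # A @ B))" using G T by (simp add: T_def)
      moreover have "set (G # A @ B) \<subseteq> S" using G T less.prems(1) by (auto simp: T_def)
      moreover have "card (set (G # A @ B)) \<le> card S" using finite_S calculation(2) by (rule card_mono)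
      ultimately have "mdiff_vanishes (G # A @ B) vol"
        using less.prems(2) by (intro less.hyps) (auto simp: Fs)
      then show "\<exists>\<epsilon>>0. \<forall>zs h. map fst zs = G # A @ B \<longrightarrow> small_steps \<epsilon> zs \<longrightarrow> near_zero \<epsilon> h \<longrightarrow> mdiff zs vol h = 0"
        by (simp only: mdiff_vanishes_def)
    qed
    then obtain E where E: "\<And>G. G \<in> S - T \<Longrightarrow> E G > 0"
      "\<And>G zs h. G \<in> S - T \<Longrightarrow> map fst zs = G # A @ B \<Longrightarrow> small_steps (E G) zs \<Longrightarrow> near_zero (E G) h \<Longrightarrow> mdiff zs vol h = 0"
      by metis
    define \<epsilon>' where "\<epsilon>' = Min (insert 1 (E ` (S - T)))"
    have e'0: "\<epsilon>' > 0" unfolding \<epsilon>'_def using finite_S E(1) by (subst Min_gr_iff) auto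
    have e'E: "\<epsilon>' \<le> E G" if "G \<in> S - T" for G unfolding \<epsilon>'_def using finite_S that by (intro Min_le) auto
    define M where "M = 1 + (\<Sum>G\<in>S - T. \<bar>a G \<bullet> w\<bar>)"
    have M: "M \<ge> 1" by (simp add: M_def sum_nonneg)
    \<comment> \<open>The replacing steps have total size at most \<open>\<epsilon> * M\<close>, on
      top of a base point of size below \<open>\<epsilon>\<close>.\<close>
    define \<epsilon> where "\<epsilon> = \<epsilon>' / (1 + M)"
    have "\<epsilon> * (1 + M) = \<epsilon>'" using M by (simp add: \<epsilon>_def)
    then have "\<epsilon> + \<epsilon> * M = \<epsilon>'" by (simp only: distrib_left mult_1_right)
    moreover have "\<epsilon> > 0" using e'0 M by (simp add: \<epsilon>_def)
    ultimately have eps: "\<epsilon> > 0" "\<epsilon> + \<epsilon> * M = \<epsilon>'" by auto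
    have epsM: "\<epsilon> \<le> \<epsilon> * M" using eps(1) M by simp
    have "finite (S - T)" using finite_S by simp
    from ex_bij_betw_nat_finite[OF this] obtain G m where G: "bij_betw G {..<m::nat} (S - T)"
      unfolding atLeast0LessThan by blast
    have GS: "j < m \<Longrightarrow> G j \<in> S - T" for j using G bij_betwE by blast
    show ?thesis
    proof (rule mdiff_vanishesI[OF eps(1)])
      fix zs and h :: "'i \<Rightarrow> real" assume zs: "map fst zs = Fs" "small_steps \<epsilon> zs" and h: "near_zero \<epsilon> h"
      obtain zA zR where sp': "zs = zA @ zR" "map fst zA = A" "map fst zR = F # B"
        using zs(1) unfolding Fs map_eq_append_conv by auto
      obtain z zB where zR: "zR = z # zB" "fst z = F" "map fst zB = B" using sp'(3) by auto
      define t where "t = snd z"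
      have sp: "zs = zA @ (F, t) # zB" "map fst zA = A" "map fst zB = B"
        using sp' zR by (auto simp: t_def)
      have t: "\<bar>t\<bar> < \<epsilon>" using zs sp by (auto simp: small_steps_def)
      \<comment> \<open>Translation along \<open>- t\<close> times \<open>w\<close> cancels the step
        \<open>t\<close> in \<open>F\<close>, fixes the other listed facets, and perturbs the
        unlisted \<open>G j\<close> by \<open>s j\<close>; \<open>R j\<close> collects the first
        \<open>j\<close> of these perturbations.\<close>
      define s where "s j = - t * (a (G j) \<bullet> w)" for j
      define R where "R j X = (\<Sum>i<j. axis_vec (G i) (s i) X)" for j X
      have ss: "(\<Sum>j<m. \<bar>s j\<bar>) \<le> \<epsilon> * M"
      proof -
        have "(\<Sum>j<m. \<bar>s j\<bar>) = \<bar>t\<bar> * (\<Sum>j<m. \<bar>a (G j) \<bullet> w\<bar>)"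
          by (simp add: s_def abs_mult sum_distrib_left)
        also have "(\<Sum>j<m. \<bar>a (G j) \<bullet> w\<bar>) = (\<Sum>G\<in>S - T. \<bar>a G \<bullet> w\<bar>)"
          by (rule sum.reindex_bij_betw[OF G])
        also have "\<bar>t\<bar> * \<dots> \<le> \<epsilon> * M"
          using t M by (intro mult_mono) (auto simp: M_def sum_nonneg)
        finally show ?thesis .
      qed
      have sj: "\<bar>s j\<bar> < \<epsilon>'" if "j < m" for j
      proof -
        have "\<bar>s j\<bar> \<le> (\<Sum>j<m. \<bar>s j\<bar>)" using that by (intro member_le_sum) auto
        then show ?thesis using ss eps by linarith
      qed
      have Rj: "\<bar>R j X\<bar> \<le> \<epsilon> * M" if "j < m" for j X
      proof -
        have "\<bar>R j X\<bar> \<le> (\<Sum>i<j. \<bar>axis_vec (G i) (s i) X\<bar>)" unfolding R_def by (rule sum_abs)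
        also have "\<dots> \<le> (\<Sum>i<j. \<bar>s i\<bar>)" by (intro sum_mono) (auto simp: axis_vec_def)
        also have "\<dots> \<le> (\<Sum>i<m. \<bar>s i\<bar>)" using that by (intro sum_mono2) auto
        finally show ?thesis using ss by linarith
      qed
      have key: "fdiff (axis_vec F t) vol = (\<lambda>h. \<Sum>j<m. fdiff (axis_vec (G j) (s j)) vol (\<lambda>X. h X + R j X))"
      proof
        fix h
        have "vol (\<lambda>X. h X + axis_vec F t X) = vol (\<lambda>X. (h X + axis_vec F t X) + a X \<bullet> ((- t) *\<^sub>R w))"
          by (rule vol_translate[symmetric])
        also have "\<dots> = vol (\<lambda>X. h X + R m X)"
        proof (rule vol_cong)
          fix X assume X: "X \<in> S"
          have Req: "R m X = (if X \<in> S - T then - t * (a X \<bullet> w) else 0)"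
          proof -
            have "R m X = (\<Sum>j<m. axis_vec (G j) (- t * (a (G j) \<bullet> w)) X)" by (simp add: R_def s_def)
            also have "\<dots> = (\<Sum>G\<in>S - T. axis_vec G (- t * (a G \<bullet> w)) X)"
              by (rule sum.reindex_bij_betw[OF G])
            also have "\<dots> = (if X \<in> S - T then - t * (a X \<bullet> w) else 0)"
              unfolding axis_vec_def using finite_S by (simp add: sum.delta)
            finally show ?thesis .
          qed
          have "F \<in> T" using Fs by (simp add: T_def)
          then show "(h X + axis_vec F t X) + a X \<bullet> ((- t) *\<^sub>R w) = h X + R m X"
            using w X unfolding Req axis_vec_def by (cases "X = F"; cases "X \<in> T") auto
        qed
        finally have "fdiff (axis_vec F t) vol h = vol (\<lambda>X. h X + R m X) - vol (\<lambda>X. h X + R 0 X)"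
          by (simp add: fdiff_def R_def)
        also have "\<dots> = (\<Sum>j<m. vol (\<lambda>X. h X + R (Suc j) X) - vol (\<lambda>X. h X + R j X))"
          by (rule sum_lessThan_telescope[symmetric])
        also have "\<dots> = (\<Sum>j<m. fdiff (axis_vec (G j) (s j)) vol (\<lambda>X. h X + R j X))"
          by (simp add: fdiff_def R_def add.assoc)
        finally show "fdiff (axis_vec F t) vol h = (\<Sum>j<m. fdiff (axis_vec (G j) (s j)) vol (\<lambda>X. h X + R j X))" .
      qed
      have "mdiff zs vol h = mdiff (zA @ zB) (fdiff (axis_vec F t) vol) h"
        by (simp add: sp mdiff_append mdiff_fdiff)
      also have "\<dots> = (\<Sum>j<m. mdiff (zA @ zB) (fdiff (axis_vec (G j) (s j)) vol) (\<lambda>X. h X + R j X))"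
        unfolding key by (simp only: mdiff_sum mdiff_shift)
      also have "\<dots> = (\<Sum>j<m. 0)"
      proof (intro sum.cong refl)
        fix j assume "j \<in> {..<m}"
        then have j: "j < m" by simp
        have "mdiff ((G j, s j) # zA @ zB) vol (\<lambda>X. h X + R j X) = 0"
        proof (rule E(2)[OF GS[OF j]])
          show "map fst ((G j, s j) # zA @ zB) = G j # A @ B" using sp by simp
          have "\<epsilon> \<le> \<epsilon>'" using epsM eps by linarith
          then have "small_steps \<epsilon>' zs" by (rule small_steps_mono[OF zs(2)])
          then have "small_steps \<epsilon>' ((G j, s j) # zA @ zB)"
            using sj[OF j] unfolding sp small_steps_def by auto
          then show "small_steps (E (G j)) ((G j, s j) # zA @ zB)"
            using e'E[OF GS[OF j]] by (rule small_steps_mono)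
          have "near_zero \<epsilon>' (\<lambda>X. h X + R j X)" unfolding near_zero_def
          proof
            fix X
            have "\<bar>h X\<bar> < \<epsilon>" using h by (simp add: near_zero_def)
            then show "\<bar>h X + R j X\<bar> < \<epsilon>'" using Rj[OF j, of X] eps by linarith
          qed
          then show "near_zero (E (G j)) (\<lambda>X. h X + R j X)"
            using e'E[OF GS[OF j]] by (rule near_zero_mono)
        qed
        then show "mdiff (zA @ zB) (fdiff (axis_vec (G j) (s j)) vol) (\<lambda>X. h X + R j X) = 0"
          by (simp add: mdiff_fdiff)
      qed
      finally show "mdiff zs vol h = 0" by simp
    qed
  qed
qed

lemma locally_polynomial_vol: "locally_polynomial S (DIM('a) + 1) vol"
  unfolding locally_polynomial_def using isCont_vol mdiff_vanishes_vol
  by (meson zero_less_one)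

end

text \<open>A lattice lies between itself and its half, so the formula for superlattices applies
  with the prime 2, and no direction is dilated.\<close>

lemma (in vertex_frame) facet_normal_int_span:
  assumes "F facet_of P" "v \<in> F"
  shows "facet_normal (int_span e) P F = u (facet_index F)"
    and "facet_const (int_span e) P F = - (u (facet_index F) \<bullet> v)"
proof -
  have "int_span e \<subseteq> (\<lambda>x. inverse (real 2) *\<^sub>R x) ` int_span e"
  proof
    fix x assume "x \<in> int_span e"
    then obtain z where x: "x = (\<Sum>i<CARD('n). real_of_int (z i) *\<^sub>R e i)" by (auto simp: int_span_def)
    have "2 *\<^sub>R x = (\<Sum>i<CARD('n). real_of_int (2 * z i) *\<^sub>R e i)" by (simp add: x scaleR_sum_right)
    then have "2 *\<^sub>R x \<in> int_span e"
      unfolding int_span_def by (intro CollectI exI[of _ "\<lambda>i. 2 * z i"]) simp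
    then show "x \<in> (\<lambda>x. inverse (real 2) *\<^sub>R x) ` int_span e" by (rule rev_image_eqI) simp
  qed
  note eq = facet_normal_eq[OF two_is_prime_nat subset_refl this assms]
  show "facet_normal (int_span e) P F = u (facet_index F)"
    "facet_const (int_span e) P F = - (u (facet_index F) \<bullet> v)"
    using eq dilation_int_span[OF facet_index(1)[OF assms]] by simp_all
qed

text \<open>Contraction towards \<open>z\<close> by a small factor \<open>s\<close> maps the
  perturbed body into the unperturbed one, because the positive slack at \<open>z\<close> absorbs
  \<open>s * h F\<close> for the finitely many \<open>F\<close>.\<close>

lemma bounded_perturbed_halfspaces:
  fixes a :: "'i \<Rightarrow> 'a::euclidean_space"
  assumes S: "finite S" and bd: "bounded {x. \<forall>F\<in>S. a F \<bullet> x + b F \<ge> 0}"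
    and z: "\<And>F. F \<in> S \<Longrightarrow> a F \<bullet> z + b F > 0"
  shows "bounded {x. \<forall>F\<in>S. a F \<bullet> x + b F + h F \<ge> 0}"
proof -
  have "\<forall>\<^sub>F s in at_right (0::real). \<forall>F\<in>S. (1 - s) * (a F \<bullet> z + b F) - s * h F > 0"
  proof (intro eventually_ball_finite S ballI)
    fix F assume F: "F \<in> S"
    have "((\<lambda>s. (1 - s) * (a F \<bullet> z + b F) - s * h F) \<longlongrightarrow> (1 - 0) * (a F \<bullet> z + b F) - 0 * h F) (at_right 0)"
      by (intro tendsto_intros)
    then show "\<forall>\<^sub>F s in at_right (0::real). (1 - s) * (a F \<bullet> z + b F) - s * h F > 0"
      by (rule order_tendstoD(1)) (use z[OF F] in simp)
  qed
  moreover have "\<forall>\<^sub>F s in at_right (0::real). s > 0" by (rule eventually_at_right_less)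
  ultimately have "\<forall>\<^sub>F s in at_right (0::real). s > 0 \<and> (\<forall>F\<in>S. (1 - s) * (a F \<bullet> z + b F) - s * h F > 0)"
    by eventually_elim auto
  then obtain s where s: "s > 0" "\<And>F. F \<in> S \<Longrightarrow> (1 - s) * (a F \<bullet> z + b F) - s * h F > 0"
    using eventually_happens' trivial_limit_at_right_real by blast
  obtain B where B: "\<And>x. \<forall>F\<in>S. a F \<bullet> x + b F \<ge> 0 \<Longrightarrow> norm x \<le> B"
    using bd unfolding bounded_iff by blast
  have "norm x \<le> norm z + (B + norm z) / s" if x: "\<forall>F\<in>S. a F \<bullet> x + b F + h F \<ge> 0" for x
  proof -
    let ?y = "z + s *\<^sub>R (x - z)"
    have "\<forall>F\<in>S. a F \<bullet> ?y + b F \<ge> 0"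
    proof
      fix F assume F: "F \<in> S"
      have "a F \<bullet> ?y + b F = (1 - s) * (a F \<bullet> z + b F) - s * h F + s * (a F \<bullet> x + b F + h F)"
        by (simp add: inner_add_right inner_diff_right algebra_simps)
      moreover have "s * (a F \<bullet> x + b F + h F) \<ge> 0" using x F s(1) by simp
      ultimately show "a F \<bullet> ?y + b F \<ge> 0" using s(2)[OF F] by linarith
    qed
    then have "norm ?y \<le> B" by (rule B)
    moreover have "norm (s *\<^sub>R (x - z)) \<le> norm ?y + norm z"
      by (metis add_diff_cancel_left' norm_triangle_ineq4)
    ultimately have "s * norm (x - z) \<le> B + norm z" using s(1) by simp
    then have "norm (x - z) \<le> (B + norm z) / s" using s(1) by (simp add: field_simps)
    moreover have "norm x \<le> norm z + norm (x - z)" by (metis add.commute diff_add_cancel norm_triangle_ineq)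
    ultimately show ?thesis by linarith
  qed
  then show ?thesis unfolding bounded_iff by blast
qed

section \<open>Facet inequalities of a nonsingular lattice polytope\<close>

locale nonsingular_lattice_polytope =
  fixes L P :: "(real^'n) set"
  assumes L: "full_lattice L" and LP: "lattice_polytope L P" and NS: "nonsingular_polytope L P"
begin

abbreviation "facets \<equiv> {F. F facet_of P}"

lemma polyP: "polytope P" and full_dimP: "aff_dim P = int CARD('n)"
  using LP by (auto simp: lattice_polytope_def)

lemma finite_facets: "finite facets"
  using polyP by (rule finite_polytope_facets)

lemma frame_at_vertex:
  assumes "v extreme_point_of P"
  obtains e u where "vertex_frame e u P v" "L = int_span e"
  using vertex_frame_exists[OF L LP NS assms] by blast

lemma vertex_in_face:
  assumes "f face_of P" "f \<noteq> {}"
  obtains v where "v extreme_point_of P" "v \<in> f"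
proof -
  have "compact f" "convex f"
    using face_of_imp_compact[OF _ _ assms(1)] face_of_imp_convex[OF assms(1)]
      polytope_imp_compact[OF polyP] polytope_imp_convex[OF polyP] by auto
  then obtain v where "v extreme_point_of f" using extreme_point_exists_convex assms by blast
  then show ?thesis using that extreme_point_of_face[OF assms(1)] by blast
qed

lemma facet_props:
  assumes F: "F facet_of P"
  shows "facet_normal L P F \<noteq> 0"
    and "x \<in> P \<Longrightarrow> facet_normal L P F \<bullet> x + facet_const L P F \<ge> 0"
    and "F = {x \<in> P. facet_normal L P F \<bullet> x + facet_const L P F = 0}"
proof -
  obtain v where v: "v extreme_point_of P" "v \<in> F"
    using vertex_in_face F by (auto simp: facet_of_def)
  obtain e u where eu: "vertex_frame e u P v" "L = int_span e" using frame_at_vertex[OF v(1)] by blast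
  interpret vertex_frame e u P v by fact
  note n = facet_normal_int_span[OF F v(2), folded eu(2)]
  note i = facet_index[OF F v(2)]
  show "facet_normal L P F \<noteq> 0" using dual[OF i(1) i(1)] unfolding n by auto
  show "x \<in> P \<Longrightarrow> facet_normal L P F \<bullet> x + facet_const L P F \<ge> 0"
    unfolding n using nonneg i(1) by (simp add: inner_diff_right)
  show "F = {x \<in> P. facet_normal L P F \<bullet> x + facet_const L P F = 0}"
    unfolding n using i(2) by simp
qed

text \<open>The segment from an interior point \<open>z\<close> to a point outside \<open>P\<close>
  meets the boundary in some facet. The affine function of that facet is positive at
  \<open>z\<close> and vanishes at the crossing, so if it is nonnegative at the far end, the
  crossing is that end, contradicting its position outside \<open>P\<close>.\<close>

lemma polytope_eq_halfspaces:
  "{x. \<forall>F\<in>facets. facet_normal L P F \<bullet> x + facet_const L P F \<ge> 0} = P"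
  and interior_point: "\<exists>z. \<forall>F\<in>facets. facet_normal L P F \<bullet> z + facet_const L P F > 0"
proof -
  let ?l = "\<lambda>F x. facet_normal L P F \<bullet> x + facet_const L P F"
  have convP: "convex P" using polyP by (rule polytope_imp_convex)
  have ri: "rel_interior P = interior P"
    using full_dimP by (intro rel_interior_interior) (use aff_dim_eq_full[of P] in simp)
  have "rel_interior P \<noteq> {}" using full_dimP rel_interior_eq_empty[OF convP] by force
  then obtain z where z: "z \<in> rel_interior P" by blast
  then have zP: "z \<in> P" using rel_interior_subset by blast
  have zpos: "?l F z > 0" if F: "F facet_of P" for F
  proof -
    have "z \<notin> F" using z F rel_interior_of_polyhedron[OF polytope_imp_polyhedron[OF polyP]] by blast
    then show ?thesis using facet_props(2)[OF F zP] facet_props(3)[OF F] zP by (auto simp: less_le)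
  qed
  then show "\<exists>z. \<forall>F\<in>facets. facet_normal L P F \<bullet> z + facet_const L P F > 0" by blast
  show "{x. \<forall>F\<in>facets. ?l F x \<ge> 0} = P"
  proof
    show "P \<subseteq> {x. \<forall>F\<in>facets. ?l F x \<ge> 0}" using facet_props(2) by blast
    show "{x. \<forall>F\<in>facets. ?l F x \<ge> 0} \<subseteq> P"
    proof
      fix x assume x: "x \<in> {x. \<forall>F\<in>facets. ?l F x \<ge> 0}"
      show "x \<in> P"
      proof (rule ccontr)
        assume xP: "x \<notin> P"
        have "closed_segment z x \<inter> frontier P \<noteq> {}"
          using zP xP by (intro connected_Int_frontier) auto
        then obtain y where y: "y \<in> closed_segment z x" "y \<in> frontier P" by blast
        have "y \<in> rel_frontier P" using y(2) ri by (simp add: rel_frontier_def frontier_def)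
        then obtain F where F: "F facet_of P" "y \<in> F"
          using rel_frontier_of_polyhedron polyP polytope_imp_polyhedron by blast
        obtain s where s: "0 \<le> s" "s \<le> 1" "y = (1 - s) *\<^sub>R z + s *\<^sub>R x" using y(1) unfolding in_segment by blast
        have "?l F y = 0" using facet_props(3)[OF F(1)] F(2) by blast
        then have "(1 - s) * ?l F z + s * ?l F x = 0"
          unfolding s(3) by (simp add: inner_add_right algebra_simps)
        moreover have "s * ?l F x \<ge> 0" using s x F by simp
        moreover have "(1 - s) * ?l F z \<ge> 0" using s zpos[OF F(1)] by simp
        ultimately have "(1 - s) * ?l F z = 0" by linarith
        then have "s = 1" using zpos[OF F(1)] by simp
        then have "y = x" using s(3) by simp
        then show False using F xP facet_of_imp_subset by blast
      qed
    qed
  qed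
qed

text \<open>Facets with a common point of \<open>P\<close> meet in a nonempty face and so share a
  vertex. Their normals are distinct members of the dual basis there, and the edge vectors
  \<open>e\<close> serve as the translations that move one facet only.\<close>

sublocale H: simple_halfspaces facets "facet_normal L P" "facet_const L P"
proof
  show "finite facets" by (rule finite_facets)
  show "F \<in> facets \<Longrightarrow> facet_normal L P F \<noteq> 0" for F using facet_props by blast
  obtain z where z: "\<forall>F\<in>facets. facet_normal L P F \<bullet> z + facet_const L P F > 0" using interior_point by blast
  show "bounded {x. \<forall>F\<in>facets. facet_normal L P F \<bullet> x + facet_const L P F + h F \<ge> 0}" for h
    using polytope_eq_halfspaces polytope_imp_bounded[OF polyP] z finite_facets
    by (intro bounded_perturbed_halfspaces[where z = z]) auto
  fix T x assume T: "T \<subseteq> facets" and x: "\<forall>F\<in>facets. facet_normal L P F \<bullet> x + facet_const L P F \<ge> 0"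
    and xT: "\<forall>F\<in>T. facet_normal L P F \<bullet> x + facet_const L P F = 0"
  have xP: "x \<in> P" using polytope_eq_halfspaces x by blast
  have xF: "x \<in> F" if "F \<in> T" for F
    using facet_props(3)[of F] that T xT xP by blast
  have "\<Inter>(insert P T) face_of P"
    using T facet_of_imp_face_of face_of_refl[OF polytope_imp_convex[OF polyP]]
    by (intro face_of_Inter) auto
  moreover have "\<Inter>(insert P T) \<noteq> {}" using xP xF by blast
  ultimately obtain v where v: "v extreme_point_of P" "v \<in> \<Inter>(insert P T)" by (rule vertex_in_face)
  obtain e u where eu: "vertex_frame e u P v" "L = int_span e" using frame_at_vertex[OF v(1)] by blast
  interpret vertex_frame e u P v by fact
  have TF: "F facet_of P \<and> v \<in> F" if "F \<in> T" for F using that T v by blast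
  then have sub: "T \<subseteq> {F. F facet_of P \<and> v \<in> F}" by blast
  have inj: "inj_on facet_index T" using inj_on_facet_index sub by (rule inj_on_subset)
  have "card T = card (facet_index ` T)" using inj by (simp add: card_image)
  also have "\<dots> \<le> card {..<CARD('n)}"
    using TF facet_index(1) by (intro card_mono) auto
  finally have card: "card T \<le> DIM(real^'n)" by simp
  moreover have "\<exists>w. facet_normal L P F \<bullet> w = 1 \<and> (\<forall>G\<in>T - {F}. facet_normal L P G \<bullet> w = 0)" if F: "F \<in> T" for F
  proof (intro exI conjI ballI)
    have n: "facet_normal L P G = u (facet_index G)" if "G \<in> T" for G
      using facet_normal_int_span(1)[of G] TF[OF that] eu(2) by simp
    have i: "facet_index G < CARD('n)" if "G \<in> T" for G using facet_index(1) TF[OF that] by blast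
    show "facet_normal L P F \<bullet> e (facet_index F) = 1" using n[OF F] dual i[OF F] by simp
    fix G assume G: "G \<in> T - {F}"
    then have "facet_index G \<noteq> facet_index F" using inj F by (auto simp: inj_on_def)
    then show "facet_normal L P G \<bullet> e (facet_index F) = 0" using n[of G] G dual i F by simp
  qed
  ultimately show "card T \<le> DIM(real^'n) \<and> (\<forall>F\<in>T. \<exists>w. facet_normal L P F \<bullet> w = 1 \<and> (\<forall>G\<in>T - {F}. facet_normal L P G \<bullet> w = 0))"
    by blast
qed

text \<open>The same factor as \<open>dilation\<close>, but free of the choice of a vertex, since
  the volume involves all facets at once.\<close>

definition facet_dilation :: "(real^'n) set \<Rightarrow> nat \<Rightarrow> (real^'n) set \<Rightarrow> nat" where
  "facet_dilation N p F = (if facet_normal L P F \<in> dual_lattice N then 1 else p)"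

lemma facet_normal_superlattice:
  assumes p: "prime p" and N: "L \<subseteq> N" "N \<subseteq> (\<lambda>x. inverse (real p) *\<^sub>R x) ` L" and F: "F facet_of P"
  shows "facet_normal N P F = real (facet_dilation N p F) *\<^sub>R facet_normal L P F"
    and "facet_const N P F = real (facet_dilation N p F) * facet_const L P F"
proof -
  obtain v where v: "v extreme_point_of P" "v \<in> F"
    using vertex_in_face F by (auto simp: facet_of_def)
  obtain e u where eu: "vertex_frame e u P v" "L = int_span e" using frame_at_vertex[OF v(1)] by blast
  interpret vertex_frame e u P v by fact
  note n = facet_normal_int_span[OF F v(2), folded eu(2)]
  note m = facet_normal_eq[OF p N[unfolded eu(2)] F v(2)]
  show "facet_normal N P F = real (facet_dilation N p F) *\<^sub>R facet_normal L P F"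
    "facet_const N P F = real (facet_dilation N p F) * facet_const L P F"
    unfolding n m by (simp_all add: facet_dilation_def dilation_def n)
qed

text \<open>The inequality of \<open>F\<close> for \<open>N\<close> is the dilation times the
  inequality for \<open>L\<close> with \<open>h F\<close> divided by the dilation. All lattices thus
  share one volume function, and differ by a rescaling of the variables and the covolume.\<close>

lemma volfun_superlattice:
  assumes p: "prime p" and N: "L \<subseteq> N" "N \<subseteq> (\<lambda>x. inverse (real p) *\<^sub>R x) ` L"
  shows "volfun N P = (\<lambda>h. (1 / covol N) * H.vol (\<lambda>F. h F / real (facet_dilation N p F)))"
proof
  fix h :: "(real^'n) set \<Rightarrow> real"
  have "PN N P h = H.body (\<lambda>F. h F / real (facet_dilation N p F))"
    unfolding PN_def H.body_def
  proof (intro Collect_cong)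
    fix x
    have "0 \<le> facet_normal N P F \<bullet> x + facet_const N P F + h F \<longleftrightarrow>
        0 \<le> facet_normal L P F \<bullet> x + facet_const L P F + h F / real (facet_dilation N p F)" if F: "F facet_of P" for F
    proof -
      have d: "real (facet_dilation N p F) > 0" using p prime_gt_0_nat by (auto simp: facet_dilation_def)
      have "facet_normal N P F \<bullet> x + facet_const N P F + h F =
          real (facet_dilation N p F) * (facet_normal L P F \<bullet> x + facet_const L P F + h F / real (facet_dilation N p F))"
        unfolding facet_normal_superlattice[OF p N F] using d by (simp add: algebra_simps)
      then show ?thesis using d by (simp add: zero_le_mult_iff)
    qed
    then show "(\<forall>F. F facet_of P \<longrightarrow> 0 \<le> facet_normal N P F \<bullet> x + facet_const N P F + h F) =
      (\<forall>F\<in>facets. 0 \<le> facet_normal L P F \<bullet> x + facet_const L P F + h F / real (facet_dilation N p F))" by blast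
  qed
  then show "volfun N P h = (1 / covol N) * H.vol (\<lambda>F. h F / real (facet_dilation N p F))"
    by (simp add: volfun_def VolN_def H.vol_def)
qed

end

section \<open>The differential operator of a face\<close>

lemma face_deriv_list_exists:
  assumes "finite T"
  shows "\<exists>xs. \<forall>F. count_list xs F = (if F \<in> T then \<pi> F else (0::nat))"
  using assms
proof induction
  case empty
  then show ?case by (intro exI[of _ "[]"]) simp
next
  case (insert G T)
  then obtain xs where xs: "\<And>F. count_list xs F = (if F \<in> T then \<pi> F else 0)" by blast
  have rep: "count_list (replicate m G) F = (if F = G then m else 0)" for m F by (induction m) auto
  show ?case
    using insert by (intro exI[of _ "replicate (\<pi> G) G @ xs"]) (auto simp: xs rep)
qed

lemma prod_list_eq_prod_count:
  assumes "finite T" "set xs \<subseteq> T"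
  shows "(\<Prod>F\<leftarrow>xs. w F) = (\<Prod>F\<in>T. (w F :: real) ^ count_list xs F)"
  using assms(2)
proof (induction xs)
  case (Cons a xs)
  have "(\<Prod>F\<in>T. w F ^ count_list (a # xs) F) = (\<Prod>F\<in>T. (if F = a then w F else 1) * w F ^ count_list xs F)"
    by (intro prod.cong) auto
  also have "\<dots> = w a * (\<Prod>F\<in>T. w F ^ count_list xs F)"
    using Cons.prems assms(1) by (simp add: prod.distrib prod.delta')
  finally show ?case using Cons by simp
qed simp

text \<open>The list picked by \<open>SOME\<close> is known only through its multiplicities, and
  these give its set, its length and its weighted products. One list serves every function
  \<open>g\<close>, so partial derivatives never have to be interchanged.\<close>

lemma face_deriv_obtain:
  assumes fin: "finite (facets_through P f)" and pos: "\<forall>F\<in>facets_through P f. \<pi> F > 0"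
  obtains xs where "\<And>g. face_deriv P f \<pi> g = pdl xs g (\<lambda>_. 0)" "set xs = facets_through P f"
    "length xs = (\<Sum>F\<in>facets_through P f. \<pi> F)"
    "\<And>w. (\<Prod>F\<leftarrow>xs. w F) = (\<Prod>F\<in>facets_through P f. (w F :: real) ^ \<pi> F)"
proof -
  define xs where "xs = (SOME xs. \<forall>F. count_list xs F = (if F facet_of P \<and> f \<subseteq> F then \<pi> F else 0))"
  have "\<exists>xs. \<forall>F. count_list xs F = (if F facet_of P \<and> f \<subseteq> F then \<pi> F else 0)"
    using face_deriv_list_exists[OF fin, of \<pi>] by (simp add: facets_through_def)
  then have xs: "count_list xs F = (if F \<in> facets_through P f then \<pi> F else 0)" for F
    unfolding xs_def facets_through_def by (rule someI2_ex) auto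
  have set: "set xs = facets_through P f"
  proof (intro set_eqI)
    fix F
    have "F \<in> set xs \<longleftrightarrow> count_list xs F \<noteq> 0" by (simp add: count_list_0_iff)
    then show "F \<in> set xs \<longleftrightarrow> F \<in> facets_through P f" using pos by (auto simp: xs)
  qed
  have "length xs = (\<Sum>F\<in>facets_through P f. \<pi> F)"
    using sum_count_set[of xs "facets_through P f"] fin set by (simp add: xs)
  moreover have "(\<Prod>F\<leftarrow>xs. w F) = (\<Prod>F\<in>facets_through P f. (w F :: real) ^ \<pi> F)" for w
    using prod_list_eq_prod_count[OF fin, of xs w] set by (simp add: xs)
  ultimately show ?thesis using that set by (simp add: face_deriv_def xs_def)
qed

section \<open>Counting subspaces over a prime field\<close>

definition zeta :: "nat \<Rightarrow> complex" where
  "zeta p = exp (2 * of_real pi * \<i> / of_nat p)"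

lemma zeta_power_p: "p > 0 \<Longrightarrow> zeta p ^ p = 1"
  by (simp add: zeta_def flip: exp_of_nat_mult)

lemma zeta_power_eq_1_iff:
  assumes "p > 0"
  shows "zeta p ^ j = 1 \<longleftrightarrow> p dvd j"
proof -
  have "zeta p ^ j = exp (2 * of_real pi * \<i> * of_nat j / of_nat p)"
    by (simp add: zeta_def mult.commute flip: exp_of_nat_mult)
  also have "\<dots> = 1 \<longleftrightarrow> p dvd j"
    using complex_root_unity_eq_1[of p j] assms by simp
  finally show ?thesis .
qed

lemma sum_zeta_powers:
  assumes "p > 0"
  shows "(\<Sum>j<p. (zeta p ^ i) ^ j) = (if p dvd i then of_nat p else 0)"
proof (cases "p dvd i")
  case True
  then show ?thesis using zeta_power_eq_1_iff[OF assms, of i] by simp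
next
  case False
  then have "zeta p ^ i \<noteq> 1" using zeta_power_eq_1_iff[OF assms] by simp
  moreover have "(zeta p ^ i) ^ p = 1"
    by (metis zeta_power_p assms power_mult mult.commute power_one)
  ultimately show ?thesis using False by (simp add: geometric_sum)
qed

text \<open>Geometric series bring all summands over the common denominator
  \<open>1 - E ^ p\<close>, and summation over the roots of unity removes every power of
  \<open>E\<close> except the zeroth. What is left is the series for parameter 1 with the variable
  multiplied by \<open>p\<close>, which accounts for \<open>p ^ m\<close>.\<close>

lemma c_coef_distribution:
  assumes "p > 0"
  shows "(\<Sum>j<p. c_coef (zeta p ^ j) m) = of_nat p ^ m * c_coef 1 m"
proof -
  define E :: "complex fps" where "E = fps_exp (-1)"
  define Q where "Q j = fps_X / (1 - fps_const (zeta p ^ j) * E)" for j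
  define R where "R = fps_compose (Q 0) (fps_const (of_nat p) * fps_X)"
  have nz: "1 - fps_const (zeta p ^ j) * E \<noteq> 0" for j
  proof
    assume "1 - fps_const (zeta p ^ j) * E = 0"
    then have "fps_nth (1 - fps_const (zeta p ^ j) * E) 1 = 0" by simp
    then show False by (simp add: E_def zeta_def)
  qed
  \<comment> \<open>For \<open>j = 0\<close> the constant term vanishes, but the linear coefficient
    is a power of \<open>zeta p\<close>, so the denominator always divides \<open>fps_X\<close> and
    the quotient is exact.\<close>
  have sub: "subdegree (1 - fps_const (zeta p ^ j) * E) \<le> 1" for j
  proof (rule subdegree_leI)
    show "fps_nth (1 - fps_const (zeta p ^ j) * E) 1 \<noteq> 0"
      by (simp add: E_def zeta_def)
  qed
  have Qmul: "Q j * (1 - fps_const (zeta p ^ j) * E) = fps_X" for j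
  proof -
    have "(1 - fps_const (zeta p ^ j) * E) dvd fps_X"
      using sub[of j] nz[of j] by (simp add: fps_dvd_iff)
    then show ?thesis unfolding Q_def by simp
  qed
  have Ep: "E ^ p = fps_exp (- of_nat p)" by (simp add: E_def fps_exp_power_mult)
  have "(\<Sum>j<p. Q j) * (1 - E ^ p) = (\<Sum>j<p. fps_X * (\<Sum>i<p. (fps_const (zeta p ^ j) * E) ^ i))"
    unfolding sum_distrib_right
  proof (rule sum.cong[OF refl])
    fix j
    have "(fps_const (zeta p ^ j) * E) ^ p = E ^ p"
    proof -
      have "(zeta p ^ j) ^ p = 1"
        by (metis zeta_power_p assms power_mult mult.commute power_one)
      then show ?thesis by (simp add: power_mult_distrib fps_const_power)
    qed
    then have "1 - E ^ p = (1 - fps_const (zeta p ^ j) * E) * (\<Sum>i<p. (fps_const (zeta p ^ j) * E) ^ i)"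
      by (metis one_diff_power_eq)
    then show "Q j * (1 - E ^ p) = fps_X * (\<Sum>i<p. (fps_const (zeta p ^ j) * E) ^ i)"
      by (simp add: Qmul mult.assoc[symmetric])
  qed
  also have "\<dots> = fps_X * (\<Sum>i<p. \<Sum>j<p. (fps_const (zeta p ^ j) * E) ^ i)"
    unfolding sum_distrib_left[symmetric] by (subst sum.swap) simp
  also have "(\<Sum>i<p. \<Sum>j<p. (fps_const (zeta p ^ j) * E) ^ i)
      = (\<Sum>i<p. fps_const (\<Sum>j<p. (zeta p ^ i) ^ j) * E ^ i)"
  proof (rule sum.cong[OF refl])
    fix i
    have *: "fps_const (sum f A) = (\<Sum>j\<in>A. fps_const (f j))" for f :: "nat \<Rightarrow> complex" and A
      by (intro fps_ext) (simp add: fps_sum_nth)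
    have "(fps_const (zeta p ^ j) * E) ^ i = fps_const ((zeta p ^ i) ^ j) * E ^ i" for j
      by (simp add: power_mult_distrib fps_const_power mult.commute flip: power_mult)
    then show "(\<Sum>j<p. (fps_const (zeta p ^ j) * E) ^ i) = fps_const (\<Sum>j<p. (zeta p ^ i) ^ j) * E ^ i"
      by (simp add: * sum_distrib_right)
  qed
  also have "\<dots> = (\<Sum>i<p. if i = 0 then of_nat p else 0)"
  proof (rule sum.cong[OF refl])
    fix i assume "i \<in> {..<p}"
    then have "p dvd i \<longleftrightarrow> i = 0" by (auto dest: dvd_imp_le)
    then show "fps_const (\<Sum>j<p. (zeta p ^ i) ^ j) * E ^ i = (if i = 0 then of_nat p else 0)"
      unfolding sum_zeta_powers[OF assms] by (simp add: fps_of_nat)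
  qed
  also have "\<dots> = of_nat p" using assms by simp
  finally have 1: "(\<Sum>j<p. Q j) * (1 - E ^ p) = fps_X * of_nat p" .
  have "R * fps_compose (1 - E) (fps_const (of_nat p) * fps_X) = fps_compose fps_X (fps_const (of_nat p) * fps_X)"
    unfolding R_def using Qmul[of 0] by (simp add: fps_compose_mult_distrib[symmetric])
  moreover have "fps_compose (1 - E) (fps_const (of_nat p) * fps_X) = 1 - E ^ p"
    by (simp add: fps_compose_sub_distrib fps_exp_power_mult E_def)
  ultimately have "R * (1 - E ^ p) = fps_X * of_nat p"
    by (simp add: fps_of_nat mult.commute)
  with 1 have "(\<Sum>j<p. Q j) * (1 - E ^ p) = R * (1 - E ^ p)" by simp
  moreover have "1 - E ^ p \<noteq> 0"
  proof
    assume "1 - E ^ p = 0"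
    then have "fps_nth (1 - E ^ p) 1 = 0" by simp
    then show False using assms by (simp add: Ep)
  qed
  ultimately have "(\<Sum>j<p. Q j) = R" by simp
  then have "fps_nth (\<Sum>j<p. Q j) m = fps_nth R m" by simp
  then show ?thesis
    unfolding R_def fps_sum_nth c_coef_def
    by (simp add: Q_def E_def fps_compose_linear)
qed

section \<open>Additive characters modulo p\<close>

definition chi :: "nat \<Rightarrow> int \<Rightarrow> complex" where
  "chi p a = exp (2 * of_real pi * \<i> * of_int a / of_nat p)"

lemma chi_add: "chi p (a + b) = chi p a * chi p b"
  by (simp add: chi_def algebra_simps add_divide_distrib flip: exp_add)

lemma chi_0 [simp]: "chi p 0 = 1"
  by (simp add: chi_def)

lemma chi_of_nat: "chi p (int j) = zeta p ^ j"
  by (simp add: chi_def zeta_def mult.commute flip: exp_of_nat_mult)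

lemma chi_eq_1_if_dvd:
  assumes "p > 0" "int p dvd a"
  shows "chi p a = 1"
proof -
  obtain k where k: "a = int p * k" using assms by blast
  have "chi p a = exp (of_int (2 * k) * (of_real pi * \<i>))"
    using assms(1) by (simp add: chi_def k mult_ac)
  also have "\<dots> = 1" by (subst exp_eq_1) auto
  finally show ?thesis .
qed

lemma chi_mod:
  assumes "p > 0"
  shows "chi p (a mod int p) = chi p a"
proof -
  have "chi p a = chi p (int p * (a div int p) + a mod int p)" by simp
  also have "\<dots> = chi p (a mod int p)" unfolding chi_add using chi_eq_1_if_dvd[OF assms] by simp
  finally show ?thesis by simp
qed

lemma chi_cong: "p > 0 \<Longrightarrow> int p dvd a - b \<Longrightarrow> chi p a = chi p b"
  using chi_mod by (metis mod_eq_dvd_iff)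

lemma chi_eq_1_iff:
  assumes "p > 0"
  shows "chi p a = 1 \<longleftrightarrow> int p dvd a"
proof
  assume "chi p a = 1"
  then have "zeta p ^ nat (a mod int p) = 1"
    using assms chi_mod[OF assms, of a] by (simp flip: chi_of_nat)
  then have "p dvd nat (a mod int p)" using zeta_power_eq_1_iff[OF assms] by blast
  moreover have "nat (a mod int p) < p" using assms by (simp add: nat_less_iff)
  ultimately have "nat (a mod int p) = 0" using nat_dvd_not_less by blast
  moreover have "a mod int p \<ge> 0" using assms by simp
  ultimately have "a mod int p = 0" by linarith
  then show "int p dvd a" by presburger
qed (use chi_eq_1_if_dvd assms in blast)

lemma sum_chi:
  assumes "p > 0"
  shows "(\<Sum>j\<in>{0..<int p}. chi p (j * a)) = (if int p dvd a then of_nat p else 0)"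
proof -
  define b where "b = nat (a mod int p)"
  have b: "int b = a mod int p" using assms by (simp add: b_def)
  have "(\<Sum>j\<in>{0..<int p}. chi p (j * a)) = (\<Sum>j<p. chi p (int j * a))"
    by (rule sum.reindex_bij_witness[of _ int nat]) auto
  also have "\<dots> = (\<Sum>j<p. (zeta p ^ b) ^ j)"
  proof (intro sum.cong refl)
    fix j
    have "chi p (int j * a) = chi p (int j * int b)"
      using assms by (intro chi_cong) (auto simp: b right_diff_distrib[symmetric] minus_mod_eq_mult_div)
    also have "\<dots> = (zeta p ^ b) ^ j"
      by (simp add: chi_of_nat mult.commute flip: of_nat_mult power_mult)
    finally show "chi p (int j * a) = (zeta p ^ b) ^ j" .
  qed
  also have "\<dots> = (if p dvd b then of_nat p else 0)" by (rule sum_zeta_powers[OF assms])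
  also have "p dvd b \<longleftrightarrow> int p dvd a"
    by (metis b dvd_mod_iff dvd_refl int_dvd_int_iff)
  finally show ?thesis .
qed

lemma c_coef_distribution_chi:
  assumes "p > 0"
  shows "(\<Sum>j\<in>{0..<int p}. c_coef (chi p j) m) = of_nat p ^ m * c_coef 1 m"
proof -
  have "(\<Sum>j\<in>{0..<int p}. c_coef (chi p j) m) = (\<Sum>j<p. c_coef (zeta p ^ j) m)"
    by (rule sum.reindex_bij_witness[of _ int nat]) (auto simp flip: chi_of_nat)
  then show ?thesis using c_coef_distribution[OF assms] by simp
qed

section \<open>Vectors with prescribed support and orthogonality\<close>

definition Fp_coord :: "nat \<Rightarrow> nat set \<Rightarrow> (nat \<Rightarrow> int) set" where
  "Fp_coord p I = {x. (\<forall>i\<in>I. 0 \<le> x i \<and> x i < int p) \<and> (\<forall>i. i \<notin> I \<longrightarrow> x i = 0)}"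

lemma Fp_space_eq_coord: "Fp_space n p = Fp_coord p {..<n}"
  by (auto simp: Fp_space_def Fp_coord_def)

lemma Fp_coord_subset: "p > 0 \<Longrightarrow> I \<subseteq> J \<Longrightarrow> Fp_coord p I \<subseteq> Fp_coord p J"
  by (fastforce simp: Fp_coord_def)

lemma zero_in_Fp_coord [simp]: "p > 0 \<Longrightarrow> (\<lambda>_. 0) \<in> Fp_coord p I"
  by (simp add: Fp_coord_def)

lemma bij_betw_Fp_coord:
  "bij_betw (\<lambda>x i. if i \<in> I then x i else 0) (PiE I (\<lambda>_. {0..<int p})) (Fp_coord p I)"
proof (rule bij_betwI[where g = "\<lambda>x. restrict x I"])
  show "(\<lambda>x i. if i \<in> I then x i else 0) \<in> (\<Pi>\<^sub>E _\<in>I. {0..<int p}) \<rightarrow> Fp_coord p I"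
    by (auto simp: Fp_coord_def PiE_def Pi_def)
  show "(\<lambda>x. restrict x I) \<in> Fp_coord p I \<rightarrow> (\<Pi>\<^sub>E _\<in>I. {0..<int p})"
    by (auto simp: Fp_coord_def)
qed (auto simp: Fp_coord_def PiE_def extensional_def restrict_def fun_eq_iff)

lemma finite_Fp_coord: "finite I \<Longrightarrow> finite (Fp_coord p I)"
  using bij_betw_finite[OF bij_betw_Fp_coord, of I p] by (simp add: finite_PiE)

lemma sum_prod_Fp_coord:
  fixes g :: "nat \<Rightarrow> int \<Rightarrow> 'b::comm_semiring_1"
  assumes "finite I"
  shows "(\<Sum>y\<in>Fp_coord p I. \<Prod>i\<in>I. g i (y i)) = (\<Prod>i\<in>I. \<Sum>j\<in>{0..<int p}. g i j)"
proof -
  have "(\<Prod>i\<in>I. \<Sum>j\<in>{0..<int p}. g i j) = (\<Sum>y\<in>PiE I (\<lambda>_. {0..<int p}). \<Prod>i\<in>I. g i (y i))"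
    using assms by (intro prod_sum_PiE) auto
  also have "\<dots> = (\<Sum>y\<in>PiE I (\<lambda>_. {0..<int p}). \<Prod>i\<in>I. g i (if i \<in> I then y i else 0))"
    by (intro sum.cong prod.cong) auto
  also have "\<dots> = (\<Sum>y\<in>Fp_coord p I. \<Prod>i\<in>I. g i (y i))"
    by (rule sum.reindex_bij_betw[OF bij_betw_Fp_coord])
  finally show ?thesis by simp
qed

lemma card_Fp_coord: "finite I \<Longrightarrow> card (Fp_coord p I) = p ^ card I"
  using sum_prod_Fp_coord[of I "\<lambda>_ _. 1::nat" p] by simp

definition dotp :: "nat \<Rightarrow> (nat \<Rightarrow> int) \<Rightarrow> (nat \<Rightarrow> int) \<Rightarrow> int" where
  "dotp n y x = (\<Sum>i<n. y i * x i)"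

definition perp :: "nat \<Rightarrow> nat \<Rightarrow> (nat \<Rightarrow> int) \<Rightarrow> (nat \<Rightarrow> int) set \<Rightarrow> bool" where
  "perp n p y W \<longleftrightarrow> (\<forall>x\<in>W. int p dvd dotp n y x)"

lemma dotp_add_mod: "int p dvd dotp n y (\<lambda>i. (x i + x' i) mod int p) - (dotp n y x + dotp n y x')"
proof -
  have "dotp n y (\<lambda>i. (x i + x' i) mod int p) - (dotp n y x + dotp n y x')
      = (\<Sum>i<n. y i * ((x i + x' i) mod int p - (x i + x' i)))"
    by (simp add: dotp_def sum.distrib[symmetric] sum_subtractf[symmetric] algebra_simps)
  also have "int p dvd \<dots>"
    by (intro dvd_sum dvd_mult) (metis dvd_minus_mod dvd_minus_iff minus_diff_eq)
  finally show ?thesis .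
qed

lemma dotp_mult_mod: "int p dvd dotp n y (\<lambda>i. (c * x i) mod int p) - c * dotp n y x"
proof -
  have "dotp n y (\<lambda>i. (c * x i) mod int p) - c * dotp n y x
      = (\<Sum>i<n. y i * ((c * x i) mod int p - c * x i))"
    by (simp add: dotp_def sum_distrib_left sum_subtractf[symmetric] algebra_simps)
  also have "int p dvd \<dots>"
    by (intro dvd_sum dvd_mult) (metis dvd_minus_mod dvd_minus_iff minus_diff_eq)
  finally show ?thesis .
qed

lemma Fp_space_eqI:
  assumes "x \<in> Fp_space n p" "x' \<in> Fp_space n p" "\<And>i. i < n \<Longrightarrow> int p dvd x i - x' i"
  shows "x = x'"
proof
  fix i
  show "x i = x' i"
  proof (cases "i < n")
    case True
    then have "x i mod int p = x' i mod int p" using assms(3) by (simp add: mod_eq_dvd_iff)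
    then show ?thesis using True assms by (auto simp: Fp_space_def)
  next
    case False then show ?thesis using assms by (auto simp: Fp_space_def)
  qed
qed

lemma finite_Fp_space: "finite (Fp_space n p)"
  by (simp add: Fp_space_eq_coord finite_Fp_coord)

lemma finite_Fp_subspace: "Fp_subspace n p W \<Longrightarrow> finite W"
  using finite_Fp_space finite_subset unfolding Fp_subspace_def by blast

text \<open>If the character is nontrivial at some \<open>x0\<close> in \<open>W\<close>,
  translation by \<open>x0\<close> permutes \<open>W\<close> and multiplies the sum by a number
  other than 1, so the sum is 0.\<close>

lemma sum_chi_subspace:
  assumes p: "p > 0" and W: "Fp_subspace n p W"
  shows "(\<Sum>x\<in>W. chi p (dotp n y x)) = (if perp n p y W then of_nat (card W) else 0)"
proof (cases "perp n p y W")
  case True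
  then have "chi p (dotp n y x) = 1" if "x \<in> W" for x
    using that chi_eq_1_iff[OF p] by (auto simp: perp_def)
  then show ?thesis using True by simp
next
  case False
  then obtain x0 where x0: "x0 \<in> W" "chi p (dotp n y x0) \<noteq> 1" using chi_eq_1_iff[OF p] by (auto simp: perp_def)
  define T where "T x = (\<lambda>i. (x i + x0 i) mod int p)" for x
  have TW: "T x \<in> W" if "x \<in> W" for x using W x0 that by (auto simp: Fp_subspace_def T_def)
  have "inj_on T W"
  proof (rule inj_onI)
    fix x x' assume x: "x \<in> W" "x' \<in> W" "T x = T x'"
    show "x = x'"
    proof (rule Fp_space_eqI)
      show "x \<in> Fp_space n p" "x' \<in> Fp_space n p" using W x by (auto simp: Fp_subspace_def)
      fix i
      have "(x i + x0 i) mod int p = (x' i + x0 i) mod int p" using x(3) by (metis T_def)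
      then show "int p dvd x i - x' i" by (simp add: mod_eq_dvd_iff)
    qed
  qed
  then have "bij_betw T W W"
    unfolding bij_betw_def using TW finite_Fp_subspace[OF W] by (simp add: endo_inj_surj image_subset_iff)
  then have "(\<Sum>x\<in>W. chi p (dotp n y x)) = (\<Sum>x\<in>W. chi p (dotp n y (T x)))"
    by (rule sum.reindex_bij_betw[symmetric])
  also have "\<dots> = (\<Sum>x\<in>W. chi p (dotp n y x) * chi p (dotp n y x0))"
    unfolding T_def chi_add[symmetric] by (intro sum.cong refl chi_cong p dotp_add_mod)
  also have "\<dots> = (\<Sum>x\<in>W. chi p (dotp n y x)) * chi p (dotp n y x0)" by (simp add: sum_distrib_right)
  finally have "(\<Sum>x\<in>W. chi p (dotp n y x)) * (1 - chi p (dotp n y x0)) = 0" by (simp add: algebra_simps)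
  then show ?thesis using x0 False by simp
qed

lemma chi_sum: "chi p (\<Sum>i\<in>I. f i) = (\<Prod>i\<in>I. chi p (f i))"
  by (induction I rule: infinite_finite_induct) (auto simp: chi_add)

text \<open>Orthogonality of characters in place of linear duality.\<close>

lemma card_Int_Fp_U:
  assumes p: "p > 0" and W: "Fp_subspace n p W" and j: "j \<le> n"
  shows "card (W \<inter> Fp_U n p j) * p ^ (n - j) = card W * card {y \<in> Fp_coord p {j..<n}. perp n p y W}"
proof -
  let ?V = "Fp_coord p {j..<n}"
  have Wsub: "W \<subseteq> Fp_space n p" using W by (simp add: Fp_subspace_def)
  have fW: "finite W" using finite_Fp_subspace[OF W] .
  have fV: "finite ?V" by (simp add: finite_Fp_coord)
  \<comment> \<open>\<open>Fp_U n p j\<close> is the annihilator of \<open>?V\<close>, so the sum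
    over \<open>?V\<close> detects it. The identity is then a double count of one sum over
    \<open>W\<close> and \<open>?V\<close>.\<close>
  have inner: "(\<Sum>y\<in>?V. chi p (dotp n y x)) = (if x \<in> Fp_U n p j then of_nat (p ^ (n - j)) else 0)" if x: "x \<in> W" for x
  proof -
    have "(\<Sum>y\<in>?V. chi p (dotp n y x)) = (\<Sum>y\<in>?V. \<Prod>i\<in>{j..<n}. chi p (y i * x i))"
    proof (intro sum.cong refl)
      fix y assume y: "y \<in> ?V"
      have "dotp n y x = (\<Sum>i\<in>{j..<n}. y i * x i)"
        unfolding dotp_def using y by (intro sum.mono_neutral_right) (auto simp: Fp_coord_def)
      then show "chi p (dotp n y x) = (\<Prod>i\<in>{j..<n}. chi p (y i * x i))" by (simp add: chi_sum)
    qed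
    also have "\<dots> = (\<Prod>i\<in>{j..<n}. \<Sum>a\<in>{0..<int p}. chi p (a * x i))"
      by (rule sum_prod_Fp_coord) simp
    also have "\<dots> = (\<Prod>i\<in>{j..<n}. if int p dvd x i then of_nat p else 0)"
      by (simp add: sum_chi[OF p])
    also have "\<dots> = (if x \<in> Fp_U n p j then of_nat (p ^ (n - j)) else 0)"
    proof (cases "x \<in> Fp_U n p j")
      case True
      then show ?thesis by (simp add: Fp_U_def)
    next
      case False
      then obtain i where i: "j \<le> i" "x i \<noteq> 0" using x Wsub by (auto simp: Fp_U_def)
      then have "i < n" "0 \<le> x i" "x i < int p" using x Wsub by (auto simp: Fp_space_def not_le[symmetric])
      then have "\<not> int p dvd x i" using i zdvd_not_zless[of "x i" "int p"] by linarith
      then show ?thesis using False i \<open>i < n\<close> by (auto intro!: prod_zero)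
    qed
    finally show ?thesis .
  qed
  have "(of_nat (card (W \<inter> Fp_U n p j) * p ^ (n - j)) :: complex) = (\<Sum>x\<in>W. \<Sum>y\<in>?V. chi p (dotp n y x))"
    using fW by (simp add: inner sum.If_cases Int_def)
  also have "\<dots> = (\<Sum>y\<in>?V. \<Sum>x\<in>W. chi p (dotp n y x))" by (rule sum.swap)
  also have "\<dots> = of_nat (card W * card {y \<in> ?V. perp n p y W})"
    using fV by (simp add: sum_chi_subspace[OF p W] sum.If_cases Int_def mult.commute)
  finally show ?thesis using of_nat_eq_iff by blast
qed

text \<open>For \<open>j = 0\<close> the counting identity says that \<open>card W\<close> divides
  \<open>p ^ n\<close>; no basis of \<open>W\<close> has to be chosen.\<close>

lemma card_Fp_subspace_power:
  assumes p: "prime p" and W: "Fp_subspace n p W"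
  obtains d where "card W = p ^ d"
proof -
  have p0: "p > 0" using p prime_gt_0_nat by blast
  have "(\<lambda>_. 0) \<in> W" using W by (simp add: Fp_subspace_def)
  then have "W \<inter> Fp_U n p 0 = {\<lambda>_. 0}" using W by (auto simp: Fp_U_def Fp_subspace_def Fp_space_def)
  then have "p ^ n = card W * card {y \<in> Fp_coord p {0..<n}. perp n p y W}"
    using card_Int_Fp_U[OF p0 W, of 0] by simp
  then have "card W dvd p ^ n" by simp
  then show ?thesis using divides_primepow_nat[OF p] that by blast
qed

lemma power_Fp_dim:
  assumes p: "prime p" and W: "Fp_subspace n p W"
  shows "p ^ Fp_dim p W = card W"
proof -
  obtain d where d: "card W = p ^ d" using card_Fp_subspace_power[OF assms] by blast
  have "Fp_dim p W = d" unfolding Fp_dim_def d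
    using prime_gt_1_nat[OF p] by (intro the_equality) (auto dest: power_inject_exp[THEN iffD1])
  then show ?thesis using d by simp
qed

lemma Fp_dim_eq_iff:
  assumes p: "prime p" and W: "Fp_subspace n p W"
  shows "Fp_dim p W = k \<longleftrightarrow> card W = p ^ k"
  using power_Fp_dim[OF assms] prime_gt_1_nat[OF p] by (metis power_inject_exp)

lemma Fp_subspace_Int_U: "Fp_subspace n p W \<Longrightarrow> p > 0 \<Longrightarrow> Fp_subspace n p (W \<inter> Fp_U n p j)"
  unfolding Fp_subspace_def Fp_U_def by (auto simp: Fp_space_def)

section \<open>Subspaces of fixed dimension orthogonal to a vector\<close>

definition Fp_subspaces :: "nat \<Rightarrow> nat \<Rightarrow> nat \<Rightarrow> (nat \<Rightarrow> int) set set" where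
  "Fp_subspaces n p k = {W. Fp_subspace n p W \<and> card W = p ^ k}"

lemma finite_Fp_subspaces: "finite (Fp_subspaces n p k)"
proof (rule finite_subset)
  show "Fp_subspaces n p k \<subseteq> Pow (Fp_space n p)" by (auto simp: Fp_subspaces_def Fp_subspace_def)
qed (simp add: finite_Fp_space)

lemma nu_eq:
  assumes p: "prime p"
  shows "nu n k j p = (\<Sum>W\<in>Fp_subspaces n p k. card (W \<inter> Fp_U n p j))"
proof -
  have "{W. Fp_subspace n p W \<and> Fp_dim p W = k} = Fp_subspaces n p k"
    using Fp_dim_eq_iff[OF p] by (auto simp: Fp_subspaces_def)
  moreover have "p ^ Fp_dim p (W \<inter> Fp_U n p j) = card (W \<inter> Fp_U n p j)" if "W \<in> Fp_subspaces n p k" for W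
    using power_Fp_dim[OF p Fp_subspace_Int_U] that prime_gt_0_nat[OF p] by (auto simp: Fp_subspaces_def)
  ultimately show ?thesis unfolding nu_def by simp
qed

definition unit_vec :: "nat \<Rightarrow> nat \<Rightarrow> int" where
  "unit_vec a = (\<lambda>i. if i = a then 1 else 0)"

lemma dotp_unit_vec: "a < n \<Longrightarrow> dotp n (unit_vec a) x = x a"
proof -
  assume "a < n"
  have "dotp n (unit_vec a) x = (\<Sum>i<n. if i = a then x i else 0)"
    by (simp add: dotp_def unit_vec_def if_distrib[of "\<lambda>c. c * _"] cong: if_cong)
  then show ?thesis using \<open>a < n\<close> by simp
qed

definition n_perp :: "nat \<Rightarrow> nat \<Rightarrow> nat \<Rightarrow> (nat \<Rightarrow> int) \<Rightarrow> nat" where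
  "n_perp n p k y = card {W \<in> Fp_subspaces n p k. perp n p y W}"

text \<open>The linear automorphism replacing the coordinate \<open>a\<close> by \<open>dotp n y\<close> carries the functional
  \<open>y\<close> to a coordinate functional.\<close>

lemma n_perp_unit_vec:
  assumes p: "prime p" and a: "a < n" and ya: "\<not> int p dvd y a"
  shows "n_perp n p k y = n_perp n p k (unit_vec a)"
proof -
  have p0: "int p > 0" using p prime_gt_0_nat by auto
  define \<Phi> where "\<Phi> x = (\<lambda>i. if i = a then dotp n y x mod int p else x i)" for x
  have \<Phi>sp: "\<Phi> x \<in> Fp_space n p" if "x \<in> Fp_space n p" for x
    using that p0 a by (auto simp: \<Phi>_def Fp_space_def)
  have inj: "inj_on \<Phi> (Fp_space n p)"
  proof (rule inj_onI)
    fix x x' assume x: "x \<in> Fp_space n p" "x' \<in> Fp_space n p" and eq: "\<Phi> x = \<Phi> x'"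
    have other: "x i = x' i" if "i \<noteq> a" for i using eq that by (auto simp: \<Phi>_def fun_eq_iff split: if_splits)
    have "dotp n y x mod int p = dotp n y x' mod int p" using fun_cong[OF eq, of a] by (simp add: \<Phi>_def)
    then have "int p dvd dotp n y x - dotp n y x'" by (simp add: mod_eq_dvd_iff)
    also have "dotp n y x - dotp n y x' = (\<Sum>i<n. if i = a then y a * (x a - x' a) else 0)"
      unfolding dotp_def sum_subtractf[symmetric] by (intro sum.cong) (auto simp: other algebra_simps)
    also have "\<dots> = y a * (x a - x' a)" using a by simp
    finally have "int p dvd x a - x' a"
      using ya p by (simp add: prime_dvd_mult_iff)
    then show "x = x'" using x other by (intro Fp_space_eqI[of x n p x']) (metis diff_self dvd_0_right)+
  qed
  have add: "\<Phi> (\<lambda>i. (x i + x' i) mod int p) = (\<lambda>i. (\<Phi> x i + \<Phi> x' i) mod int p)" for x x'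
    using dotp_add_mod[of p n y x x'] by (auto simp: \<Phi>_def fun_eq_iff mod_eq_dvd_iff mod_add_eq)
  have mult: "\<Phi> (\<lambda>i. (c * x i) mod int p) = (\<lambda>i. (c * \<Phi> x i) mod int p)" for c x
    using dotp_mult_mod[of p n y c x] by (auto simp: \<Phi>_def fun_eq_iff mod_eq_dvd_iff mod_mult_right_eq)
  have zero: "\<Phi> (\<lambda>_. 0) = (\<lambda>_. 0)" by (auto simp: \<Phi>_def dotp_def)
  have sub: "\<Phi> ` W \<in> Fp_subspaces n p k" if W: "W \<in> Fp_subspaces n p k" for W
  proof -
    have W': "Fp_subspace n p W" "card W = p ^ k" using W by (auto simp: Fp_subspaces_def)
    have Wsp: "W \<subseteq> Fp_space n p" using W' by (simp add: Fp_subspace_def)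
    have "card (\<Phi> ` W) = card W" using inj Wsp by (simp add: card_image inj_on_subset)
    moreover have "Fp_subspace n p (\<Phi> ` W)" unfolding Fp_subspace_def
    proof (intro conjI ballI allI)
      show "\<Phi> ` W \<subseteq> Fp_space n p" using \<Phi>sp Wsp by blast
      show "(\<lambda>_. 0) \<in> \<Phi> ` W" using zero W'(1) unfolding Fp_subspace_def by (metis imageI)
      fix x' assume "x' \<in> \<Phi> ` W"
      then obtain x where x: "x \<in> W" "x' = \<Phi> x" by blast
      fix c :: int show "(\<lambda>i. (c * x' i) mod int p) \<in> \<Phi> ` W"
        unfolding x mult[symmetric] using W'(1) x by (intro imageI) (simp add: Fp_subspace_def)
    next
      fix x' z' assume "x' \<in> \<Phi> ` W" "z' \<in> \<Phi> ` W"
      then obtain x z where x: "x \<in> W" "x' = \<Phi> x" and z: "z \<in> W" "z' = \<Phi> z" by blast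
      show "(\<lambda>i. (x' i + z' i) mod int p) \<in> \<Phi> ` W"
        unfolding x z add[symmetric] using W'(1) x z by (intro imageI) (simp add: Fp_subspace_def)
    qed
    ultimately show ?thesis using W' by (simp add: Fp_subspaces_def)
  qed
  have sp: "W \<subseteq> Fp_space n p" if "W \<in> Fp_subspaces n p k" for W
    using that by (auto simp: Fp_subspaces_def Fp_subspace_def)
  have inj': "inj_on ((`) \<Phi>) (Fp_subspaces n p k)"
    using inj_on_image_eq_iff[OF inj] sp by (auto intro!: inj_onI)
  \<comment> \<open>An injective self-map of a finite set is onto, which spares an explicit inverse
    of \<open>\<Phi>\<close>.\<close>
  then have surj': "(`) \<Phi> ` Fp_subspaces n p k = Fp_subspaces n p k"
    using sub finite_Fp_subspaces by (intro endo_inj_surj) auto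
  have iff: "perp n p y W \<longleftrightarrow> perp n p (unit_vec a) (\<Phi> ` W)" for W
    using a by (auto simp: perp_def dotp_unit_vec \<Phi>_def dvd_mod_iff)
  have "bij_betw ((`) \<Phi>) {W \<in> Fp_subspaces n p k. perp n p y W} {W \<in> Fp_subspaces n p k. perp n p (unit_vec a) W}"
    unfolding bij_betw_def
  proof
    show "inj_on ((`) \<Phi>) {W \<in> Fp_subspaces n p k. perp n p y W}" using inj' by (rule inj_on_subset) auto
    show "(`) \<Phi> ` {W \<in> Fp_subspaces n p k. perp n p y W} = {W \<in> Fp_subspaces n p k. perp n p (unit_vec a) W}"
    proof
      show "(`) \<Phi> ` {W \<in> Fp_subspaces n p k. perp n p y W} \<subseteq> {W \<in> Fp_subspaces n p k. perp n p (unit_vec a) W}"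
        using sub iff by blast
      show "{W \<in> Fp_subspaces n p k. perp n p (unit_vec a) W} \<subseteq> (`) \<Phi> ` {W \<in> Fp_subspaces n p k. perp n p y W}"
      proof
        fix W' assume W': "W' \<in> {W \<in> Fp_subspaces n p k. perp n p (unit_vec a) W}"
        then obtain W where "W \<in> Fp_subspaces n p k" "W' = \<Phi> ` W" using surj' by blast
        then show "W' \<in> (`) \<Phi> ` {W \<in> Fp_subspaces n p k. perp n p y W}" using iff W' by blast
      qed
    qed
  qed
  then show ?thesis unfolding n_perp_def by (rule bij_betw_same_card)
qed

text \<open>A vector has the count of the unit vector at any coordinate where it is invertible
  modulo \<open>p\<close>. The vector \<open>?w\<close>, with entries 1 at \<open>a\<close> and at
  0, links the two coordinates.\<close>

lemma n_perp_nonzero: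
  assumes p: "prime p" and n: "n > 0" and y: "y \<in> Fp_space n p" "y \<noteq> (\<lambda>_. 0)"
  shows "n_perp n p k y = n_perp n p k (unit_vec 0)"
proof -
  have p1: "\<not> int p dvd 1" using prime_gt_1_nat[OF p] by auto
  obtain a where a: "y a \<noteq> 0" using y(2) by auto
  have an: "a < n" using a y(1) unfolding Fp_space_def by (metis (mono_tags, lifting) mem_Collect_eq not_le)
  then have "0 \<le> y a" "y a < int p" using y(1) by (auto simp: Fp_space_def)
  then have "0 < y a" "y a < int p" using a by auto
  then have "\<not> int p dvd y a" using zdvd_not_zless by blast
  then have 1: "n_perp n p k y = n_perp n p k (unit_vec a)" by (rule n_perp_unit_vec[OF p an])
  have "n_perp n p k (unit_vec a) = n_perp n p k (unit_vec 0)"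
  proof (cases "a = 0")
    case False
    let ?w = "\<lambda>i. unit_vec a i + unit_vec 0 i"
    have "n_perp n p k ?w = n_perp n p k (unit_vec a)" "n_perp n p k ?w = n_perp n p k (unit_vec 0)"
      using False p1 by (intro n_perp_unit_vec p an n; simp add: unit_vec_def)+
    then show ?thesis by simp
  qed simp
  with 1 show ?thesis by simp
qed

text \<open>After interchange of the sums each \<open>y\<close> is weighted by the number of
  subspaces orthogonal to it, and this weight takes one value at 0 and one value everywhere
  else.\<close>

lemma sum_subspaces_perp:
  fixes G :: "(nat \<Rightarrow> int) \<Rightarrow> complex"
  assumes p: "prime p" and n: "n > 0" and V: "V \<subseteq> Fp_space n p" "(\<lambda>_. 0) \<in> V"
  shows "(\<Sum>W\<in>Fp_subspaces n p k. \<Sum>y\<in>{y\<in>V. perp n p y W}. G y)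
    = of_nat (n_perp n p k (\<lambda>_. 0)) * G (\<lambda>_. 0) + of_nat (n_perp n p k (unit_vec 0)) * ((\<Sum>y\<in>V. G y) - G (\<lambda>_. 0))"
proof -
  have fV: "finite V" using V finite_Fp_space finite_subset by blast
  have "(\<Sum>W\<in>Fp_subspaces n p k. \<Sum>y\<in>{y\<in>V. perp n p y W}. G y)
      = (\<Sum>W\<in>Fp_subspaces n p k. \<Sum>y\<in>V. if perp n p y W then G y else 0)"
    using fV by (simp add: sum.inter_filter)
  also have "\<dots> = (\<Sum>y\<in>V. \<Sum>W\<in>Fp_subspaces n p k. if perp n p y W then G y else 0)" by (rule sum.swap)
  also have "\<dots> = (\<Sum>y\<in>V. of_nat (n_perp n p k y) * G y)"
    using finite_Fp_subspaces by (simp add: n_perp_def sum.If_cases Int_def mult.commute)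
  also have "\<dots> = of_nat (n_perp n p k (\<lambda>_. 0)) * G (\<lambda>_. 0) + (\<Sum>y\<in>V - {\<lambda>_. 0}. of_nat (n_perp n p k y) * G y)"
    using fV V by (simp add: sum.remove)
  also have "(\<Sum>y\<in>V - {\<lambda>_. 0}. of_nat (n_perp n p k y) * G y) = (\<Sum>y\<in>V - {\<lambda>_. 0}. of_nat (n_perp n p k (unit_vec 0)) * G y)"
    using n_perp_nonzero[OF p n] V by (intro sum.cong) auto
  also have "\<dots> = of_nat (n_perp n p k (unit_vec 0)) * ((\<Sum>y\<in>V. G y) - G (\<lambda>_. 0))"
    using fV V by (simp add: sum_distrib_left[symmetric] sum_diff1)
  finally show ?thesis .
qed

text \<open>The function 1 on \<open>?V\<close>, the annihilator of \<open>Fp_U n p (n - l)\<close>,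
  has value 1 at 0 and total \<open>p ^ l\<close>; the sum over orthogonal pairs then counts the
  intersections that define \<open>nu\<close>.\<close>

lemma nu_n_perp:
  assumes p: "prime p" and n: "n > 0" and l: "l \<le> n"
  shows "(of_nat p ^ l * of_nat (nu n k (n - l) p) :: complex) = of_nat p ^ k *
    (of_nat (n_perp n p k (\<lambda>_. 0)) + of_nat (n_perp n p k (unit_vec 0)) * (of_nat p ^ l - 1))"
proof -
  let ?V = "Fp_coord p {n - l..<n}"
  have p0: "p > 0" using p prime_gt_0_nat by blast
  have "of_nat p ^ l * of_nat (nu n k (n - l) p) = (of_nat (\<Sum>W\<in>Fp_subspaces n p k. card (W \<inter> Fp_U n p (n - l)) * p ^ l) :: complex)"
    by (simp add: nu_eq[OF p] sum_distrib_left mult.commute)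
  also have "(\<Sum>W\<in>Fp_subspaces n p k. card (W \<inter> Fp_U n p (n - l)) * p ^ l)
      = (\<Sum>W\<in>Fp_subspaces n p k. p ^ k * card {y \<in> ?V. perp n p y W})"
  proof (intro sum.cong refl)
    fix W assume "W \<in> Fp_subspaces n p k"
    then have W: "Fp_subspace n p W" "card W = p ^ k" by (auto simp: Fp_subspaces_def)
    show "card (W \<inter> Fp_U n p (n - l)) * p ^ l = p ^ k * card {y \<in> ?V. perp n p y W}"
      using card_Int_Fp_U[OF p0 W(1), of "n - l"] l W(2) by simp
  qed
  also have "(of_nat \<dots> :: complex) = of_nat p ^ k * (\<Sum>W\<in>Fp_subspaces n p k. \<Sum>y\<in>{y\<in>?V. perp n p y W}. 1)"
    by (simp add: sum_distrib_left)
  also have "(\<Sum>W\<in>Fp_subspaces n p k. \<Sum>y\<in>{y\<in>?V. perp n p y W}. (1::complex))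
     = of_nat (n_perp n p k (\<lambda>_. 0)) + of_nat (n_perp n p k (unit_vec 0)) * (of_nat (card ?V) - 1)"
  proof -
    have "?V \<subseteq> Fp_space n p" unfolding Fp_space_eq_coord by (intro Fp_coord_subset p0) auto
    then show ?thesis using sum_subspaces_perp[OF p n, of ?V "\<lambda>_. 1" k] p0 by simp
  qed
  also have "card ?V = p ^ l" using l by (simp add: card_Fp_coord)
  finally show ?thesis by simp
qed

section \<open>Lattices between a lattice and its dilate\<close>

text \<open>Matrices are indexed by the type \<open>'n\<close>, coordinates by naturals; a fixed
  enumeration translates between the two.\<close>

definition idx :: "'n::finite \<Rightarrow> nat" where
  "idx = (SOME f. bij_betw f (UNIV :: 'n set) {..<CARD('n)})"

lemma bij_idx: "bij_betw (idx :: 'n::finite \<Rightarrow> nat) UNIV {..<CARD('n)}"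
proof -
  have "\<exists>f. bij_betw f (UNIV :: 'n set) {..<CARD('n)}"
    using ex_bij_betw_finite_nat[of "UNIV :: 'n set"] by (simp add: atLeast0LessThan)
  then show ?thesis unfolding idx_def by (rule someI_ex)
qed

lemma idx_less: "idx (i :: 'n::finite) < CARD('n)"
  using bij_idx bij_betwE by blast

lemma idx_eq_iff: "idx i = idx j \<longleftrightarrow> i = j"
  using bij_idx unfolding bij_betw_def by (metis UNIV_I inj_on_eq_iff)

lemma ex_idx: "k < CARD('n) \<Longrightarrow> \<exists>i :: 'n::finite. idx i = k"
  using bij_idx[where 'n = 'n] unfolding bij_betw_def by (metis imageE lessThan_iff)

text \<open>Generators are placed in rows so that the rules for row operations on determinants apply
  directly; \<open>lattice_of\<close> uses columns, hence the transpose in the next lemma.\<close>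

definition rowmat :: "(nat \<Rightarrow> real^'n) \<Rightarrow> real^'n^'n" where
  "rowmat b = (\<chi> j. b (idx j))"

lemma lattice_of_rowmat:
  fixes b :: "nat \<Rightarrow> real^'n"
  shows "lattice_of (transpose (rowmat b)) = int_span b"
proof -
  have mult: "transpose (rowmat b) *v (\<chi> j. c (idx j)) = (\<Sum>i<CARD('n). c i *\<^sub>R b i)" for c
  proof -
    have "transpose (rowmat b) *v (\<chi> j. c (idx j)) = (\<Sum>j\<in>(UNIV :: 'n set). c (idx j) *\<^sub>R b (idx j))"
      unfolding matrix_mult_sum by (simp add: scalar_mult_eq_scaleR rowmat_def row_def column_def transpose_def)
    also have "\<dots> = (\<Sum>i<CARD('n). c i *\<^sub>R b i)"
      by (rule sum.reindex_bij_betw[OF bij_idx])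
    finally show ?thesis .
  qed
  show ?thesis
  proof
    show "lattice_of (transpose (rowmat b)) \<subseteq> int_span b"
    proof
      fix x assume "x \<in> lattice_of (transpose (rowmat b))"
      then obtain z :: "int^'n" where x: "x = transpose (rowmat b) *v (\<chi> i. real_of_int (z $ i))"
        unfolding lattice_of_def by blast
      define c where "c i = z $ (inv_into UNIV idx i)" for i
      have zc: "(\<chi> i. real_of_int (z $ i)) = (\<chi> i. real_of_int (c (idx i)))"
        using bij_idx[where 'n = 'n] by (simp add: c_def bij_betw_def)
      have "x = (\<Sum>i<CARD('n). real_of_int (c i) *\<^sub>R b i)"
        unfolding x zc by (rule mult)
      then show "x \<in> int_span b" unfolding int_span_def by blast
    qed
    show "int_span b \<subseteq> lattice_of (transpose (rowmat b))"
    proof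
      fix x assume "x \<in> int_span b"
      then obtain c where "x = (\<Sum>i<CARD('n). real_of_int (c i) *\<^sub>R b i)" unfolding int_span_def by blast
      then have "x = transpose (rowmat b) *v (\<chi> i. real_of_int ((\<chi> i. c (idx i)) $ i))"
        using mult[of "\<lambda>i. real_of_int (c i)"] by (simp only: vec_lambda_beta)
      then show "x \<in> lattice_of (transpose (rowmat b))" unfolding lattice_of_def by blast
    qed
  qed
qed

lemma det_rowmat_nonzero:
  assumes "dual_bases e u"
  shows "det (rowmat e) \<noteq> 0"
proof -
  interpret dual_bases e u by fact
  have "rowmat e ** transpose (rowmat u) = mat 1"
  proof -
    have "(rowmat e ** transpose (rowmat u)) $ i $ j = e (idx i) \<bullet> u (idx j)" for i j
      by (simp add: matrix_matrix_mult_def rowmat_def transpose_def inner_vec_def)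
    then show ?thesis
      by (simp add: vec_eq_iff mat_def inner_commute[of "e _"] dual idx_less idx_eq_iff eq_commute)
  qed
  then have "det (rowmat e) * det (transpose (rowmat u)) = 1" by (metis det_I det_mul)
  then show ?thesis by auto
qed

section \<open>Determinants and covolumes\<close>

lemma det_Ints:
  fixes A :: "real^'n^'n"
  assumes "\<And>i j. A $ i $ j \<in> \<int>"
  shows "det A \<in> \<int>"
  unfolding det_def using assms by (intro Ints_sum Ints_mult Ints_prod) auto

lemma lattice_of_subset_det:
  fixes B B' :: "real^'n^'n"
  assumes "lattice_of B' \<subseteq> lattice_of B"
  shows "\<exists>d\<in>\<int>. det B' = det B * d"
proof -
  have "\<exists>z :: int^'n. column j B' = B *v (\<chi> i. real_of_int (z $ i))" for j
  proof -
    have "B' *v (\<chi> i. real_of_int ((\<chi> i. if i = j then 1 else 0) $ i)) = column j B'"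
      by (simp add: matrix_vector_mult_def column_def vec_eq_iff if_distrib cong: if_cong)
    then have "column j B' = B' *v (\<chi> i. real_of_int ((\<chi> i. if i = j then 1 else 0) $ i))" by (rule sym)
    then have "column j B' \<in> lattice_of B'" unfolding lattice_of_def by blast
    then show ?thesis using assms unfolding lattice_of_def by blast
  qed
  then obtain z :: "'n \<Rightarrow> int^'n" where z: "\<And>j. column j B' = B *v (\<chi> i. real_of_int (z j $ i))" by metis
  define A :: "real^'n^'n" where "A = (\<chi> i j. real_of_int (z j $ i))"
  have "B' $ i $ j = (B ** A) $ i $ j" for i j
  proof -
    have "B' $ i $ j = column j B' $ i" by (simp add: column_def)
    also have "\<dots> = (B ** A) $ i $ j"
      unfolding z by (simp add: matrix_vector_mult_def matrix_matrix_mult_def A_def)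
    finally show ?thesis .
  qed
  then have "B' = B ** A" by (simp add: vec_eq_iff)
  then have "det B' = det B * det A" by (simp add: det_mul)
  moreover have "det A \<in> \<int>" by (rule det_Ints) (simp add: A_def)
  ultimately show ?thesis by blast
qed

text \<open>Two bases of one lattice are integer combinations of each other, so the ratio of their
  determinants and its inverse are both integers. Hence every choice in the \<open>SOME\<close> of
  \<open>covol\<close> gives the same value.\<close>

lemma covol_lattice_of:
  fixes B :: "real^'n^'n"
  assumes B: "invertible B"
  shows "covol (lattice_of B) = \<bar>det B\<bar>"
proof -
  have uniq: "\<bar>det B'\<bar> = \<bar>det B\<bar>" if B': "invertible B'" and eq: "lattice_of B = lattice_of B'" for B'
  proof -
    obtain d where d: "d \<in> \<int>" "det B' = det B * d" using lattice_of_subset_det[of B' B] eq by auto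
    obtain d' where d': "d' \<in> \<int>" "det B = det B' * d'" using lattice_of_subset_det[of B B'] eq by auto
    have nz: "det B \<noteq> 0" using B invertible_det_nz by blast
    have "det B * (d * d') = det B * 1" using d(2) d'(2) by (metis mult.assoc mult.right_neutral)
    then have dd: "d * d' = 1" using nz by (metis mult_left_cancel)
    obtain m m' where m: "d = of_int m" "d' = of_int m'" using d d' by (auto elim!: Ints_cases)
    have "m * m' = 1" using dd unfolding m by (metis of_int_1 of_int_eq_iff of_int_mult)
    then have "\<bar>m\<bar> = 1" by (metis dvd_triv_left zdvd1_eq)
    then have "\<bar>d\<bar> = 1" unfolding m by (metis of_int_1 of_int_abs)
    then show ?thesis by (simp add: d(2) abs_mult)
  qed
  let ?Q = "\<lambda>c. \<exists>B'. invertible B' \<and> lattice_of B = lattice_of B' \<and> c = \<bar>det B'\<bar>"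
  have "?Q (covol (lattice_of B))" unfolding covol_def
    by (rule someI[of ?Q]) (use B in blast)
  then show ?thesis using uniq by auto
qed

lemma int_span_full_lattice:
  fixes b :: "nat \<Rightarrow> real^'n"
  assumes "det (rowmat b) \<noteq> 0"
  shows "full_lattice (int_span b)" "covol (int_span b) = \<bar>det (rowmat b)\<bar>"
proof -
  have inv: "invertible (transpose (rowmat b))" using assms by (simp add: invertible_det_nz)
  then show "full_lattice (int_span b)" unfolding full_lattice_def lattice_of_rowmat[symmetric] by blast
  show "covol (int_span b) = \<bar>det (rowmat b)\<bar>"
    using covol_lattice_of[OF inv] by (simp add: lattice_of_rowmat)
qed

section \<open>Adjoining a vector to a lattice\<close>

definition int_module :: "(real^'n) set \<Rightarrow> bool" where
  "int_module K \<longleftrightarrow> 0 \<in> K \<and> (\<forall>x\<in>K. \<forall>y\<in>K. x + y \<in> K) \<and> (\<forall>c. \<forall>x\<in>K. real_of_int c *\<^sub>R x \<in> K)"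

lemma int_module_sum: "int_module K \<Longrightarrow> (\<And>i. i \<in> I \<Longrightarrow> f i \<in> K) \<Longrightarrow> (\<Sum>i\<in>I. real_of_int (z i) *\<^sub>R f i) \<in> K"
  by (induction I rule: infinite_finite_induct) (auto simp: int_module_def)

lemma int_module_add: "int_module K \<Longrightarrow> x \<in> K \<Longrightarrow> y \<in> K \<Longrightarrow> x + y \<in> K"
  by (simp add: int_module_def)

lemma int_module_scale: "int_module K \<Longrightarrow> x \<in> K \<Longrightarrow> real_of_int c *\<^sub>R x \<in> K"
  by (simp add: int_module_def)

lemma int_module_diff: "int_module K \<Longrightarrow> x \<in> K \<Longrightarrow> y \<in> K \<Longrightarrow> x - y \<in> K"
  using int_module_add[of K x "real_of_int (-1) *\<^sub>R y"] int_module_scale[of K y "-1"] by simp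

lemma int_module_int_span: "int_module (int_span b)"
  unfolding int_module_def
proof (intro conjI ballI allI)
  show "0 \<in> int_span b" unfolding int_span_def by (intro CollectI exI[of _ "\<lambda>_. 0"]) simp
  fix x y assume "x \<in> int_span b" "y \<in> int_span b"
  then obtain z z' where xy: "x = (\<Sum>i<CARD('a). real_of_int (z i) *\<^sub>R b i)" "y = (\<Sum>i<CARD('a). real_of_int (z' i) *\<^sub>R b i)"
    unfolding int_span_def by blast
  then have "x + y = (\<Sum>i<CARD('a). real_of_int (z i + z' i) *\<^sub>R b i)"
    by (simp add: sum.distrib scaleR_add_left)
  then show "x + y \<in> int_span b" unfolding int_span_def by (intro CollectI exI[of _ "\<lambda>i. z i + z' i"]) simp
next
  fix c :: int and x assume "x \<in> int_span b"
  then obtain z where x: "x = (\<Sum>i<CARD('a). real_of_int (z i) *\<^sub>R b i)" unfolding int_span_def by blast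
  then have "real_of_int c *\<^sub>R x = (\<Sum>i<CARD('a). real_of_int (c * z i) *\<^sub>R b i)"
    by (simp add: scaleR_sum_right)
  then show "real_of_int c *\<^sub>R x \<in> int_span b" unfolding int_span_def by (intro CollectI exI[of _ "\<lambda>i. c * z i"]) simp
qed

lemma int_span_subset:
  fixes b :: "nat \<Rightarrow> real^'n"
  assumes "int_module K" "\<And>i. i < CARD('n) \<Longrightarrow> b i \<in> K"
  shows "int_span b \<subseteq> K"
  unfolding int_span_def using int_module_sum[OF assms(1), of "{..<CARD('n)}" b] assms(2) by auto

text \<open>After rescaling \<open>w\<close> modulo the lattice, \<open>p *\<^sub>R w\<close> has coefficient \<open>1\<close> at some basis vector,
  which \<open>w\<close> can therefore replace.\<close>

lemma int_span_adjoin: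
  fixes b :: "nat \<Rightarrow> real^'n"
  assumes p: "prime p" and det: "det (rowmat b) \<noteq> 0"
    and pw: "real p *\<^sub>R w \<in> int_span b" and w: "w \<notin> int_span b"
  obtains b' where "det (rowmat b') \<noteq> 0" "\<bar>det (rowmat b)\<bar> = real p * \<bar>det (rowmat b')\<bar>"
    "int_span b' = {x + real_of_int t *\<^sub>R w | x t. x \<in> int_span b}"
proof -
  have p0: "real p > 0" using p prime_gt_0_nat by simp
  obtain a where a: "real p *\<^sub>R w = (\<Sum>i<CARD('n). real_of_int (a i) *\<^sub>R b i)"
    using pw unfolding int_span_def by blast
  have "\<exists>i<CARD('n). \<not> int p dvd a i"
  proof (rule ccontr)
    assume "\<not> ?thesis"
    then have "\<forall>i<CARD('n). \<exists>k. a i = int p * k" by blast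
    then obtain k where k: "\<And>i. i < CARD('n) \<Longrightarrow> a i = int p * k i" by metis
    have "real p *\<^sub>R w = real p *\<^sub>R (\<Sum>i<CARD('n). real_of_int (k i) *\<^sub>R b i)"
      unfolding a scaleR_sum_right by (intro sum.cong) (auto simp: k)
    then have "w = (\<Sum>i<CARD('n). real_of_int (k i) *\<^sub>R b i)" using p0 by simp
    then show False using w unfolding int_span_def by blast
  qed
  then obtain i where i: "i < CARD('n)" "\<not> int p dvd a i" by blast
  then have "coprime (a i) (int p)" using p prime_imp_coprime[of "int p" "a i"] by (simp add: coprime_commute)
  then obtain c q where cq: "c * a i + q * int p = 1" using bezout_int[of "a i" "int p"] by auto
  define w' where "w' = real_of_int c *\<^sub>R w + real_of_int q *\<^sub>R b i"
  define s where "s = (\<Sum>j\<in>{..<CARD('n)} - {i}. real_of_int (c * a j) *\<^sub>R b j)"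
  have "real p *\<^sub>R w' = real_of_int c *\<^sub>R (real p *\<^sub>R w) + real_of_int (q * int p) *\<^sub>R b i"
    by (simp add: w'_def scaleR_add_right mult.commute)
  also have "real_of_int c *\<^sub>R (real p *\<^sub>R w) = real_of_int (c * a i) *\<^sub>R b i + s"
    unfolding a scaleR_sum_right s_def using i(1) by (simp add: sum.remove)
  finally have "real p *\<^sub>R w' = real_of_int (c * a i + q * int p) *\<^sub>R b i + s"
    by (simp only: of_int_add scaleR_add_left) (simp add: algebra_simps)
  then have pw': "real p *\<^sub>R w' = b i + s" unfolding cq by simp
  define b' where "b' = b(i := w')"
  obtain k :: 'n where k: "idx k = i" using ex_idx i(1) by blast
  \<comment> \<open>Adding \<open>s\<close>, a combination of the other rows, to row
    \<open>k\<close> keeps the determinant and turns that row into \<open>p\<close> times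
    \<open>w'\<close>.\<close>
  have "det (rowmat b) = det (rowmat (b(i := real p *\<^sub>R w')))"
  proof -
    have "s \<in> vec.span {row j (rowmat b) |j. j \<noteq> k}"
      unfolding s_def
    proof (intro vec.span_sum)
      fix j assume "j \<in> {..<CARD('n)} - {i}"
      then obtain j' :: 'n where j': "idx j' = j" "j' \<noteq> k" using ex_idx k by blast
      then have "b j \<in> {row j (rowmat b) |j. j \<noteq> k}" by (auto simp: row_def rowmat_def)
      then have "real_of_int (c * a j) *s b j \<in> vec.span {row j (rowmat b) |j. j \<noteq> k}"
        by (intro vec.span_scale vec.span_base)
      then show "real_of_int (c * a j) *\<^sub>R b j \<in> vec.span {row j (rowmat b) |j. j \<noteq> k}"
        by (simp only: scalar_mult_eq_scaleR)
    qed
    from det_row_span[OF this]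
    have "det (\<chi> j. if j = k then row k (rowmat b) + s else row j (rowmat b)) = det (rowmat b)" .
    moreover have "(\<chi> j. if j = k then row k (rowmat b) + s else row j (rowmat b)) = rowmat (b(i := real p *\<^sub>R w'))"
      unfolding pw' using k by (auto simp: vec_eq_iff rowmat_def row_def idx_eq_iff[symmetric])
    ultimately show ?thesis by simp
  qed
  also have "rowmat (b(i := real p *\<^sub>R w')) = (\<chi> j. if j = k then real p *s w' else b (idx j))"
    using k by (auto simp: vec_eq_iff rowmat_def idx_eq_iff[symmetric])
  also have "det \<dots> = real p * det (\<chi> j. if j = k then w' else b (idx j))"
    by (rule det_row_mul)
  also have "(\<chi> j. if j = k then w' else b (idx j)) = rowmat b'"
    using k by (auto simp: vec_eq_iff rowmat_def b'_def idx_eq_iff[symmetric])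
  finally have d: "det (rowmat b) = real p * det (rowmat b')" .
  let ?N = "{x + real_of_int t *\<^sub>R w | x t. x \<in> int_span b}"
  have modb: "int_module (int_span b)" and modb': "int_module (int_span b')" by (rule int_module_int_span)+
  have modN: "int_module ?N" unfolding int_module_def
  proof (intro conjI ballI allI)
    show "0 \<in> ?N" using modb by (intro CollectI exI[of _ 0]) (auto simp: int_module_def)
    fix x y assume "x \<in> ?N" "y \<in> ?N"
    then obtain x1 t1 x2 t2 where "x = x1 + real_of_int t1 *\<^sub>R w" "x1 \<in> int_span b"
      "y = x2 + real_of_int t2 *\<^sub>R w" "x2 \<in> int_span b" by blast
    then show "x + y \<in> ?N"
      using int_module_add[OF modb] by (intro CollectI exI[of _ "x1 + x2"] exI[of _ "t1 + t2"]) (auto simp: scaleR_add_left)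
  next
    fix m :: int and x assume "x \<in> ?N"
    then obtain x1 t1 where "x = x1 + real_of_int t1 *\<^sub>R w" "x1 \<in> int_span b" by blast
    then show "real_of_int m *\<^sub>R x \<in> ?N"
      using int_module_scale[OF modb]
      by (intro CollectI exI[of _ "real_of_int m *\<^sub>R x1"] exI[of _ "m * t1"]) (auto simp: scaleR_add_right)
  qed
  have bN: "x \<in> ?N" if "x \<in> int_span b" for x
    using that by (intro CollectI exI[of _ x] exI[of _ 0]) auto
  have b'other: "b j \<in> int_span b'" if "j < CARD('n)" "j \<noteq> i" for j
    using in_int_span[of j b'] that by (simp add: b'_def)
  have w'b': "w' \<in> int_span b'" using in_int_span[of i b'] i(1) by (simp add: b'_def)
  have bib': "b i \<in> int_span b'"
  proof -
    have "s \<in> int_span b'" unfolding s_def using b'other by (intro int_module_sum[OF modb']) auto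
    then have "real_of_int (int p) *\<^sub>R w' - s \<in> int_span b'"
      by (intro int_module_diff[OF modb'] int_module_scale[OF modb'] w'b')
    then show ?thesis using pw' by simp
  qed
  then have bb': "int_span b \<subseteq> int_span b'"
    using b'other by (intro int_span_subset[OF modb']) metis
  have "w \<in> int_span b'"
  proof -
    \<comment> \<open>The Bezout relation writes \<open>w\<close> through \<open>c\<close> times
      \<open>w\<close> and \<open>p\<close> times \<open>w\<close>, both of which lie in the new
      span.\<close>
    have "w = real_of_int (c * a i + q * int p) *\<^sub>R w" unfolding cq by simp
    also have "\<dots> = real_of_int (a i) *\<^sub>R (real_of_int c *\<^sub>R w) + real_of_int q *\<^sub>R (real p *\<^sub>R w)"
      by (simp add: scaleR_add_left mult.commute)
    also have "real_of_int c *\<^sub>R w = w' - real_of_int q *\<^sub>R b i" by (simp add: w'_def)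
    finally have "w = real_of_int (a i) *\<^sub>R (w' - real_of_int q *\<^sub>R b i) + real_of_int q *\<^sub>R (real p *\<^sub>R w)" .
    moreover have "real_of_int (a i) *\<^sub>R (w' - real_of_int q *\<^sub>R b i) + real_of_int q *\<^sub>R (real p *\<^sub>R w) \<in> int_span b'"
      using bb' pw w'b' bib'
      by (intro int_module_add[OF modb'] int_module_scale[OF modb'] int_module_diff[OF modb']) auto
    ultimately show ?thesis by simp
  qed
  then have "?N \<subseteq> int_span b'"
    using bb' int_module_add[OF modb'] int_module_scale[OF modb'] by blast
  moreover have "int_span b' \<subseteq> ?N"
  proof (rule int_span_subset[OF modN])
    fix j assume j: "j < CARD('n)"
    show "b' j \<in> ?N"
    proof (cases "j = i")
      case False then show ?thesis using bN in_int_span[OF j, of b] by (simp add: b'_def)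
    next
      case True
      have "real_of_int q *\<^sub>R b i \<in> int_span b" using in_int_span[OF i(1), of b] by (rule int_module_scale[OF modb])
      then have "w' \<in> ?N" unfolding w'_def by (intro CollectI exI[of _ "real_of_int q *\<^sub>R b i"] exI[of _ c]) auto
      then show ?thesis using True by (simp add: b'_def)
    qed
  qed
  ultimately have "int_span b' = ?N" by blast
  moreover have "det (rowmat b') \<noteq> 0" using d det by auto
  moreover have "\<bar>det (rowmat b)\<bar> = real p * \<bar>det (rowmat b')\<bar>" using d p0 by (simp add: abs_mult)
  ultimately show ?thesis using that by blast
qed

section \<open>Superlattices and subspaces over the prime field\<close>

definition reduce :: "nat \<Rightarrow> nat \<Rightarrow> (nat \<Rightarrow> int) \<Rightarrow> nat \<Rightarrow> int" where
  "reduce n p z = (\<lambda>i. if i < n then z i mod int p else 0)"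

definition frac_vec :: "(nat \<Rightarrow> real^'n) \<Rightarrow> nat \<Rightarrow> (nat \<Rightarrow> int) \<Rightarrow> real^'n" where
  "frac_vec e p z = (\<Sum>i<CARD('n). (real_of_int (z i) / real p) *\<^sub>R e i)"

text \<open>The superlattice \<open>M\<close> of \<open>int_span e\<close> whose image in \<open>p\<^sup>-\<^sup>1 L / L\<close> is \<open>W\<close>.\<close>

definition subspace_lattice :: "(nat \<Rightarrow> real^'n) \<Rightarrow> nat \<Rightarrow> (nat \<Rightarrow> int) set \<Rightarrow> (real^'n) set" where
  "subspace_lattice e p W = {frac_vec e p z | z. reduce CARD('n) p z \<in> W}"

lemma reduce_in_Fp_space: "p > 0 \<Longrightarrow> reduce n p z \<in> Fp_space n p"
  by (simp add: reduce_def Fp_space_def)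

lemma reduce_Fp_space: "x \<in> Fp_space n p \<Longrightarrow> reduce n p x = x"
  by (auto simp: reduce_def Fp_space_def fun_eq_iff)

lemma reduce_add: "reduce n p (\<lambda>i. z i + z' i) = (\<lambda>i. (reduce n p z i + reduce n p z' i) mod int p)"
  by (auto simp: reduce_def mod_add_eq)

lemma reduce_mult: "reduce n p (\<lambda>i. c * z i) = (\<lambda>i. (c * reduce n p z i) mod int p)"
  by (auto simp: reduce_def mod_mult_right_eq)

lemma reduce_cong: "(\<And>i. i < n \<Longrightarrow> int p dvd z i - z' i) \<Longrightarrow> reduce n p z = reduce n p z'"
  by (auto simp: reduce_def fun_eq_iff mod_eq_dvd_iff)

lemma Fp_subspace_reduce_add:
  "Fp_subspace n p W \<Longrightarrow> reduce n p z \<in> W \<Longrightarrow> reduce n p z' \<in> W \<Longrightarrow> reduce n p (\<lambda>i. z i + z' i) \<in> W"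
  unfolding reduce_add by (simp add: Fp_subspace_def)

lemma Fp_subspace_reduce_mult:
  "Fp_subspace n p W \<Longrightarrow> reduce n p z \<in> W \<Longrightarrow> reduce n p (\<lambda>i. c * z i) \<in> W"
  unfolding reduce_mult by (simp add: Fp_subspace_def)

lemma frac_vec_add: "frac_vec e p (\<lambda>i. z i + z' i) = frac_vec e p z + frac_vec e p z'"
  by (simp add: frac_vec_def sum.distrib[symmetric] scaleR_add_left[symmetric] add_divide_distrib)

lemma frac_vec_mult: "frac_vec e p (\<lambda>i. c * z i) = real_of_int c *\<^sub>R frac_vec e p z"
  by (simp add: frac_vec_def scaleR_sum_right)

lemma frac_vec_int: 
  fixes e :: "nat \<Rightarrow> real^'n"
  shows "p > 0 \<Longrightarrow> frac_vec e p (\<lambda>i. int p * z i) = (\<Sum>i<CARD('n). real_of_int (z i) *\<^sub>R e i)"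
  by (simp add: frac_vec_def)

lemma int_module_full_lattice:
  fixes M :: "(real^'n) set"
  assumes "full_lattice M"
  shows "int_module M"
proof -
  obtain B where B: "M = lattice_of B" using assms by (auto simp: full_lattice_def)
  show ?thesis unfolding int_module_def B lattice_of_def
  proof (intro conjI ballI allI; clarify)
    show "\<exists>z. 0 = B *v (\<chi> i. real_of_int (z $ i)) \<and> True"
      by (intro exI[of _ 0]) (simp add: vec_eq_iff matrix_vector_mult_def)
    fix z z' :: "int^'n"
    show "\<exists>z''. B *v (\<chi> i. real_of_int (z $ i)) + B *v (\<chi> i. real_of_int (z' $ i)) = B *v (\<chi> i. real_of_int (z'' $ i)) \<and> True"
      by (intro exI[of _ "z + z'"]) (simp add: vec_eq_iff matrix_vector_mult_def sum.distrib algebra_simps)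
    fix c :: int
    show "\<exists>z''. real_of_int c *\<^sub>R (B *v (\<chi> i. real_of_int (z $ i))) = B *v (\<chi> i. real_of_int (z'' $ i)) \<and> True"
      by (intro exI[of _ "\<chi> i. c * z $ i"]) (simp add: vec_eq_iff matrix_vector_mult_def sum_distrib_left algebra_simps)
  qed
qed

context dual_bases
begin

lemma frac_vec_eq_iff: "p > 0 \<Longrightarrow> frac_vec e p z = frac_vec e p z' \<longleftrightarrow> (\<forall>i<CARD('n). z i = z' i)"
proof
  assume p: "p > 0" and eq: "frac_vec e p z = frac_vec e p z'"
  show "\<forall>i<CARD('n). z i = z' i"
  proof (intro allI impI)
    fix i assume i: "i < CARD('n)"
    have "u i \<bullet> frac_vec e p z = u i \<bullet> frac_vec e p z'" using eq by simp
    then show "z i = z' i" using i p unfolding frac_vec_def inner_sum_e[OF i] by simp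
  qed
qed (simp add: frac_vec_def)

lemma frac_vec_in_int_span_iff:
  assumes p: "p > 0"
  shows "frac_vec e p z \<in> int_span e \<longleftrightarrow> (\<forall>i<CARD('n). int p dvd z i)"
proof
  assume "frac_vec e p z \<in> int_span e"
  then obtain c where "frac_vec e p z = frac_vec e p (\<lambda>i. int p * c i)"
    unfolding int_span_def frac_vec_int[OF p] by blast
  then show "\<forall>i<CARD('n). int p dvd z i" unfolding frac_vec_eq_iff[OF p] by simp
next
  assume "\<forall>i<CARD('n). int p dvd z i"
  then have "frac_vec e p z = frac_vec e p (\<lambda>i. int p * (z i div int p))"
    unfolding frac_vec_eq_iff[OF p] by simp
  then show "frac_vec e p z \<in> int_span e" unfolding int_span_def frac_vec_int[OF p]
    by (intro CollectI exI[of _ "\<lambda>i. z i div int p"]) simp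
qed

lemma frac_vec_in_subspace_lattice_iff:
  assumes p: "p > 0"
  shows "frac_vec e p z \<in> subspace_lattice e p W \<longleftrightarrow> reduce CARD('n) p z \<in> W"
proof
  assume "frac_vec e p z \<in> subspace_lattice e p W"
  then obtain z' where z': "frac_vec e p z = frac_vec e p z'" "reduce CARD('n) p z' \<in> W"
    unfolding subspace_lattice_def by blast
  then have "reduce CARD('n) p z = reduce CARD('n) p z'"
    unfolding frac_vec_eq_iff[OF p] by (auto simp: reduce_def)
  then show "reduce CARD('n) p z \<in> W" using z' by simp
qed (auto simp: subspace_lattice_def)

lemma int_span_eq_frac_vec: "p > 0 \<Longrightarrow> int_span e = {frac_vec e p z | z. \<forall>i<CARD('n). int p dvd z i}"
proof
  assume p: "p > 0"
  show "int_span e \<subseteq> {frac_vec e p z | z. \<forall>i<CARD('n). int p dvd z i}"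
  proof
    fix x assume "x \<in> int_span e"
    then obtain c where "x = frac_vec e p (\<lambda>i. int p * c i)"
      unfolding int_span_def frac_vec_int[OF p] by blast
    then show "x \<in> {frac_vec e p z | z. \<forall>i<CARD('n). int p dvd z i}"
      by (intro CollectI exI[of _ "\<lambda>i. int p * c i"]) simp
  qed
  show "{frac_vec e p z | z. \<forall>i<CARD('n). int p dvd z i} \<subseteq> int_span e"
    using frac_vec_in_int_span_iff[OF p] by blast
qed

lemma reduce_eq_0_iff: "reduce n p z = (\<lambda>_. 0) \<longleftrightarrow> (\<forall>i<n. int p dvd z i)"
  by (auto simp: reduce_def fun_eq_iff dvd_eq_mod_eq_0)

lemma int_span_eq_subspace_lattice: "p > 0 \<Longrightarrow> int_span e = subspace_lattice e p {\<lambda>_. 0}"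
  unfolding int_span_eq_frac_vec subspace_lattice_def by (simp add: reduce_eq_0_iff)

lemma int_span_subset_subspace_lattice:
  "p > 0 \<Longrightarrow> Fp_subspace CARD('n) p W \<Longrightarrow> int_span e \<subseteq> subspace_lattice e p W"
  unfolding int_span_eq_subspace_lattice[of p] by (auto simp: subspace_lattice_def Fp_subspace_def)

lemma scaled_int_span: "p > 0 \<Longrightarrow> (\<lambda>x. inverse (real p) *\<^sub>R x) ` int_span e = range (frac_vec e p)"
proof -
  assume p: "p > 0"
  have scale: "inverse (real p) *\<^sub>R (\<Sum>i<CARD('n). real_of_int (z i) *\<^sub>R e i) = frac_vec e p z" for z
    by (simp add: frac_vec_def scaleR_sum_right divide_inverse mult.commute)
  then have eq: "inverse (real p) *\<^sub>R x \<in> range (frac_vec e p)" if "x \<in> int_span e" for x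
    using that unfolding int_span_def by auto
  show ?thesis
  proof
    show "range (frac_vec e p) \<subseteq> (\<lambda>x. inverse (real p) *\<^sub>R x) ` int_span e"
    proof
      fix x assume "x \<in> range (frac_vec e p)"
      then obtain z where "x = frac_vec e p z" by blast
      then have "x = inverse (real p) *\<^sub>R (\<Sum>i<CARD('n). real_of_int (z i) *\<^sub>R e i)"
        by (simp add: scale)
      then show "x \<in> (\<lambda>x. inverse (real p) *\<^sub>R x) ` int_span e"
        by (rule image_eqI) (auto simp: int_span_def)
    qed
  qed (use eq in blast)
qed

text \<open>The vectors of \<open>W\<close> represent the cosets: reduction changes a vector by an
  element of \<open>int_span e\<close>, and reduced vectors that are congruent modulo
  \<open>p\<close> are equal.\<close>

lemma card_cosets_subspace_lattice:
  assumes p: "p > 0" and W: "Fp_subspace CARD('n) p W"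
  shows "card ((\<lambda>x. (\<lambda>y. x + y) ` int_span e) ` subspace_lattice e p W) = card W"
proof -
  let ?C = "\<lambda>x. (\<lambda>y. x + y) ` int_span e"
  have Wsp: "W \<subseteq> Fp_space CARD('n) p" using W by (simp add: Fp_subspace_def)
  have mod: "int_module (int_span e)" by (rule int_module_int_span)
  have eqC: "?C x = ?C y \<longleftrightarrow> x - y \<in> int_span e" for x y
  proof
    assume eq: "?C x = ?C y"
    have "x + 0 \<in> ?C x" using mod unfolding int_module_def by (intro imageI) simp
    then have "x \<in> ?C y" using eq by simp
    then show "x - y \<in> int_span e" by auto
  next
    assume xy: "x - y \<in> int_span e"
    have yx: "y - x \<in> int_span e" using int_module_scale[OF mod xy, of "-1"] by simp
    show "?C x = ?C y"
    proof
      show "?C x \<subseteq> ?C y"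
      proof
        fix t assume "t \<in> ?C x"
        then obtain s where "s \<in> int_span e" "t = x + s" by blast
        then show "t \<in> ?C y" using int_module_add[OF mod xy] by (intro image_eqI[of _ _ "x - y + s"]) auto
      qed
      show "?C y \<subseteq> ?C x"
      proof
        fix t assume "t \<in> ?C y"
        then obtain s where "s \<in> int_span e" "t = y + s" by blast
        then show "t \<in> ?C x" using int_module_add[OF mod yx] by (intro image_eqI[of _ _ "y - x + s"]) auto
      qed
    qed
  qed
  have diff: "frac_vec e p z - frac_vec e p z' \<in> int_span e \<longleftrightarrow> (\<forall>i<CARD('n). int p dvd z i - z' i)" for z z'
  proof -
    have "frac_vec e p z - frac_vec e p z' = frac_vec e p (\<lambda>i. z i - z' i)"
      using frac_vec_add[of e p "\<lambda>i. z i - z' i" z'] by simp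
    then show ?thesis by (simp add: frac_vec_in_int_span_iff[OF p])
  qed
  have "inj_on (\<lambda>w. ?C (frac_vec e p w)) W"
  proof (rule inj_onI)
    fix w w' assume w: "w \<in> W" "w' \<in> W" "?C (frac_vec e p w) = ?C (frac_vec e p w')"
    then have "\<forall>i<CARD('n). int p dvd w i - w' i" unfolding eqC diff by simp
    then show "w = w'" using w Wsp by (intro Fp_space_eqI[of w "CARD('n)" p w']) auto
  qed
  moreover have "(\<lambda>w. ?C (frac_vec e p w)) ` W = ?C ` subspace_lattice e p W"
  proof
    show "(\<lambda>w. ?C (frac_vec e p w)) ` W \<subseteq> ?C ` subspace_lattice e p W"
    proof
      fix c assume "c \<in> (\<lambda>w. ?C (frac_vec e p w)) ` W"
      then obtain w where w: "w \<in> W" "c = ?C (frac_vec e p w)" by blast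
      have "frac_vec e p w \<in> subspace_lattice e p W"
        using w Wsp by (subst frac_vec_in_subspace_lattice_iff[OF p]) (auto simp: reduce_Fp_space)
      then show "c \<in> ?C ` subspace_lattice e p W" using w by blast
    qed
    show "?C ` subspace_lattice e p W \<subseteq> (\<lambda>w. ?C (frac_vec e p w)) ` W"
    proof
      fix c assume "c \<in> ?C ` subspace_lattice e p W"
      then obtain z where z: "reduce CARD('n) p z \<in> W" "c = ?C (frac_vec e p z)"
        unfolding subspace_lattice_def by blast
      have "?C (frac_vec e p z) = ?C (frac_vec e p (reduce CARD('n) p z))"
        unfolding eqC diff by (auto simp: reduce_def minus_mod_eq_mult_div)
      then show "c \<in> (\<lambda>w. ?C (frac_vec e p w)) ` W" using z by blast
    qed
  qed
  ultimately show ?thesis by (metis card_image)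
qed

text \<open>\<open>W'\<close> is the span of \<open>W\<close> and \<open>w\<close>. The factor
  \<open>p\<close> in its size arises because the multiple of \<open>w\<close> is determined modulo
  \<open>p\<close>: otherwise a difference \<open>t - s\<close> invertible modulo \<open>p\<close>
  would put \<open>w\<close> into \<open>W\<close>.\<close>

lemma Fp_subspace_adjoin:
  assumes p: "prime p" and W: "Fp_subspace n p W" and w: "w \<in> Fp_space n p" "w \<notin> W"
  defines "W' \<equiv> {reduce n p (\<lambda>i. x i + t * w i) | x t. x \<in> W}"
  shows "Fp_subspace n p W'" "card W' = p * card W" "W \<subseteq> W'"
    "V \<supseteq> W \<Longrightarrow> w \<in> V \<Longrightarrow> Fp_subspace n p V \<Longrightarrow> W' \<subseteq> V"
proof -
  have p0: "p > 0" using p prime_gt_0_nat by blast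
  have Wsp: "W \<subseteq> Fp_space n p" using W by (simp add: Fp_subspace_def)
  have red: "reduce n p x = x" if "x \<in> W" for x using that Wsp reduce_Fp_space by blast
  \<comment> \<open>A criterion free of chosen representatives, under which closure reduces to
    closure of \<open>W\<close>.\<close>
  have redin: "reduce n p z \<in> W'" if "reduce n p (\<lambda>i. z i - t * w i) \<in> W" for z t
  proof -
    have "reduce n p z = reduce n p (\<lambda>i. reduce n p (\<lambda>i. z i - t * w i) i + t * w i)"
    proof (rule reduce_cong)
      fix i assume "i < n"
      then have "z i - (reduce n p (\<lambda>i. z i - t * w i) i + t * w i)
          = (z i - t * w i) - (z i - t * w i) mod int p" by (simp add: reduce_def)
      then show "int p dvd z i - (reduce n p (\<lambda>i. z i - t * w i) i + t * w i)"
        by (simp add: minus_mod_eq_mult_div)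
    qed
    then show ?thesis using that unfolding W'_def by blast
  qed
  show "W \<subseteq> W'"
  proof
    fix x assume "x \<in> W"
    then have "reduce n p (\<lambda>i. x i + 0 * w i) \<in> W'" unfolding W'_def by blast
    then show "x \<in> W'" using red[OF \<open>x \<in> W\<close>] by simp
  qed
  then have zero: "(\<lambda>_. 0) \<in> W'" using W by (auto simp: Fp_subspace_def)
  show "Fp_subspace n p W'" unfolding Fp_subspace_def
  proof (intro conjI ballI allI zero)
    show "W' \<subseteq> Fp_space n p" unfolding W'_def using reduce_in_Fp_space[OF p0] by blast
    fix x assume "x \<in> W'"
    then obtain x1 t1 where x: "x1 \<in> W" "x = reduce n p (\<lambda>i. x1 i + t1 * w i)" unfolding W'_def by blast
    {
      fix y assume "y \<in> W'"
      then obtain x2 t2 where y: "x2 \<in> W" "y = reduce n p (\<lambda>i. x2 i + t2 * w i)" unfolding W'_def by blast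
      have "(\<lambda>i. (x i + y i) mod int p) = reduce n p (\<lambda>i. (x1 i + t1 * w i) + (x2 i + t2 * w i))"
        unfolding x y reduce_add ..
      also have "\<dots> \<in> W'"
      proof (rule redin[of _ "t1 + t2"])
        have "reduce n p (\<lambda>i. x1 i + x2 i) \<in> W"
          using x(1) y(1) by (intro Fp_subspace_reduce_add[OF W]) (simp_all add: red)
        then show "reduce n p (\<lambda>i. x1 i + t1 * w i + (x2 i + t2 * w i) - (t1 + t2) * w i) \<in> W"
          by (simp add: algebra_simps)
      qed
      finally show "(\<lambda>i. (x i + y i) mod int p) \<in> W'" .
    }
    fix c :: int
    have "(\<lambda>i. (c * x i) mod int p) = reduce n p (\<lambda>i. c * (x1 i + t1 * w i))"
      unfolding x reduce_mult ..
    also have "\<dots> \<in> W'"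
    proof (rule redin[of _ "c * t1"])
      have "reduce n p (\<lambda>i. c * x1 i) \<in> W"
        using x(1) by (intro Fp_subspace_reduce_mult[OF W]) (simp add: red)
      then show "reduce n p (\<lambda>i. c * (x1 i + t1 * w i) - c * t1 * w i) \<in> W"
        by (simp add: algebra_simps)
    qed
    finally show "(\<lambda>i. (c * x i) mod int p) \<in> W'" .
  qed
  show "W' \<subseteq> V" if V: "V \<supseteq> W" "w \<in> V" "Fp_subspace n p V" for V
  proof
    fix y assume "y \<in> W'"
    then obtain x t where y: "x \<in> W" "y = reduce n p (\<lambda>i. x i + t * w i)" unfolding W'_def by blast
    have "reduce n p x \<in> V" "reduce n p w \<in> V" using V y red reduce_Fp_space[OF w(1)] by auto
    then show "y \<in> V" unfolding y(2) by (intro Fp_subspace_reduce_add[OF V(3)] Fp_subspace_reduce_mult[OF V(3)])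
  qed
  have "bij_betw (\<lambda>(x, t). reduce n p (\<lambda>i. x i + t * w i)) (W \<times> {0..<int p}) W'"
    unfolding bij_betw_def
  proof
    show "inj_on (\<lambda>(x, t). reduce n p (\<lambda>i. x i + t * w i)) (W \<times> {0..<int p})"
    proof (rule inj_onI, clarify)
      fix x t y s assume xt: "x \<in> W" "t \<in> {0..<int p}" "y \<in> W" "s \<in> {0..<int p}"
        and eq: "reduce n p (\<lambda>i. x i + t * w i) = reduce n p (\<lambda>i. y i + s * w i)"
      have c: "int p dvd (x i + t * w i) - (y i + s * w i)" if "i < n" for i
        using fun_cong[OF eq, of i] that by (simp add: reduce_def mod_eq_dvd_iff)
      have ts: "t = s"
      proof (rule ccontr)
        assume "t \<noteq> s"
        have "\<bar>t - s\<bar> < int p" using xt by auto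
        then have "\<not> int p dvd t - s" using \<open>t \<noteq> s\<close> dvd_imp_le_int[of "t - s" "int p"] by auto
        then have "coprime (t - s) (int p)"
          using p prime_imp_coprime[of "int p" "t - s"] by (simp add: coprime_commute)
        then obtain a b where ab: "a * (t - s) + b * int p = 1" using bezout_int[of "t - s" "int p"] by auto
        have "w = reduce n p w" using reduce_Fp_space[OF w(1)] by simp
        also have "\<dots> = reduce n p (\<lambda>i. a * (y i + (-1) * x i))"
        proof (rule reduce_cong)
          fix i assume "i < n"
          have "w i = (a * (t - s) + b * int p) * w i" by (simp add: ab)
          then have "w i - a * (y i + (-1) * x i) = a * ((x i + t * w i) - (y i + s * w i)) + int p * (b * w i)"
            by (simp add: algebra_simps)
          then show "int p dvd w i - a * (y i + (-1) * x i)" using c[OF \<open>i < n\<close>] by simp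
        qed
        also have "\<dots> \<in> W"
          using xt by (intro Fp_subspace_reduce_add[OF W] Fp_subspace_reduce_mult[OF W]) (auto simp: red)
        finally show False using w by blast
      qed
      have "x = y"
      proof (rule Fp_space_eqI)
        show "x \<in> Fp_space n p" "y \<in> Fp_space n p" using xt Wsp by auto
        show "\<And>i. i < n \<Longrightarrow> int p dvd x i - y i" using c ts by simp
      qed
      then show "x = y \<and> t = s" using ts by simp
    qed
    show "(\<lambda>(x, t). reduce n p (\<lambda>i. x i + t * w i)) ` (W \<times> {0..<int p}) = W'"
    proof
      show "W' \<subseteq> (\<lambda>(x, t). reduce n p (\<lambda>i. x i + t * w i)) ` (W \<times> {0..<int p})"
      proof
        fix y assume "y \<in> W'"
        then obtain x t where y: "x \<in> W" "y = reduce n p (\<lambda>i. x i + t * w i)" unfolding W'_def by blast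
        have "y = reduce n p (\<lambda>i. x i + (t mod int p) * w i)"
          unfolding y(2) by (rule reduce_cong) (simp add: left_diff_distrib[symmetric] minus_mod_eq_mult_div)
        moreover have "t mod int p \<in> {0..<int p}" using p0 by simp
        ultimately show "y \<in> (\<lambda>(x, t). reduce n p (\<lambda>i. x i + t * w i)) ` (W \<times> {0..<int p})"
          using y(1) by (intro image_eqI[of _ _ "(x, t mod int p)"]) auto
      qed
    qed (auto simp: W'_def)
  qed
  then have "card W' = card (W \<times> {0..<int p})" by (rule bij_betw_same_card[symmetric])
  then show "card W' = p * card W" by (simp add: card_cartesian_product)
qed

text \<open>Adjoining one vector multiplies the size of the subspace by \<open>p\<close> and divides
  the determinant by \<open>p\<close>, so the product is preserved. A largest subspace of
  \<open>W\<close> that has a suitable basis must be \<open>W\<close>, since otherwise another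
  vector of \<open>W\<close> could be adjoined.\<close>

lemma subspace_lattice_basis:
  assumes p: "prime p" and W: "Fp_subspace CARD('n) p W"
  shows "\<exists>b. det (rowmat b) \<noteq> 0 \<and> subspace_lattice e p W = int_span b \<and>
    \<bar>det (rowmat e)\<bar> = real (card W) * \<bar>det (rowmat b)\<bar>"
proof -
  have p0: "p > 0" using p prime_gt_0_nat by blast
  let ?n = "CARD('n)"
  define Q where "Q W' \<longleftrightarrow> (\<exists>b. det (rowmat b) \<noteq> 0 \<and> subspace_lattice e p W' = int_span b \<and>
    \<bar>det (rowmat e)\<bar> = real (card W') * \<bar>det (rowmat b)\<bar>)" for W'
  define S where "S = {W'. Fp_subspace ?n p W' \<and> W' \<subseteq> W \<and> Q W'}"
  have finW: "finite W" by (rule finite_Fp_subspace[OF W])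
  have "finite S" by (rule finite_subset[of _ "Pow W"]) (use finW in \<open>auto simp: S_def\<close>)
  have "Fp_subspace ?n p {\<lambda>_. 0}" using p0 by (simp add: Fp_subspace_def Fp_space_def)
  moreover have "Q {\<lambda>_. 0}"
    unfolding Q_def using det_rowmat_nonzero[OF dual_bases_axioms] int_span_eq_subspace_lattice[OF p0]
    by (intro exI[of _ e]) simp
  ultimately have "{\<lambda>_. 0} \<in> S" using W by (auto simp: S_def Fp_subspace_def)
  then have "S \<noteq> {}" by blast
  have "Max (card ` S) \<in> card ` S" using \<open>finite S\<close> \<open>S \<noteq> {}\<close> by (intro Max_in) auto
  then obtain W' where "W' \<in> S" "card W' = Max (card ` S)" by auto
  then have W': "W' \<in> S" "\<And>X. X \<in> S \<Longrightarrow> card X \<le> card W'"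
    using Max_ge[of "card ` S"] \<open>finite S\<close> by auto
  have "W' = W"
  proof (rule ccontr)
    assume "W' \<noteq> W"
    then obtain w where w: "w \<in> W" "w \<notin> W'" using W'(1) by (auto simp: S_def)
    have W's: "Fp_subspace ?n p W'" "W' \<subseteq> W" and "Q W'" using W'(1) by (auto simp: S_def)
    have wsp: "w \<in> Fp_space ?n p" using w W by (auto simp: Fp_subspace_def)
    obtain b where b: "det (rowmat b) \<noteq> 0" "subspace_lattice e p W' = int_span b"
      "\<bar>det (rowmat e)\<bar> = real (card W') * \<bar>det (rowmat b)\<bar>" using \<open>Q W'\<close> unfolding Q_def by blast
    define v where "v = frac_vec e p w"
    have vb: "v \<notin> int_span b" unfolding v_def b(2)[symmetric] frac_vec_in_subspace_lattice_iff[OF p0]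
      using w reduce_Fp_space[OF wsp] by simp
    have pv: "real p *\<^sub>R v \<in> int_span b"
    proof -
      have "real p *\<^sub>R v = frac_vec e p (\<lambda>i. int p * w i)" by (simp add: v_def frac_vec_mult)
      also have "\<dots> \<in> int_span e" by (simp add: frac_vec_in_int_span_iff[OF p0])
      also have "\<dots> \<subseteq> int_span b" unfolding b(2)[symmetric] by (rule int_span_subset_subspace_lattice[OF p0 W's(1)])
      finally show ?thesis .
    qed
    obtain b' where b': "det (rowmat b') \<noteq> 0" "\<bar>det (rowmat b)\<bar> = real p * \<bar>det (rowmat b')\<bar>"
      "int_span b' = {x + real_of_int t *\<^sub>R v | x t. x \<in> int_span b}"
      by (rule int_span_adjoin[OF p b(1) pv vb]) blast
    define X where "X = {reduce ?n p (\<lambda>i. x i + t * w i) | x t. x \<in> W'}"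
    note X = Fp_subspace_adjoin[OF p W's(1) wsp w(2), folded X_def]
    have lat: "subspace_lattice e p X = int_span b'"
    proof
      show "subspace_lattice e p X \<subseteq> int_span b'"
      proof
        fix y assume "y \<in> subspace_lattice e p X"
        then obtain z where z: "y = frac_vec e p z" "reduce ?n p z \<in> X" unfolding subspace_lattice_def by blast
        then obtain x t where x: "x \<in> W'" "reduce ?n p z = reduce ?n p (\<lambda>i. x i + t * w i)" unfolding X_def by blast
        define z' where "z' = (\<lambda>i. z i - t * w i)"
        have "reduce ?n p z' = reduce ?n p x"
        proof (rule reduce_cong)
          fix i assume "i < ?n"
          then have "int p dvd z i - (x i + t * w i)" using fun_cong[OF x(2), of i] by (simp add: reduce_def mod_eq_dvd_iff)
          then show "int p dvd z' i - x i" by (simp add: z'_def algebra_simps)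
        qed
        also have "\<dots> \<in> W'" using x W's reduce_Fp_space by (metis Fp_subspace_def subsetD)
        finally have "frac_vec e p z' \<in> int_span b" unfolding b(2)[symmetric] by (simp add: frac_vec_in_subspace_lattice_iff[OF p0])
        moreover have "y = frac_vec e p z' + real_of_int t *\<^sub>R v"
          unfolding z(1) v_def frac_vec_mult[symmetric] frac_vec_add[symmetric] by (simp add: z'_def)
        ultimately show "y \<in> int_span b'" unfolding b'(3) by blast
      qed
      show "int_span b' \<subseteq> subspace_lattice e p X"
      proof
        fix y assume "y \<in> int_span b'"
        then obtain x t where y: "y = x + real_of_int t *\<^sub>R v" "x \<in> subspace_lattice e p W'" unfolding b'(3) b(2) by blast
        then obtain z where z: "x = frac_vec e p z" "reduce ?n p z \<in> W'" unfolding subspace_lattice_def by blast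
        have "y = frac_vec e p (\<lambda>i. z i + t * w i)" unfolding y z v_def by (simp add: frac_vec_add frac_vec_mult)
        moreover have "reduce ?n p (\<lambda>i. z i + t * w i) \<in> X"
        proof -
          have "reduce ?n p (\<lambda>i. z i + t * w i) = reduce ?n p (\<lambda>i. reduce ?n p z i + t * w i)"
            by (rule reduce_cong) (simp add: reduce_def minus_mod_eq_mult_div)
          then show ?thesis using z(2) unfolding X_def by blast
        qed
        ultimately show "y \<in> subspace_lattice e p X" unfolding subspace_lattice_def by blast
      qed
    qed
    have "\<bar>det (rowmat e)\<bar> = real (card X) * \<bar>det (rowmat b')\<bar>" using b(3) b'(2) X(2) by simp
    then have "Q X" unfolding Q_def using b'(1) lat by blast
    moreover have "X \<subseteq> W" using X(4)[OF W's(2) w(1) W] .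
    ultimately have "X \<in> S" using X(1) by (simp add: S_def)
    then have "card X \<le> card W'" by (rule W'(2))
    moreover have "card W' > 0" using W's finite_Fp_subspace[OF W's(1)] by (auto simp: card_gt_0_iff Fp_subspace_def)
    ultimately show False using X(2) prime_gt_1_nat[OF p] by simp
  qed
  then show ?thesis using W'(1) by (auto simp: S_def Q_def)
qed

lemma subspace_lattice_full:
  assumes p: "prime p" and W: "Fp_subspace CARD('n) p W"
  shows "full_lattice (subspace_lattice e p W)"
    and "covol (int_span e) = real (card W) * covol (subspace_lattice e p W)"
    and "covol (subspace_lattice e p W) > 0"
proof -
  obtain b where b: "det (rowmat b) \<noteq> 0" "subspace_lattice e p W = int_span b"
    "\<bar>det (rowmat e)\<bar> = real (card W) * \<bar>det (rowmat b)\<bar>"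
    using subspace_lattice_basis[OF assms] by blast
  show "full_lattice (subspace_lattice e p W)" unfolding b(2) by (rule int_span_full_lattice(1)[OF b(1)])
  show "covol (int_span e) = real (card W) * covol (subspace_lattice e p W)"
    unfolding b(2) int_span_full_lattice(2)[OF b(1)] int_span_full_lattice(2)[OF det_rowmat_nonzero[OF dual_bases_axioms]] by (rule b(3))
  show "covol (subspace_lattice e p W) > 0" unfolding b(2) int_span_full_lattice(2)[OF b(1)] using b(1) by simp
qed

text \<open>The inverse sends \<open>M\<close> to the reduced vectors \<open>w\<close> with
  \<open>frac_vec e p w\<close> in \<open>M\<close>. The two bounds on \<open>k\<close> correspond
  to the two strict inclusions in \<open>Lk\<close>.\<close>

lemma bij_betw_subspace_lattice:
  assumes p: "prime p" and k: "1 \<le> k" "k \<le> CARD('n) - 1"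
  shows "bij_betw (subspace_lattice e p) (Fp_subspaces CARD('n) p k) (Lk (int_span e) p k)"
proof -
  let ?n = "CARD('n)"
  have p0: "p > 0" using p prime_gt_0_nat by blast
  have p1: "p > 1" using p prime_gt_1_nat by blast
  have rec: "W = {w \<in> Fp_space ?n p. frac_vec e p w \<in> subspace_lattice e p W}" if "Fp_subspace ?n p W" for W
    using that reduce_Fp_space unfolding frac_vec_in_subspace_lattice_iff[OF p0] Fp_subspace_def by fastforce
  show ?thesis unfolding bij_betw_def
  proof
    show "inj_on (subspace_lattice e p) (Fp_subspaces ?n p k)"
    proof (rule inj_onI)
      fix W W' assume W: "W \<in> Fp_subspaces ?n p k" "W' \<in> Fp_subspaces ?n p k"
        and eq: "subspace_lattice e p W = subspace_lattice e p W'"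
      show "W = W'" using rec[of W] rec[of W'] W unfolding Fp_subspaces_def eq by simp
    qed
    show "subspace_lattice e p ` Fp_subspaces ?n p k = Lk (int_span e) p k"
    proof
      show "subspace_lattice e p ` Fp_subspaces ?n p k \<subseteq> Lk (int_span e) p k"
      proof
        fix M assume "M \<in> subspace_lattice e p ` Fp_subspaces ?n p k"
        then obtain W where W: "Fp_subspace ?n p W" "card W = p ^ k" "M = subspace_lattice e p W"
          by (auto simp: Fp_subspaces_def)
        have Wsp: "W \<subseteq> Fp_space ?n p" and W0: "(\<lambda>_. 0) \<in> W" using W(1) by (auto simp: Fp_subspace_def)
        have "int_span e \<noteq> M"
        proof
          assume "int_span e = M"
          have "card W \<noteq> 1" using W(2) p1 k by simp
          then have "W \<noteq> {\<lambda>_. 0}" by auto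
          then obtain w where w: "w \<in> W" "w \<noteq> (\<lambda>_. 0)" using W0 by blast
          have "frac_vec e p w \<in> M" unfolding W(3) frac_vec_in_subspace_lattice_iff[OF p0]
            using w Wsp reduce_Fp_space by auto
          then have "frac_vec e p w \<in> subspace_lattice e p {\<lambda>_. 0}"
            using \<open>int_span e = M\<close> int_span_eq_subspace_lattice[OF p0] by simp
          then have "reduce ?n p w = (\<lambda>_. 0)" by (simp add: frac_vec_in_subspace_lattice_iff[OF p0])
          then show False using w Wsp reduce_Fp_space by auto
        qed
        moreover have "int_span e \<subseteq> M" unfolding W(3) by (rule int_span_subset_subspace_lattice[OF p0 W(1)])
        moreover have "M \<subseteq> range (frac_vec e p)" unfolding W(3) subspace_lattice_def by blast
        moreover have "M \<noteq> range (frac_vec e p)"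
        proof
          assume M: "M = range (frac_vec e p)"
          have "Fp_space ?n p \<subseteq> W"
          proof
            fix x assume x: "x \<in> Fp_space ?n p"
            have "frac_vec e p x \<in> subspace_lattice e p W" using M W(3) by blast
            then show "x \<in> W" using reduce_Fp_space[OF x] by (simp add: frac_vec_in_subspace_lattice_iff[OF p0])
          qed
          then have "W = Fp_space ?n p" using Wsp by blast
          then have "p ^ k = p ^ ?n" using W(2) by (simp add: Fp_space_eq_coord card_Fp_coord)
          then have "k = ?n" using p1 by (simp add: power_inject_exp)
          then show False using k by linarith
        qed
        ultimately show "M \<in> Lk (int_span e) p k"
          unfolding Lk_def scaled_int_span[OF p0]
          using subspace_lattice_full(1)[OF p W(1)] card_cosets_subspace_lattice[OF p0 W(1)] W by auto
      qed
      show "Lk (int_span e) p k \<subseteq> subspace_lattice e p ` Fp_subspaces ?n p k"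
      proof
        fix M assume "M \<in> Lk (int_span e) p k"
        then have M: "full_lattice M" "int_span e \<subset> M" "M \<subset> range (frac_vec e p)"
          "card ((\<lambda>x. (\<lambda>y. x + y) ` int_span e) ` M) = p ^ k"
          unfolding Lk_def scaled_int_span[OF p0] by auto
        have mod: "int_module M" by (rule int_module_full_lattice[OF M(1)])
        define W where "W = {w \<in> Fp_space ?n p. frac_vec e p w \<in> M}"
        have red: "frac_vec e p (reduce ?n p z) \<in> M \<longleftrightarrow> frac_vec e p z \<in> M" for z
        proof -
          have "frac_vec e p (\<lambda>i. z i - reduce ?n p z i) \<in> int_span e"
            unfolding frac_vec_in_int_span_iff[OF p0] by (simp add: reduce_def minus_mod_eq_mult_div)
          then have d: "frac_vec e p (\<lambda>i. z i - reduce ?n p z i) \<in> M" using M(2) by blast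
          have eq: "frac_vec e p z = frac_vec e p (\<lambda>i. z i - reduce ?n p z i) + frac_vec e p (reduce ?n p z)"
            unfolding frac_vec_add[symmetric] by simp
          show ?thesis
            using int_module_add[OF mod d] int_module_diff[OF mod _ d] eq by (metis add_diff_cancel_left')
        qed
        have Wred: "reduce ?n p z \<in> W \<longleftrightarrow> frac_vec e p z \<in> M" for z
          unfolding W_def using red reduce_in_Fp_space[OF p0] by simp
        have W: "Fp_subspace ?n p W" unfolding Fp_subspace_def
        proof (intro conjI ballI allI)
          show "W \<subseteq> Fp_space ?n p" by (auto simp: W_def)
          have "frac_vec e p (\<lambda>_. 0) \<in> M" using mod by (simp add: frac_vec_def int_module_def)
          then show "(\<lambda>_. 0) \<in> W" using p0 by (simp add: W_def Fp_space_def)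
          fix x assume x: "x \<in> W"
          then have xr: "reduce ?n p x = x" and xM: "frac_vec e p x \<in> M" using reduce_Fp_space by (auto simp: W_def)
          {
            fix y assume y: "y \<in> W"
            then have yr: "reduce ?n p y = y" and yM: "frac_vec e p y \<in> M" using reduce_Fp_space by (auto simp: W_def)
            have "(\<lambda>i. (x i + y i) mod int p) = reduce ?n p (\<lambda>i. x i + y i)" unfolding reduce_add xr yr ..
            also have "\<dots> \<in> W" unfolding Wred frac_vec_add using int_module_add[OF mod xM yM] .
            finally show "(\<lambda>i. (x i + y i) mod int p) \<in> W" .
          }
          fix c :: int
          have "(\<lambda>i. (c * x i) mod int p) = reduce ?n p (\<lambda>i. c * x i)" unfolding reduce_mult xr ..
          also have "\<dots> \<in> W" unfolding Wred frac_vec_mult using int_module_scale[OF mod xM] .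
          finally show "(\<lambda>i. (c * x i) mod int p) \<in> W" .
        qed
        have "M = subspace_lattice e p W"
          unfolding subspace_lattice_def Wred using M(3) by blast
        moreover have "card W = p ^ k"
          using card_cosets_subspace_lattice[OF p0 W] M(4) calculation by simp
        ultimately show "M \<in> subspace_lattice e p ` Fp_subspaces ?n p k"
          using W by (auto simp: Fp_subspaces_def)
      qed
    qed
  qed
qed

end

section \<open>The coefficients A\<close>

text \<open>All vectors of \<open>W\<close> vanish at the coordinates in \<open>I1\<close>, so
  orthogonality does not constrain \<open>y\<close> there. The sum over these coordinates factors
  off, and the distribution relation makes it \<open>p ^ \<sigma> i\<close> times the value at 0 for
  each of them.\<close>

lemma sum_perp_coordinates:
  fixes \<sigma> :: "nat \<Rightarrow> nat" and W :: "(nat \<Rightarrow> int) set"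
  assumes p: "p > 0" and I: "I \<subseteq> {..<n}"
  defines "I1 \<equiv> {i \<in> I. perp n p (unit_vec i) W}"
  shows "(\<Sum>y\<in>{y \<in> Fp_coord p I. perp n p y W}. \<Prod>i\<in>I. c_coef (chi p (y i)) (\<sigma> i))
    = (\<Prod>i\<in>I1. of_nat p ^ \<sigma> i) * (\<Sum>y\<in>{y \<in> Fp_coord p (I - I1). perp n p y W}. \<Prod>i\<in>I. c_coef (chi p (y i)) (\<sigma> i))"
proof -
  let ?c = "\<lambda>i a. c_coef (chi p a) (\<sigma> i)"
  let ?Y = "{y \<in> Fp_coord p (I - I1). perp n p y W}"
  have finI: "finite I" using I finite_subset by blast
  have I1: "I1 \<subseteq> I" by (auto simp: I1_def)
  have finI1: "finite I1" using I1 finI finite_subset by blast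
  have perp_shift: "perp n p y W \<longleftrightarrow> perp n p b W" if "\<And>i. i \<notin> I1 \<Longrightarrow> y i = b i" for y b
  proof -
    have "int p dvd dotp n y x - dotp n b x" if x: "x \<in> W" for x
    proof -
      have "dotp n y x - dotp n b x = (\<Sum>i<n. (y i - b i) * x i)"
        by (simp add: dotp_def sum_subtractf left_diff_distrib)
      also have "int p dvd \<dots>"
      proof (rule dvd_sum)
        fix i assume "i \<in> {..<n}"
        show "int p dvd (y i - b i) * x i"
        proof (cases "i \<in> I1")
          case True
          then have "perp n p (unit_vec i) W" "i < n" using I by (auto simp: I1_def)
          then have "int p dvd x i" using x unfolding perp_def by (metis dotp_unit_vec)
          then show ?thesis by simp
        next
          case False then show ?thesis using \<open>\<And>i. i \<notin> I1 \<Longrightarrow> y i = b i\<close> by simp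
        qed
      qed
      finally show ?thesis .
    qed
    then have "int p dvd dotp n y x \<longleftrightarrow> int p dvd dotp n b x" if "x \<in> W" for x
      using that by (metis dvd_diff_right_iff dvd_diff_left_iff)
    then show ?thesis unfolding perp_def by blast
  qed
  let ?m = "\<lambda>(a, b) i. if i \<in> I1 then a i else b i"
  have bij: "bij_betw ?m (Fp_coord p I1 \<times> ?Y) {y \<in> Fp_coord p I. perp n p y W}"
  proof (rule bij_betwI[where g = "\<lambda>y. (\<lambda>i. if i \<in> I1 then y i else 0, \<lambda>i. if i \<in> I1 then 0 else y i)"])
    show "?m \<in> Fp_coord p I1 \<times> ?Y \<rightarrow> {y \<in> Fp_coord p I. perp n p y W}"
    proof
      fix ab assume ab: "ab \<in> Fp_coord p I1 \<times> ?Y"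
      obtain a b where [simp]: "ab = (a, b)" by fastforce
      have "perp n p (?m ab) W \<longleftrightarrow> perp n p b W" by (rule perp_shift) simp
      moreover have "?m ab \<in> Fp_coord p I" using ab I1 by (auto simp: Fp_coord_def)
      ultimately show "?m ab \<in> {y \<in> Fp_coord p I. perp n p y W}" using ab by simp
    qed
    show "(\<lambda>y. (\<lambda>i. if i \<in> I1 then y i else 0, \<lambda>i. if i \<in> I1 then 0 else y i)) \<in> {y \<in> Fp_coord p I. perp n p y W} \<rightarrow> Fp_coord p I1 \<times> ?Y"
    proof
      fix y assume y: "y \<in> {y \<in> Fp_coord p I. perp n p y W}"
      have "perp n p y W \<longleftrightarrow> perp n p (\<lambda>i. if i \<in> I1 then 0 else y i) W" by (rule perp_shift) simp
      then show "(\<lambda>i. if i \<in> I1 then y i else 0, \<lambda>i. if i \<in> I1 then 0 else y i) \<in> Fp_coord p I1 \<times> ?Y"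
        using y I1 by (auto simp: Fp_coord_def)
    qed
  qed (auto simp: Fp_coord_def fun_eq_iff)
  have split: "(\<Prod>i\<in>I. F i) = (\<Prod>i\<in>I1. F i) * (\<Prod>i\<in>I - I1. F i)" for F :: "nat \<Rightarrow> complex"
    using prod.subset_diff[OF I1 finI] by (simp add: mult.commute)
  have "(\<Sum>y\<in>{y \<in> Fp_coord p I. perp n p y W}. \<Prod>i\<in>I. ?c i (y i))
      = (\<Sum>ab\<in>Fp_coord p I1 \<times> ?Y. \<Prod>i\<in>I. ?c i (?m ab i))"
    by (rule sum.reindex_bij_betw[OF bij, symmetric])
  also have "\<dots> = (\<Sum>a\<in>Fp_coord p I1. \<Sum>b\<in>?Y. (\<Prod>i\<in>I1. ?c i (a i)) * (\<Prod>i\<in>I - I1. ?c i (b i)))"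
    unfolding sum.cartesian_product split by (intro sum.cong refl) (auto intro!: arg_cong2[of _ _ _ _ times] prod.cong)
  also have "\<dots> = (\<Sum>a\<in>Fp_coord p I1. \<Prod>i\<in>I1. ?c i (a i)) * (\<Sum>b\<in>?Y. \<Prod>i\<in>I - I1. ?c i (b i))"
    by (simp add: sum_product)
  also have "(\<Sum>a\<in>Fp_coord p I1. \<Prod>i\<in>I1. ?c i (a i)) = (\<Prod>i\<in>I1. of_nat p ^ \<sigma> i * c_coef 1 (\<sigma> i))"
    by (simp only: sum_prod_Fp_coord[OF finI1, of "\<lambda>i a. c_coef (chi p a) (\<sigma> i)"] c_coef_distribution_chi[OF p])
  \<comment> \<open>The factors at \<open>I1\<close> return to the product with parameter 1, because
    \<open>b\<close> is 0 there.\<close>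
  also have "\<dots> * (\<Sum>b\<in>?Y. \<Prod>i\<in>I - I1. ?c i (b i)) =
      (\<Prod>i\<in>I1. of_nat p ^ \<sigma> i) * (\<Sum>b\<in>?Y. (\<Prod>i\<in>I1. ?c i (b i)) * (\<Prod>i\<in>I - I1. ?c i (b i)))"
  proof -
    have "(\<Prod>i\<in>I1. ?c i (b i)) = (\<Prod>i\<in>I1. c_coef 1 (\<sigma> i))" if "b \<in> ?Y" for b
      using that by (intro prod.cong) (auto simp: Fp_coord_def)
    then have "(\<Sum>b\<in>?Y. (\<Prod>i\<in>I1. ?c i (b i)) * (\<Prod>i\<in>I - I1. ?c i (b i)))
        = (\<Sum>b\<in>?Y. (\<Prod>i\<in>I1. c_coef 1 (\<sigma> i)) * (\<Prod>i\<in>I - I1. ?c i (b i)))"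
      by (intro sum.cong refl) (simp only:)
    then show ?thesis by (simp only: prod.distrib sum_distrib_left[symmetric] mult.assoc)
  qed
  finally show ?thesis unfolding split .
qed

context dual_bases
begin

text \<open>The pairing with \<open>frac_vec e p z\<close> is \<open>dotp\<close> divided by
  \<open>p\<close>, and divisibility of \<open>dotp\<close> by \<open>p\<close> depends only on the
  reduction of \<open>z\<close>.\<close>

lemma dual_subspace_lattice_iff:
  assumes p: "p > 0" and W: "Fp_subspace CARD('n) p W"
  shows "(\<Sum>i<CARD('n). real_of_int (y i) *\<^sub>R u i) \<in> dual_lattice (subspace_lattice e p W) \<longleftrightarrow> perp CARD('n) p y W"
proof -
  let ?n = "CARD('n)" and ?g = "\<Sum>i<CARD('n). real_of_int (y i) *\<^sub>R u i"
  have inner: "?g \<bullet> frac_vec e p z = real_of_int (dotp ?n y z) / real p" for z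
    unfolding frac_vec_def inner_sum_u_e by (simp add: dotp_def sum_divide_distrib)
  have int: "?g \<bullet> frac_vec e p z \<in> \<int> \<longleftrightarrow> int p dvd dotp ?n y z" for z
  proof
    assume "?g \<bullet> frac_vec e p z \<in> \<int>"
    then obtain c where "real_of_int (dotp ?n y z) / real p = real_of_int c" unfolding inner by (elim Ints_cases)
    then have "real_of_int (dotp ?n y z) = real_of_int (c * int p)" using p by (simp add: field_simps)
    then have "dotp ?n y z = c * int p" by (simp only: of_int_eq_iff)
    then show "int p dvd dotp ?n y z" by simp
  next
    assume "int p dvd dotp ?n y z"
    then obtain c where "dotp ?n y z = int p * c" by blast
    then show "?g \<bullet> frac_vec e p z \<in> \<int>" unfolding inner using p by simp
  qed
  have red: "int p dvd dotp ?n y (reduce ?n p z) \<longleftrightarrow> int p dvd dotp ?n y z" for z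
  proof -
    have "dotp ?n y z - dotp ?n y (reduce ?n p z) = (\<Sum>i<?n. y i * (z i - z i mod int p))"
      by (simp add: dotp_def reduce_def sum_subtractf right_diff_distrib)
    also have "int p dvd \<dots>" by (intro dvd_sum) (simp add: minus_mod_eq_mult_div)
    finally show ?thesis by (metis dvd_diff_right_iff dvd_diff_left_iff)
  qed
  show ?thesis
  proof
    assume g: "?g \<in> dual_lattice (subspace_lattice e p W)"
    show "perp ?n p y W" unfolding perp_def
    proof
      fix x assume x: "x \<in> W"
      have "frac_vec e p x \<in> subspace_lattice e p W"
        using x W reduce_Fp_space by (subst frac_vec_in_subspace_lattice_iff[OF p]) (auto simp: Fp_subspace_def)
      then show "int p dvd dotp ?n y x" using g int unfolding dual_lattice_def by blast
    qed
  next
    assume "perp ?n p y W"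
    then show "?g \<in> dual_lattice (subspace_lattice e p W)"
      unfolding dual_lattice_def subspace_lattice_def perp_def using int red by blast
  qed
qed

lemma u_eq_sum_unit_vec: "j < CARD('n) \<Longrightarrow> u j = (\<Sum>i<CARD('n). real_of_int (unit_vec j i) *\<^sub>R u i)"
  by (simp add: unit_vec_def if_distrib[of real_of_int] if_distrib[of "\<lambda>c. c *\<^sub>R _"] cong: if_cong)

end

section \<open>The sets Gamma in coordinates of the dual basis\<close>

locale vertex_of_face = vertex_frame e u P v for e u :: "nat \<Rightarrow> real^'n" and P v +
  fixes f :: "(real^'n) set" and p :: nat
  assumes p: "prime p" and vf: "v \<in> f"
begin

abbreviation "T \<equiv> facets_through P f"
abbreviation "ix \<equiv> facet_index"

definition I :: "nat set" where "I = ix ` T"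

lemma T_facets: "F \<in> T \<Longrightarrow> F facet_of P" "F \<in> T \<Longrightarrow> v \<in> F"
  using vf by (auto simp: facets_through_def)

lemma finite_T: "finite T"
  using finite_polytope_facets[OF poly] by (rule finite_subset[rotated]) (auto simp: facets_through_def)

lemma ix_less: "F \<in> T \<Longrightarrow> ix F < CARD('n)"
  using facet_index(1) T_facets by blast

lemma inj_ix: "inj_on ix T"
  using inj_on_facet_index by (rule inj_on_subset) (use T_facets in blast)

lemma bij_ix: "bij_betw ix T I"
  using inj_ix by (simp add: I_def bij_betw_def)

lemma I_subset: "I \<subseteq> {..<CARD('n)}"
  using ix_less by (auto simp: I_def)

lemma ix_eq_iff: "F \<in> T \<Longrightarrow> G \<in> T \<Longrightarrow> ix F = ix G \<longleftrightarrow> F = G"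
  using inj_ix by (auto simp: inj_on_def)

lemma p0: "p > 0"
  using p prime_gt_0_nat by blast

context
  fixes W assumes W: "Fp_subspace CARD('n) p W"
begin

abbreviation "M \<equiv> subspace_lattice e p W"

lemma M_between: "int_span e \<subseteq> M" "M \<subseteq> (\<lambda>x. inverse (real p) *\<^sub>R x) ` int_span e"
  using int_span_subset_subspace_lattice[OF p0 W]
  by (auto simp: scaled_int_span[OF p0] subspace_lattice_def)

lemma dilation_eq: "i < CARD('n) \<Longrightarrow> dilation M p i = (if perp CARD('n) p (unit_vec i) W then 1 else p)"
  unfolding dilation_def using dual_subspace_lattice_iff[OF p0 W, of "unit_vec i"] u_eq_sum_unit_vec by simp

lemma facet_normal_M: "F \<in> T \<Longrightarrow> facet_normal M P F = real (dilation M p (ix F)) *\<^sub>R u (ix F)"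
  using facet_normal_eq(1)[OF p M_between] T_facets by blast

lemma dilation_pos: "real (dilation M p i) > 0"
  using p0 by (simp add: dilation_def)

text \<open>Coordinates of \<open>Gamma M P f\<close> in the basis \<open>u\<close>. Where the facet
  is not dilated, an integer in the half-open unit interval must be 0, so these coordinates are
  removed from the support.\<close>

definition Y :: "(nat \<Rightarrow> int) set" where
  "Y = {y \<in> Fp_coord p (I - {i \<in> I. perp CARD('n) p (unit_vec i) W}). perp CARD('n) p y W}"

definition gvec :: "(nat \<Rightarrow> int) \<Rightarrow> real^'n" where
  "gvec y = (\<Sum>i<CARD('n). real_of_int (y i) *\<^sub>R u i)"

lemma sum_T_inner:
  "F \<in> T \<Longrightarrow> (\<Sum>G\<in>T. r G *\<^sub>R facet_normal M P G) \<bullet> e (ix F) = r F * real (dilation M p (ix F))"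
proof -
  assume F: "F \<in> T"
  have "(\<Sum>G\<in>T. r G *\<^sub>R facet_normal M P G) \<bullet> e (ix F) = (\<Sum>G\<in>T. if G = F then r F * real (dilation M p (ix F)) else 0)"
    unfolding inner_sum_left using F
    by (intro sum.cong refl) (auto simp: facet_normal_M dual ix_less ix_eq_iff)
  then show ?thesis using F finite_T by simp
qed

lemma sum_T_inner_other:
  "j < CARD('n) \<Longrightarrow> j \<notin> I \<Longrightarrow> (\<Sum>G\<in>T. r G *\<^sub>R facet_normal M P G) \<bullet> e j = 0"
  unfolding inner_sum_left by (intro sum.neutral) (auto simp: facet_normal_M dual ix_less I_def)

lemma gvec_eq_sum_T:
  assumes y: "\<And>i. i \<notin> I \<Longrightarrow> y i = 0"
  shows "gvec y = (\<Sum>F\<in>T. (real_of_int (y (ix F)) / real (dilation M p (ix F))) *\<^sub>R facet_normal M P F)"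
proof -
  have "gvec y = (\<Sum>i\<in>I. real_of_int (y i) *\<^sub>R u i)"
    unfolding gvec_def using I_subset y by (intro sum.mono_neutral_right) auto
  also have "\<dots> = (\<Sum>F\<in>T. real_of_int (y (ix F)) *\<^sub>R u (ix F))"
    by (rule sum.reindex_bij_betw[OF bij_ix, symmetric])
  also have "\<dots> = (\<Sum>F\<in>T. (real_of_int (y (ix F)) / real (dilation M p (ix F))) *\<^sub>R facet_normal M P F)"
    using dilation_pos by (intro sum.cong refl) (simp add: facet_normal_M less_imp_neq[symmetric])
  finally show ?thesis .
qed

lemma Y_props:
  assumes "y \<in> Y"
  shows "\<And>i. i \<notin> I \<Longrightarrow> y i = 0" "\<And>i. i \<in> I \<Longrightarrow> 0 \<le> y i \<and> y i < int (dilation M p i)"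
proof -
  show "y i = 0" if "i \<notin> I" for i using assms that by (auto simp: Y_def Fp_coord_def)
  fix i assume i: "i \<in> I"
  then have "i < CARD('n)" using I_subset by auto
  then show "0 \<le> y i \<and> y i < int (dilation M p i)" unfolding dilation_eq[OF \<open>i < CARD('n)\<close>]
    using assms i by (cases "perp CARD('n) p (unit_vec i) W") (auto simp: Y_def Fp_coord_def)
qed

text \<open>The coordinate along \<open>u (ix F)\<close> is \<open>\<rho> F\<close> times the
  dilation, so the bounds on \<open>\<rho>\<close> become bounds by 0 and the dilation, while
  membership in the dual lattice becomes orthogonality to \<open>W\<close>.\<close>

lemma bij_gvec: "bij_betw gvec Y (Gamma M P f)"
  unfolding bij_betw_def
proof
  show "inj_on gvec Y"
  proof (rule inj_onI)
    fix y y' assume y: "y \<in> Y" "y' \<in> Y" and eq: "gvec y = gvec y'"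
    show "y = y'"
    proof
      fix i show "y i = y' i"
      proof (cases "i < CARD('n)")
        case True
        have "gvec y \<bullet> e i = gvec y' \<bullet> e i" using eq by simp
        then show ?thesis using True by (simp add: gvec_def)
      next
        case False
        then have "i \<notin> I" using I_subset by auto
        then show ?thesis using Y_props(1)[OF y(1)] Y_props(1)[OF y(2)] by simp
      qed
    qed
  qed
  show "gvec ` Y = Gamma M P f"
  proof
    show "gvec ` Y \<subseteq> Gamma M P f"
    proof
      fix g assume "g \<in> gvec ` Y"
      then obtain y where y: "y \<in> Y" "g = gvec y" by blast
      have "g \<in> dual_lattice M" unfolding y(2) gvec_def
        using y(1) dual_subspace_lattice_iff[OF p0 W] by (simp add: Y_def)
      moreover have "0 \<le> real_of_int (y (ix F)) / real (dilation M p (ix F)) \<and> real_of_int (y (ix F)) / real (dilation M p (ix F)) < 1"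
        if F: "F \<in> T" for F
      proof -
        have "0 \<le> y (ix F) \<and> y (ix F) < int (dilation M p (ix F))" using Y_props(2)[OF y(1)] F by (auto simp: I_def)
        then have "0 \<le> real_of_int (y (ix F))" "real_of_int (y (ix F)) < real (dilation M p (ix F))"
          by (auto simp: of_int_less_iff[symmetric, where 'a = real] simp del: of_int_less_iff)
        then show ?thesis using dilation_pos[of "ix F"] by simp
      qed
      ultimately show "g \<in> Gamma M P f"
        unfolding Gamma_def using gvec_eq_sum_T[OF Y_props(1)[OF y(1)]] y(2)
        by (intro CollectI conjI exI[of _ "\<lambda>F. real_of_int (y (ix F)) / real (dilation M p (ix F))"]) auto
    qed
    show "Gamma M P f \<subseteq> gvec ` Y"
    proof
      fix g assume "g \<in> Gamma M P f"
      then obtain \<rho> where g: "g \<in> dual_lattice M" and \<rho>: "\<And>F. F \<in> T \<Longrightarrow> 0 \<le> \<rho> F \<and> \<rho> F < 1"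
        and gs: "g = (\<Sum>F\<in>T. \<rho> F *\<^sub>R facet_normal M P F)" unfolding Gamma_def by blast
      have "\<exists>c. g \<bullet> e i = real_of_int c" if "i < CARD('n)" for i
        using inner_e_Ints[OF M_between(1) g that] by (auto elim: Ints_cases)
      then obtain c where c: "\<And>i. i < CARD('n) \<Longrightarrow> g \<bullet> e i = real_of_int (c i)" by metis
      define y where "y i = (if i \<in> I then c i else 0)" for i
      have ge: "g \<bullet> e i = real_of_int (y i)" if "i < CARD('n)" for i
        using c[OF that] sum_T_inner_other[OF that, of \<rho>] gs by (auto simp: y_def)
      have "g = (\<Sum>i<CARD('n). (g \<bullet> e i) *\<^sub>R u i)" by (rule expand_dual)
      also have "\<dots> = gvec y" unfolding gvec_def by (intro sum.cong refl) (simp add: ge)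
      finally have gy: "g = gvec y" .
      have bnd: "0 \<le> y i \<and> y i < int (dilation M p i)" if iI: "i \<in> I" for i
      proof -
        obtain F where F: "F \<in> T" "i = ix F" using iI by (auto simp: I_def)
        have "real_of_int (y i) = \<rho> F * real (dilation M p i)"
          using ge[of i] sum_T_inner[OF F(1), of \<rho>] gs F ix_less by simp
        moreover have "0 \<le> \<rho> F * real (dilation M p i)" "\<rho> F * real (dilation M p i) < 1 * real (dilation M p i)"
          using \<rho>[OF F(1)] dilation_pos[of i] by (auto intro: mult_strict_right_mono)
        ultimately have "0 \<le> real_of_int (y i)" "real_of_int (y i) < real_of_int (int (dilation M p i))" by auto
        then show ?thesis by (simp only: of_int_0_le_iff of_int_less_iff)
      qed
      have "y \<in> Fp_coord p (I - {i \<in> I. perp CARD('n) p (unit_vec i) W})"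
        unfolding Fp_coord_def
      proof (intro CollectI conjI ballI allI impI)
        fix i assume i: "i \<in> I - {i \<in> I. perp CARD('n) p (unit_vec i) W}"
        then have "i \<in> I" "i < CARD('n)" "\<not> perp CARD('n) p (unit_vec i) W" using I_subset by auto
        then show "0 \<le> y i" "y i < int p" using bnd[of i] dilation_eq[of i] by auto
      next
        fix i assume i: "i \<notin> I - {i \<in> I. perp CARD('n) p (unit_vec i) W}"
        show "y i = 0"
        proof (cases "i \<in> I")
          case True
          then have "i < CARD('n)" "perp CARD('n) p (unit_vec i) W" using I_subset i by auto
          then show ?thesis using bnd[OF True] dilation_eq[of i] by auto
        qed (simp add: y_def)
      qed
      moreover have "perp CARD('n) p y W"
        using g unfolding gy gvec_def dual_subspace_lattice_iff[OF p0 W] .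
      ultimately show "g \<in> gvec ` Y" using gy by (auto simp: Y_def)
    qed
  qed
qed

text \<open>Pairing with \<open>e (ix G)\<close> isolates the coefficient at \<open>G\<close>, which
  gives the uniqueness that the \<open>THE\<close> in \<open>rho\<close> calls for.\<close>

lemma rho_gvec:
  assumes y: "y \<in> Y" and F: "F \<in> T"
  shows "rho M P f (gvec y) F = real_of_int (y (ix F)) / real (dilation M p (ix F))"
proof -
  have gs: "gvec y = (\<Sum>F\<in>T. (real_of_int (y (ix F)) / real (dilation M p (ix F))) *\<^sub>R facet_normal M P F)"
    by (rule gvec_eq_sum_T) (rule Y_props(1)[OF y])
  define r where "r F = (if F \<in> T then real_of_int (y (ix F)) / real (dilation M p (ix F)) else 0)" for F
  have "rho M P f (gvec y) = r"
    unfolding rho_def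
  proof (rule the_equality)
    show "(\<forall>F. F \<notin> T \<longrightarrow> r F = 0) \<and> gvec y = (\<Sum>F\<in>T. r F *\<^sub>R facet_normal M P F)"
      unfolding gs by (simp add: r_def)
    fix r' assume r': "(\<forall>F. F \<notin> T \<longrightarrow> r' F = 0) \<and> gvec y = (\<Sum>F\<in>T. r' F *\<^sub>R facet_normal M P F)"
    show "r' = r"
    proof
      fix G show "r' G = r G"
      proof (cases "G \<in> T")
        case True
        have "r' G * real (dilation M p (ix G)) = gvec y \<bullet> e (ix G)" using sum_T_inner[OF True, of r'] r' by simp
        also have "\<dots> = real_of_int (y (ix G))" using ix_less[OF True] by (simp add: gvec_def)
        finally show ?thesis using True dilation_pos[of "ix G"] by (simp add: r_def field_simps)
      qed (use r' in \<open>simp add: r_def\<close>)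
    qed
  qed
  then show ?thesis using F by (simp add: r_def)
qed

lemma A_coef_eq_sum_Y:
  "A_coef M P f \<pi> = (\<Sum>y\<in>Y. \<Prod>F\<in>T. c_coef (chi p (y (ix F))) (\<pi> F))"
proof -
  have "A_coef M P f \<pi> = (\<Sum>y\<in>Y. \<Prod>F\<in>T. c_coef (exp (2 * of_real pi * \<i> * of_real (rho M P f (gvec y) F))) (\<pi> F))"
    unfolding A_coef_def by (rule sum.reindex_bij_betw[OF bij_gvec, symmetric])
  also have "\<dots> = (\<Sum>y\<in>Y. \<Prod>F\<in>T. c_coef (chi p (y (ix F))) (\<pi> F))"
  proof (intro sum.cong prod.cong refl)
    fix y F assume y: "y \<in> Y" and F: "F \<in> T"
    have i: "ix F \<in> I" "ix F < CARD('n)" using F ix_less by (auto simp: I_def)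
    have "exp (2 * of_real pi * \<i> * of_real (rho M P f (gvec y) F)) = chi p (y (ix F))"
    \<comment> \<open>Without dilation both arguments are 0; with dilation \<open>p\<close> the
      coefficient is \<open>y (ix F)\<close> over \<open>p\<close>, the argument of
      \<open>chi\<close>.\<close>
    proof (cases "perp CARD('n) p (unit_vec (ix F)) W")
      case True
      then have "y (ix F) = 0" using Y_props(2)[OF y i(1)] dilation_eq[OF i(2)] by simp
      then show ?thesis by (simp add: rho_gvec[OF y F])
    next
      case False
      then show ?thesis by (simp add: rho_gvec[OF y F] dilation_eq[OF i(2)] chi_def)
    qed
    then show "c_coef (exp (2 * of_real pi * \<i> * of_real (rho M P f (gvec y) F))) (\<pi> F) = c_coef (chi p (y (ix F))) (\<pi> F)"
      by simp
  qed
  finally show ?thesis .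
qed

text \<open>The power of \<open>p\<close> turns each weight 1/d into p/d, which is \<open>p\<close>
  at facets that are not dilated and 1 at the others. These are the factors gained when the sum is
  enlarged from \<open>Y\<close> to all of \<open>Fp_coord p I\<close>, so the right side no longer
  mentions the dilations.\<close>

lemma A_coef_dilated:
  "of_nat p ^ (\<Sum>F\<in>T. \<pi> F) * (A_coef M P f \<pi> * complex_of_real (\<Prod>F\<in>T. (1 / real (dilation M p (ix F))) ^ \<pi> F))
    = (\<Sum>y\<in>{y \<in> Fp_coord p I. perp CARD('n) p y W}. \<Prod>F\<in>T. c_coef (chi p (y (ix F))) (\<pi> F))"
proof -
  \<comment> \<open>Carries the exponents from facets to their indices in \<open>I\<close>.\<close>
  define \<sigma> where "\<sigma> i = \<pi> (the_inv_into T ix i)" for i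
  have \<sigma>: "\<sigma> (ix F) = \<pi> F" if "F \<in> T" for F
    using the_inv_into_f_f[OF inj_ix that] by (simp add: \<sigma>_def)
  have prodI: "(\<Prod>F\<in>T. h (ix F) (\<pi> F)) = (\<Prod>i\<in>I. h i (\<sigma> i))" for h :: "nat \<Rightarrow> nat \<Rightarrow> complex"
  proof -
    have "(\<Prod>F\<in>T. h (ix F) (\<pi> F)) = (\<Prod>F\<in>T. h (ix F) (\<sigma> (ix F)))" by (intro prod.cong) (simp_all add: \<sigma>)
    also have "\<dots> = (\<Prod>i\<in>I. h i (\<sigma> i))" by (rule prod.reindex_bij_betw[OF bij_ix])
    finally show ?thesis .
  qed
  let ?d = "\<lambda>i. complex_of_real (real (dilation M p i))"
  let ?I1 = "{i \<in> I. perp CARD('n) p (unit_vec i) W}"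
  have finI: "finite I" using finite_T by (simp add: I_def)
  have "of_nat p ^ (\<Sum>F\<in>T. \<pi> F) * complex_of_real (\<Prod>F\<in>T. (1 / real (dilation M p (ix F))) ^ \<pi> F)
      = (\<Prod>F\<in>T. (of_nat p / ?d (ix F)) ^ \<pi> F)"
    by (simp add: power_sum prod.distrib[symmetric] power_mult_distrib[symmetric])
  also have "\<dots> = (\<Prod>i\<in>I. (of_nat p / ?d i) ^ \<sigma> i)" by (rule prodI)
  also have "\<dots> = (\<Prod>i\<in>I. if perp CARD('n) p (unit_vec i) W then of_nat p ^ \<sigma> i else 1)"
    using I_subset p0 by (intro prod.cong refl) (auto simp: dilation_eq)
  also have "\<dots> = (\<Prod>i\<in>?I1. of_nat p ^ \<sigma> i)" using finI by (simp add: prod.inter_filter)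
  finally have 1: "of_nat p ^ (\<Sum>F\<in>T. \<pi> F) * complex_of_real (\<Prod>F\<in>T. (1 / real (dilation M p (ix F))) ^ \<pi> F)
      = (\<Prod>i\<in>?I1. of_nat p ^ \<sigma> i)" .
  have "of_nat p ^ (\<Sum>F\<in>T. \<pi> F) * (A_coef M P f \<pi> * complex_of_real (\<Prod>F\<in>T. (1 / real (dilation M p (ix F))) ^ \<pi> F))
      = (\<Prod>i\<in>?I1. of_nat p ^ \<sigma> i) * A_coef M P f \<pi>"
    unfolding 1[symmetric] by (simp only: mult_ac)
  also have "\<dots> = (\<Prod>i\<in>?I1. of_nat p ^ \<sigma> i) * (\<Sum>y\<in>Y. \<Prod>i\<in>I. c_coef (chi p (y i)) (\<sigma> i))"
    unfolding A_coef_eq_sum_Y by (intro arg_cong2[of _ _ _ _ times] sum.cong refl prodI)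
  also have "\<dots> = (\<Sum>y\<in>{y \<in> Fp_coord p I. perp CARD('n) p y W}. \<Prod>i\<in>I. c_coef (chi p (y i)) (\<sigma> i))"
    unfolding Y_def by (rule sum_perp_coordinates[OF p0 I_subset, symmetric])
  also have "\<dots> = (\<Sum>y\<in>{y \<in> Fp_coord p I. perp CARD('n) p y W}. \<Prod>F\<in>T. c_coef (chi p (y (ix F))) (\<pi> F))"
    by (intro sum.cong refl prodI[symmetric])
  finally show ?thesis .
qed

end

lemma zero_subspace: "Fp_subspace CARD('n) p {\<lambda>_. 0}"
  using p0 by (simp add: Fp_subspace_def Fp_space_def)

text \<open>The lattice belongs to the zero subspace. Nothing is dilated there, so 0 is the only
  element of \<open>Gamma\<close>.\<close>

lemma A_coef_int_span: "A_coef (int_span e) P f \<pi> = (\<Prod>F\<in>T. c_coef 1 (\<pi> F))"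
proof -
  have "perp CARD('n) p y {\<lambda>_. 0}" for y by (simp add: perp_def dotp_def)
  then have "Y {\<lambda>_. 0} = {\<lambda>_. 0}" by (auto simp: Y_def[OF zero_subspace] Fp_coord_def)
  then show ?thesis
    using A_coef_eq_sum_Y[OF zero_subspace, of \<pi>] int_span_eq_subspace_lattice[OF p0] by simp
qed

text \<open>The instance of the previous identity at the zero subspace: every \<open>y\<close> is
  orthogonal to it and all weights are 1. It supplies the ratio \<open>p ^ l\<close> between total
  and value at 0.\<close>

lemma sum_c_coef_I:
  "(\<Sum>y\<in>Fp_coord p I. \<Prod>F\<in>T. c_coef (chi p (y (ix F))) (\<pi> F)) = of_nat p ^ (\<Sum>F\<in>T. \<pi> F) * (\<Prod>F\<in>T. c_coef 1 (\<pi> F))"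
proof -
  have "{y \<in> Fp_coord p I. perp CARD('n) p y {\<lambda>_. 0}} = Fp_coord p I" by (simp add: perp_def dotp_def)
  moreover have "dilation (int_span e) p (ix F) = 1" if "F \<in> T" for F using dilation_int_span ix_less[OF that] by blast
  ultimately show ?thesis
    using A_coef_dilated[OF zero_subspace, of \<pi>] A_coef_int_span[of \<pi>]
    by (simp add: int_span_eq_subspace_lattice[OF p0, symmetric])
qed

end

section \<open>Summation over all superlattices of given index\<close>

theorem theorem1p2:
  fixes L P f :: "(real^'n) set" and p k :: nat and \<pi> :: "(real^'n) set \<Rightarrow> nat"
  assumes "full_lattice L"
    and "prime p"
    and "1 \<le> k" and "k \<le> CARD('n) - 1"
    and "lattice_polytope L P" and "nonsingular_polytope L P"
    and "f face_of P" and "f \<noteq> {}"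
    and "\<forall>F\<in>facets_through P f. \<pi> F > 0"
  shows "(\<Sum>M\<in>Lk L p k. A_coef M P f \<pi> * complex_of_real (face_deriv P f \<pi> (volfun M P)))
       = of_nat (nu CARD('n) k (CARD('n) - (\<Sum>F\<in>facets_through P f. \<pi> F)) p)
         * A_coef L P f \<pi> * complex_of_real (face_deriv P f \<pi> (volfun L P))"
proof -
  interpret nonsingular_lattice_polytope L P by unfold_locales (fact assms)+
  obtain v where v: "v extreme_point_of P" "v \<in> f" using vertex_in_face assms by blast
  obtain e u where eu: "vertex_frame e u P v" "L = int_span e" using frame_at_vertex[OF v(1)] by blast
  interpret vertex_frame e u P v by fact
  interpret vertex_of_face e u P v f p by unfold_locales (fact assms v)+
  let ?n = "CARD('n)"
  define l where "l = (\<Sum>F\<in>T. \<pi> F)"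
  obtain xs where fd: "\<And>g. face_deriv P f \<pi> g = pdl xs g (\<lambda>_. 0)" and xs: "set xs = T" "length xs = l"
    "\<And>w. (\<Prod>F\<leftarrow>xs. w F) = (\<Prod>F\<in>T. (w F :: real) ^ \<pi> F)"
    using face_deriv_obtain[OF finite_T assms(9)] unfolding l_def by metis
  define D where "D = pdl xs H.vol (\<lambda>_. 0)"
  have xsf: "set xs \<subseteq> {F. F facet_of P}" using xs T_facets by auto
  \<comment> \<open>The bound is exclusive: it encodes degree at most \<open>?n\<close>.\<close>
  have lp: "locally_polynomial {F. F facet_of P} (?n + 1) H.vol" using H.locally_polynomial_vol by simp
  have deriv: "face_deriv P f \<pi> (volfun N P) = (1 / covol N) * (\<Prod>F\<in>T. (1 / real (facet_dilation N p F)) ^ \<pi> F) * D"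
    if N: "L \<subseteq> N" "N \<subseteq> (\<lambda>x. inverse (real p) *\<^sub>R x) ` L" for N
  proof -
    have "real (facet_dilation N p F) \<ge> 1" for F using p0 by (simp add: facet_dilation_def)
    then have "pdl xs (\<lambda>h. (1 / covol N) * H.vol (\<lambda>F. h F / real (facet_dilation N p F))) (\<lambda>_. 0)
      = (1 / covol N) * (\<Prod>F\<leftarrow>xs. 1 / real (facet_dilation N p F)) * D"
      unfolding D_def by (rule pdl_rescale_at_zero[OF lp xsf])
    then show ?thesis by (simp only: fd volfun_superlattice[OF assms(2) N] xs(3))
  qed
  have fn: "facet_normal L P F = u (ix F)" if "F \<in> T" for F
    using facet_normal_int_span(1)[OF T_facets[OF that]] eu(2) by simp
  have dil: "facet_dilation N p F = dilation N p (ix F)" if "F \<in> T" for N F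
    by (simp add: facet_dilation_def dilation_def fn[OF that])
  define G0 where "G0 = (\<Prod>F\<in>T. c_coef 1 (\<pi> F))"
  have AL: "A_coef L P f \<pi> = G0" by (simp add: eu(2) A_coef_int_span G0_def)
  have Lsub: "L \<subseteq> (\<lambda>x. inverse (real p) *\<^sub>R x) ` L"
    using M_between[OF zero_subspace] by (simp add: eu(2) int_span_eq_subspace_lattice[OF p0, symmetric])
  have derivL: "face_deriv P f \<pi> (volfun L P) = D / covol L"
    using deriv[OF subset_refl Lsub] dil[of _ L] dilation_int_span[OF ix_less] by (simp add: eu(2))
  have bij: "bij_betw (subspace_lattice e p) (Fp_subspaces ?n p k) (Lk L p k)"
    unfolding eu(2) by (rule bij_betw_subspace_lattice[OF assms(2-4)])
  \<comment> \<open>The power \<open>p ^ k\<close> is the ratio of covolumes, and \<open>D\<close>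
    is common to all lattices; only the weighted coefficient still depends on
    \<open>W\<close>.\<close>
  have summand: "A_coef (subspace_lattice e p W) P f \<pi> * complex_of_real (face_deriv P f \<pi> (volfun (subspace_lattice e p W) P))
      = complex_of_real (D / covol L) * of_nat p ^ k *
        (A_coef (subspace_lattice e p W) P f \<pi> * complex_of_real (\<Prod>F\<in>T. (1 / real (dilation (subspace_lattice e p W) p (ix F))) ^ \<pi> F))"
    if W: "W \<in> Fp_subspaces ?n p k" for W
  proof -
    let ?M = "subspace_lattice e p W"
    have W': "Fp_subspace ?n p W" "card W = p ^ k" using W by (auto simp: Fp_subspaces_def)
    have "face_deriv P f \<pi> (volfun ?M P) = (1 / covol ?M) * (\<Prod>F\<in>T. (1 / real (dilation ?M p (ix F))) ^ \<pi> F) * D"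
      using deriv[OF M_between[OF W'(1), folded eu(2)]] by (simp add: dil)
    moreover have "1 / covol ?M = real p ^ k / covol L"
      using subspace_lattice_full(2,3)[OF assms(2) W'(1)] W'(2) p0 by (simp add: eu(2))
    ultimately show ?thesis by (simp add: mult_ac)
  qed
  have "(\<Sum>M\<in>Lk L p k. A_coef M P f \<pi> * complex_of_real (face_deriv P f \<pi> (volfun M P)))
      = (\<Sum>W\<in>Fp_subspaces ?n p k. A_coef (subspace_lattice e p W) P f \<pi> * complex_of_real (face_deriv P f \<pi> (volfun (subspace_lattice e p W) P)))"
    by (rule sum.reindex_bij_betw[OF bij, symmetric])
  also have "\<dots> = complex_of_real (D / covol L) * of_nat p ^ k * (\<Sum>W\<in>Fp_subspaces ?n p k.
      A_coef (subspace_lattice e p W) P f \<pi> * complex_of_real (\<Prod>F\<in>T. (1 / real (dilation (subspace_lattice e p W) p (ix F))) ^ \<pi> F))"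
    unfolding sum_distrib_left by (intro sum.cong refl summand)
  finally have LHS: "(\<Sum>M\<in>Lk L p k. A_coef M P f \<pi> * complex_of_real (face_deriv P f \<pi> (volfun M P))) = \<dots>" .
  show ?thesis
  \<comment> \<open>Beyond the dimension the truncated subtraction makes the third argument of
    \<open>nu\<close> equal to 0; this is harmless because \<open>D = 0\<close> there.\<close>
  proof (cases "l \<le> ?n")
    case False
    then have "D = 0" unfolding D_def by (intro pdl_eq_0[OF lp xsf]) (simp add: xs)
    then show ?thesis unfolding LHS derivL by simp
  next
    case True
    let ?G = "\<lambda>y. \<Prod>F\<in>T. c_coef (chi p (y (ix F))) (\<pi> F)"
    let ?S = "\<Sum>W\<in>Fp_subspaces ?n p k.
      A_coef (subspace_lattice e p W) P f \<pi> * complex_of_real (\<Prod>F\<in>T. (1 / real (dilation (subspace_lattice e p W) p (ix F))) ^ \<pi> F)"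
    have "of_nat p ^ l * ?S = (\<Sum>W\<in>Fp_subspaces ?n p k. \<Sum>y\<in>{y \<in> Fp_coord p I. perp ?n p y W}. ?G y)"
      unfolding sum_distrib_left l_def
      by (intro sum.cong refl A_coef_dilated) (simp add: Fp_subspaces_def)
    also have "\<dots> = of_nat (n_perp ?n p k (\<lambda>_. 0)) * ?G (\<lambda>_. 0)
        + of_nat (n_perp ?n p k (unit_vec 0)) * ((\<Sum>y\<in>Fp_coord p I. ?G y) - ?G (\<lambda>_. 0))"
      using Fp_coord_subset[OF p0 I_subset] p0 by (intro sum_subspaces_perp assms) (auto simp: Fp_space_eq_coord)
    also have "\<dots> = (of_nat (n_perp ?n p k (\<lambda>_. 0)) + of_nat (n_perp ?n p k (unit_vec 0)) * (of_nat p ^ l - 1)) * G0"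
      by (simp add: sum_c_coef_I G0_def l_def algebra_simps)
    \<comment> \<open>The bracket with the two orthogonality counts is the one that
      \<open>nu_n_perp\<close> relates to \<open>nu\<close>, so the common factor
      \<open>p ^ l\<close> can be cancelled.\<close>
    finally have "of_nat p ^ l * (of_nat p ^ k * ?S) = of_nat p ^ l * (of_nat (nu ?n k (?n - l) p) * G0)"
      using nu_n_perp[OF assms(2) _ True, of k] by (simp add: mult_ac)
    then have "of_nat p ^ k * ?S = of_nat (nu ?n k (?n - l) p) * G0" using p0 by simp
    then show ?thesis unfolding LHS derivL AL l_def[symmetric] by (simp add: mult_ac)
  qed
qed

end
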